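(* Let $G$ be a complex Lie group and let $F$ be a left invariant complex Finsler metric on $G$. Then the complex spray $\chi=w^i\delta_{z^i}$ of $F$, defined on $T^{1,0}G\setminus 0$, extends to the holomorphic tangent field $$\chi=u^i\widetilde{U}_i=v^i\widetilde{V}_i$$ on $T^{1,0}G$. Furthermore, when $\chi$ is viewed as a real tangent field on $TG$, it coincides with the canonical bi-invariant spray structure on $G$.
   Context: Conventions: repeated indices are summed. $M$ is a complex manifold of complex dimension $n>0$ with complex structure $J$; for a holomorphic local coordinate $z=(z^1,\dots,z^n)$ on $M$, $(z,w)=(z^1,\dots,z^n,w^1,\dots,w^n)$ denotes the induced holomorphic coordinate on the holomorphic tangent bundle $T^{1,0}M$, representing $w^i\partial_{z^i}\in T^{1,0}_zM$. $T^{1,0}M\setminus 0$ is the complement of the zero section. Identification $\cdot^\circ$: the real bundle isomorphism $\cdot^\circ:T^{1,0}M\to TM$, $V\mapsto V^\circ=V+\overline V$, with inverse $V=\tfrac12(V^\circ-\sqrt{-1}J(V^\circ))$, identifies $T^{1,0}M$ with $TM$ and tangent fields of type $(1,0)$ with real tangent fields; it is also used on the complex manifold $T^{1,0}M\cong TM$. A $(1,0)$ field $\chi$ on $T^{1,0}M$ is "viewed as a real tangent field on $TM$" as $\chi^\circ$. Lift: for a real tangent field $X$ on $M$ with local flow $\rho_t$, its lift to $TM$ is $\widetilde X=\frac{d}{dt}\big|_{t=0}(\rho_t)_*$. For a $(1,0)$ field $V$ on $M$, its lift $\widetilde V$ is the $(1,0)$ field on $T^{1,0}M\cong TM$ with $(\widetilde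 V)^\circ=\widetilde{V^\circ}$. Complex Finsler metric on $M$: a continuous function $F:T^{1,0}M\to[0,+\infty)$ such that (1) $F$ is positive and smooth on $T^{1,0}M\setminus 0$; (2) $F(z,\lambda w)=|\lambda|F(z,w)$ for $\lambda\in\mathbb{C}$; (3) with $\mathrm{G}=F^2$, $(\mathrm{G}_{i\overline{j}})=(\partial_{w^i}\partial_{\overline{w}^j}\mathrm{G})$ is positive definite on $T^{1,0}M\setminus 0$. Let $(\mathrm{G}^{\overline{i}j})$ be the inverse matrix, $\mathrm{G}_{k\overline{j}}\mathrm{G}^{\overline{j}i}=\delta^i_k$, and $N^i_k=\mathrm{G}^{\overline{j}i}\,\partial_{\overline{w}^j}\partial_{z^k}\mathrm{G}$, $\delta_{z^i}=\partial_{z^i}-N^j_i\partial_{w^j}$. The complex spray $\chi=w^i\delta_{z^i}$ is a globally defined $(1,0)$ tangent field on $T^{1,0}M\setminus0$. A complex Lie group is a complex manifold with a group structure whose multiplication and inversion are holomorphic. $F$ on $G$ is left invariant if $F((L_g)_*w)=F(w)$ for all $g\in G$, $w\in T^{1,0}G$, where $L_g(g')=gg'$. Fix a complex basis $\{e_1,\dots,e_n\}$ of $\mathfrak g=\mathrm{Lie}(G)=T^{1,0}_eG$. $U_i$ (resp. $V_i$) is the left (resp. right) invariant $(1,0)$ tangent field on $G$ with $U_i(e)=V_i(e)=e_i$ (invariance of a $(1,0)$ field $V$ means that of $V^\circ$), and $\widetilde U_i,\widetilde V_i$ are their lifts to $T^{1,0}G$. The functions $u^i,v^i$ on $T^{1,0}G$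 are defined by $w=u^iU_i(g)=v^iV_i(g)$ for $w\in T^{1,0}_gG$. Canonical bi-invariant spray structure on a real Lie group $G$: the vector field $\sum_a x^a\widetilde{X_a}$ on $TG$, where $\{X_a\}$ is a basis of the left invariant real tangent fields, $\widetilde{X_a}$ are their lifts to $TG$, and $x^a$ are the functions on $TG$ with $y=\sum_a x^a(y)X_a(g)$ for $y\in T_gG$. It does not depend on the basis, and the same vector field is obtained from a basis of right invariant fields. Here the complex Lie group $G$ is regarded as a real Lie group. *)

theory Defs
  imports "HOL-Analysis.Analysis" "HOL-Algebra.Group"
begin

section \<open>Calculus on \<open>\<complex>\<^sup>n\<close>\<close>

definition holo_on :: "(complex^'n \<Rightarrow> complex^'m) \<Rightarrow> (complex^'n) set \<Rightarrow> bool" where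
  "holo_on f S \<longleftrightarrow> (\<forall>x\<in>S. \<exists>f'. (f has_derivative f') (at x) \<and> (\<forall>a v. f' (a *s v) = a *s f' v))"

text \<open>\<open>Ck_on\<close> and \<open>smooth_on\<close> are only used for functions on open subsets of
  finite-dimensional spaces.\<close>

primrec Ck_on :: "nat \<Rightarrow> ('a::real_normed_vector \<Rightarrow> 'b::real_normed_vector) \<Rightarrow> 'a set \<Rightarrow> bool" where
  "Ck_on 0 f S = continuous_on S f"
| "Ck_on (Suc k) f S =
    ((\<forall>x\<in>S. f differentiable (at x)) \<and> (\<forall>v. Ck_on k (\<lambda>x. frechet_derivative f (at x) v) S))"

definition smooth_on :: "('a::real_normed_vector \<Rightarrow> 'b::real_normed_vector) \<Rightarrow> 'a set \<Rightarrow> bool" where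
  "smooth_on f S \<longleftrightarrow> (\<forall>k. Ck_on k f S)"

text \<open>The Wirtinger derivatives \<open>\<partial>/\<partial>z\<^sup>i\<close> and \<open>\<partial>/\<partial>\<close>(conjugate of \<open>z\<^sup>i\<close>), with \<open>frechet_derivative\<close>
  the real derivative.\<close>

definition wirt :: "'n \<Rightarrow> (complex^'n::finite \<Rightarrow> complex) \<Rightarrow> complex^'n \<Rightarrow> complex" where
  "wirt i h x = (frechet_derivative h (at x) (axis i 1)
                  - \<i> * frechet_derivative h (at x) (axis i \<i>)) / 2"

definition wirt_bar :: "'n \<Rightarrow> (complex^'n::finite \<Rightarrow> complex) \<Rightarrow> complex^'n \<Rightarrow> complex" where
  "wirt_bar i h x = (frechet_derivative h (at x) (axis i 1)
                  + \<i> * frechet_derivative h (at x) (axis i \<i>)) / 2"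


section \<open>Complex manifolds\<close>

type_synonym ('a, 'n) chart = "'a set \<times> ('a \<Rightarrow> complex^'n)"
type_synonym ('a, 'n) atlas = "('a, 'n) chart set"

definition points :: "('a, 'n) atlas \<Rightarrow> 'a set" where
  "points A = (\<Union>c\<in>A. fst c)"

definition chart_inv :: "('a, 'n) chart \<Rightarrow> complex^'n \<Rightarrow> 'a" where
  "chart_inv c = inv_into (fst c) (snd c)"

definition complex_manifold :: "'a topology \<Rightarrow> ('a, 'n::finite) atlas \<Rightarrow> bool" where
  "complex_manifold X A \<longleftrightarrow>
     Hausdorff_space X \<and> second_countable X \<and> topspace X = points A \<and>
     (\<forall>c\<in>A. openin X (fst c) \<and> open (snd c ` fst c) \<and>
        homeomorphic_map (subtopology X (fst c)) (top_of_set (snd c ` fst c)) (snd c)) \<and>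
     (\<forall>c\<in>A. \<forall>d\<in>A. holo_on (snd d \<circ> chart_inv c) (snd c ` (fst c \<inter> fst d)))"

definition holo_map :: "('a, 'n::finite) atlas \<Rightarrow> ('b, 'm::finite) atlas \<Rightarrow> ('a \<Rightarrow> 'b) \<Rightarrow> bool" where
  "holo_map A B \<Phi> \<longleftrightarrow>
     (\<forall>p\<in>points A. \<exists>c\<in>A. \<exists>d\<in>B. \<exists>W. open W \<and> W \<subseteq> snd c ` fst c \<and> p \<in> fst c \<and> snd c p \<in> W \<and>
        (\<forall>x\<in>W. \<Phi> (chart_inv c x) \<in> fst d) \<and> holo_on (snd d \<circ> \<Phi> \<circ> chart_inv c) W)"

definition prod_atlas :: "('a, 'n::finite) atlas \<Rightarrow> ('b, 'm::finite) atlas \<Rightarrow> ('a \<times> 'b, 'n + 'm) atlas" where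
  "prod_atlas A B =
     (\<lambda>(c, d). (fst c \<times> fst d,
        \<lambda>p. \<chi> k. case k of Inl i \<Rightarrow> snd c (fst p) $ i | Inr j \<Rightarrow> snd d (snd p) $ j)) ` (A \<times> B)"

definition mdiff :: "('a, 'n::finite) atlas \<Rightarrow> ('a \<Rightarrow> complex) \<Rightarrow> 'a \<Rightarrow> bool" where
  "mdiff A f p \<longleftrightarrow> (\<exists>c\<in>A. p \<in> fst c \<and> (f \<circ> chart_inv c) differentiable (at (snd c p)))"


section \<open>Tangent vectors and tangent bundles\<close>

text \<open>
  A complexified tangent vector at \<open>p\<close> is the first-order differential operator
  \<open>f \<mapsto> V f\<close> on complex-valued functions that are (real) differentiable at \<open>p\<close>.
  To make it a total function, so that equality of vectors is equality of functions, it is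
  set to \<open>0\<close> on all other \<open>f\<close>. Functions on a manifold are total functions on the ambient type;
  only their values near \<open>p\<close> in the manifold matter.
\<close>

type_synonym 'a tvec = "('a \<Rightarrow> complex) \<Rightarrow> complex"
type_synonym 'a tfield = "'a \<Rightarrow> 'a tvec"

definition pd :: "('a, 'n::finite) chart \<Rightarrow> 'n \<Rightarrow> 'a tfield" where
  "pd c i p f = (if (f \<circ> chart_inv c) differentiable (at (snd c p))
                 then wirt i (f \<circ> chart_inv c) (snd c p) else 0)"

text \<open>Writing \<open>z = x + iy\<close>, \<open>real_vec c v p\<close> is the real tangent vector with components
  \<open>Re v\<^sup>j\<close> along \<open>\<partial>/\<partial>x\<^sup>j\<close> and \<open>Im v\<^sup>j\<close> along \<open>\<partial>/\<partial>y\<^sup>j\<close>.\<close>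

definition real_vec :: "('a, 'n::finite) chart \<Rightarrow> complex^'n \<Rightarrow> 'a tfield" where
  "real_vec c v p f = (if (f \<circ> chart_inv c) differentiable (at (snd c p))
                 then frechet_derivative (f \<circ> chart_inv c) (at (snd c p)) v else 0)"

definition T10_space :: "('a, 'n::finite) atlas \<Rightarrow> 'a \<Rightarrow> 'a tvec set" where
  "T10_space A p = {D. \<exists>c\<in>A. p \<in> fst c \<and>
     (\<exists>w::complex^'n. D = (\<lambda>f. \<Sum>i\<in>UNIV. w $ i * pd c i p f))}"

definition TR_space :: "('a, 'n::finite) atlas \<Rightarrow> 'a \<Rightarrow> 'a tvec set" where
  "TR_space A p = {D. \<exists>c\<in>A. p \<in> fst c \<and> (\<exists>v. D = real_vec c v p)}"

definition T10 :: "('a, 'n::finite) atlas \<Rightarrow> ('a \<times> 'a tvec) set" where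
  "T10 A = (SIGMA p:points A. T10_space A p)"

definition TR :: "('a, 'n::finite) atlas \<Rightarrow> ('a \<times> 'a tvec) set" where
  "TR A = (SIGMA p:points A. TR_space A p)"

text \<open>The induced coordinates: \<open>Inl i\<close> is the index of \<open>z\<^sup>i\<close> and \<open>Inr i\<close> that of \<open>w\<^sup>i\<close>,
  the component \<open>w\<^sup>i = V(z\<^sup>i)\<close> of \<open>V = w\<^sup>i \<partial>/\<partial>z\<^sup>i\<close>. On the real tangent bundle
  \<open>w\<^sup>i = Y(x\<^sup>i) + i Y(y\<^sup>i)\<close>, so these are also the usual induced (real) coordinates of \<open>TM\<close>,
  packed into complex numbers.\<close>

definition induced_coord :: "('a, 'n::finite) chart \<Rightarrow> 'a \<times> 'a tvec \<Rightarrow> complex^('n + 'n)" where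
  "induced_coord c y = (\<chi> k. case k of Inl i \<Rightarrow> snd c (fst y) $ i
                                     | Inr i \<Rightarrow> snd y (\<lambda>q. snd c q $ i))"

definition T10_chart :: "('a, 'n::finite) atlas \<Rightarrow> ('a, 'n) chart \<Rightarrow> ('a \<times> 'a tvec, 'n + 'n) chart" where
  "T10_chart A c = ({y \<in> T10 A. fst y \<in> fst c}, induced_coord c)"

definition T10_atlas :: "('a, 'n::finite) atlas \<Rightarrow> ('a \<times> 'a tvec, 'n + 'n) atlas" where
  "T10_atlas A = T10_chart A ` A"

definition TR_atlas :: "('a, 'n::finite) atlas \<Rightarrow> ('a \<times> 'a tvec, 'n + 'n) atlas" where
  "TR_atlas A = (\<lambda>c. ({y \<in> TR A. fst y \<in> fst c}, induced_coord c)) ` A"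

definition T10_field :: "('a, 'n::finite) atlas \<Rightarrow> 'a tfield \<Rightarrow> bool" where
  "T10_field A Z \<longleftrightarrow> (\<forall>p\<in>points A. Z p \<in> T10_space A p)"

definition TR_field :: "('a, 'n::finite) atlas \<Rightarrow> 'a tfield \<Rightarrow> bool" where
  "TR_field A Z \<longleftrightarrow> (\<forall>p\<in>points A. Z p \<in> TR_space A p)"

definition holomorphic_field :: "('a, 'n::finite) atlas \<Rightarrow> 'a tfield \<Rightarrow> bool" where
  "holomorphic_field A Z \<longleftrightarrow> T10_field A Z \<and>
     (\<forall>c\<in>A. holo_on (\<lambda>x. \<chi> i. Z (chart_inv c x) (\<lambda>q. snd c q $ i)) (snd c ` fst c))"

text \<open>The differential of \<open>\<Phi>\<close>, acting on a bundle element \<open>y\<close>; \<open>B\<close> is the atlas of the target.\<close>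

definition push :: "('b, 'm::finite) atlas \<Rightarrow> ('a \<Rightarrow> 'b) \<Rightarrow> 'a \<times> 'a tvec \<Rightarrow> 'b \<times> 'b tvec" where
  "push B \<Phi> y = (\<Phi> (fst y), \<lambda>f. if mdiff B f (\<Phi> (fst y)) then snd y (f \<circ> \<Phi>) else 0)"

definition conj_vec :: "'a tvec \<Rightarrow> 'a tvec" where
  "conj_vec D f = cnj (D (\<lambda>p. cnj (f p)))"

text \<open>The identification of \<open>T\<^sup>1\<^sup>,\<^sup>0M\<close> with \<open>TM\<close>: on vectors, and as a map of bundles.\<close>

definition circ :: "'a tvec \<Rightarrow> 'a tvec" where
  "circ D f = D f + conj_vec D f"

definition circ_map :: "'a \<times> 'a tvec \<Rightarrow> 'a \<times> 'a tvec" where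
  "circ_map y = (fst y, circ (snd y))"

text \<open>For a vector \<open>Z\<close> of type (1,0) tangent to \<open>T\<^sup>1\<^sup>,\<^sup>0M\<close> at \<open>w\<close>, the real vector \<open>circ Z\<close>
  transported along \<open>circ_map\<close> to a vector tangent to \<open>TM\<close> at \<open>circ_map w\<close>.\<close>

definition circ_TM :: "('a, 'n::finite) atlas \<Rightarrow> 'a \<times> 'a tvec \<Rightarrow> ('a \<times> 'a tvec) tvec \<Rightarrow> ('a \<times> 'a tvec) tvec" where
  "circ_TM A w Z = snd (push (TR_atlas A) circ_map (w, circ Z))"

definition field_on_TM :: "('a, 'n::finite) atlas \<Rightarrow> ('a \<times> 'a tvec) tfield \<Rightarrow> ('a \<times> 'a tvec) tfield" where
  "field_on_TM A Z y = (let w = inv_into (T10 A) circ_map y in circ_TM A w (Z w))"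


section \<open>Flows and lifts\<close>

text \<open>As \<open>f\<close> ranges over all functions differentiable at \<open>\<gamma> t\<close>, this includes continuity of
  \<open>\<gamma>\<close> at \<open>t\<close> in the manifold topology.\<close>

definition has_velocity :: "('a, 'n::finite) atlas \<Rightarrow> (real \<Rightarrow> 'a) \<Rightarrow> 'a tvec \<Rightarrow> real \<Rightarrow> bool" where
  "has_velocity A \<gamma> D t \<longleftrightarrow>
     (\<forall>f. mdiff A f (\<gamma> t) \<longrightarrow> ((\<lambda>s. f (\<gamma> s)) has_vector_derivative D f) (at t))"

definition local_flow :: "('a, 'n::finite) atlas \<Rightarrow> 'a tfield \<Rightarrow> 'a \<Rightarrow> (real \<Rightarrow> 'a \<Rightarrow> 'a) \<Rightarrow> bool" where
  "local_flow A X p \<rho> \<longleftrightarrow>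
     (\<exists>\<epsilon>>0. \<exists>c\<in>A. \<exists>W. W \<subseteq> fst c \<and> open (snd c ` W) \<and> p \<in> W \<and>
        (\<forall>q\<in>W. \<rho> 0 q = q \<and>
           (\<forall>t. \<bar>t\<bar> < \<epsilon> \<longrightarrow> \<rho> t q \<in> points A \<and> has_velocity A (\<lambda>s. \<rho> s q) (X (\<rho> t q)) t)))"

definition lift :: "('a, 'n::finite) atlas \<Rightarrow> 'a tfield \<Rightarrow> ('a \<times> 'a tvec) tfield" where
  "lift A X y f = (if mdiff (TR_atlas A) f y
     then THE d. \<exists>\<rho>. local_flow A X (fst y) \<rho> \<and>
                     ((\<lambda>t. f (push A (\<rho> t) y)) has_vector_derivative d) (at 0)
     else 0)"

definition lift10 :: "('a, 'n::finite) atlas \<Rightarrow> 'a tfield \<Rightarrow> ('a \<times> 'a tvec) tfield" where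
  "lift10 A V w = (THE Z. Z \<in> T10_space (T10_atlas A) w \<and>
     circ_TM A w Z = lift A (\<lambda>p. circ (V p)) (circ_map w))"


section \<open>Complex Finsler metrics and the complex spray\<close>

definition Levi :: "(complex^('n + 'n) \<Rightarrow> complex) \<Rightarrow> complex^('n + 'n) \<Rightarrow> complex^'n::finite^'n" where
  "Levi h x = (\<chi> i j. wirt (Inr i) (wirt_bar (Inr j) h) x)"

definition pos_def_hermitian :: "complex^'n::finite^'n \<Rightarrow> bool" where
  "pos_def_hermitian H \<longleftrightarrow> (\<forall>i j. H $ j $ i = cnj (H $ i $ j)) \<and>
     (\<forall>\<xi>. \<xi> \<noteq> 0 \<longrightarrow> 0 < Re (\<Sum>i\<in>UNIV. \<Sum>j\<in>UNIV. H $ i $ j * \<xi> $ i * cnj (\<xi> $ j)))"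

text \<open>The function \<open>G = F\<^sup>2\<close> in the coordinates \<open>(z, w)\<close> induced by \<open>c\<close>.\<close>

definition Gfun :: "('a, 'n::finite) atlas \<Rightarrow> ('a, 'n) chart \<Rightarrow> ('a \<times> 'a tvec \<Rightarrow> real)
    \<Rightarrow> complex^('n + 'n) \<Rightarrow> complex" where
  "Gfun A c F x = of_real ((F (chart_inv (T10_chart A c) x))\<^sup>2)"

definition slit :: "('a \<times> 'a tvec) set" where
  "slit = {y. snd y \<noteq> (\<lambda>f. 0)}"

definition complex_finsler_metric :: "('a, 'n::finite) atlas \<Rightarrow> ('a \<times> 'a tvec \<Rightarrow> real) \<Rightarrow> bool" where
  "complex_finsler_metric A F \<longleftrightarrow>
     (\<forall>y\<in>T10 A. 0 \<le> F y) \<and>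
     (\<forall>k\<in>T10_atlas A. continuous_on (snd k ` fst k) (F \<circ> chart_inv k)) \<and>
     (\<forall>y\<in>T10 A \<inter> slit. 0 < F y) \<and>
     (\<forall>k\<in>T10_atlas A. smooth_on (F \<circ> chart_inv k) (snd k ` (fst k \<inter> slit))) \<and>
     (\<forall>p V a. (p, V) \<in> T10 A \<longrightarrow> F (p, \<lambda>f. a * V f) = cmod a * F (p, V)) \<and>
     (\<forall>c\<in>A. \<forall>y\<in>T10 A \<inter> slit. fst y \<in> fst c \<longrightarrow>
        pos_def_hermitian (Levi (Gfun A c F) (induced_coord c y)))"

definition Ncoef :: "(complex^('n + 'n) \<Rightarrow> complex) \<Rightarrow> complex^('n + 'n) \<Rightarrow> 'n::finite \<Rightarrow> 'n \<Rightarrow> complex" where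
  "Ncoef h x i k = (\<Sum>j\<in>UNIV. matrix_inv (Levi h x) $ j $ i * wirt_bar (Inr j) (wirt (Inl k) h) x)"

definition delta_z :: "('a, 'n::finite) atlas \<Rightarrow> ('a \<times> 'a tvec \<Rightarrow> real) \<Rightarrow> ('a, 'n) chart \<Rightarrow> 'n
    \<Rightarrow> ('a \<times> 'a tvec) tfield" where
  "delta_z A F c i y f = pd (T10_chart A c) (Inl i) y f
     - (\<Sum>j\<in>UNIV. Ncoef (Gfun A c F) (induced_coord c y) j i * pd (T10_chart A c) (Inr j) y f)"

definition complex_spray :: "('a, 'n::finite) atlas \<Rightarrow> ('a \<times> 'a tvec \<Rightarrow> real) \<Rightarrow> ('a, 'n) chart
    \<Rightarrow> ('a \<times> 'a tvec) tfield" where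
  "complex_spray A F c y f = (\<Sum>i\<in>UNIV. induced_coord c y $ Inr i * delta_z A F c i y f)"


section \<open>Complex Lie groups\<close>

definition complex_lie_group :: "'a topology \<Rightarrow> ('a, 'n::finite) atlas \<Rightarrow> ('a, 'b) monoid_scheme \<Rightarrow> bool" where
  "complex_lie_group X A G \<longleftrightarrow>
     complex_manifold X A \<and> group G \<and> carrier G = points A \<and>
     holo_map (prod_atlas A A) A (\<lambda>(g, h). g \<otimes>\<^bsub>G\<^esub> h) \<and>
     holo_map A A (\<lambda>g. inv\<^bsub>G\<^esub> g)"

definition left_invariant :: "('a, 'n::finite) atlas \<Rightarrow> ('a, 'b) monoid_scheme \<Rightarrow> 'a tfield \<Rightarrow> bool" where
  "left_invariant A G X \<longleftrightarrow>
     (\<forall>g\<in>carrier G. \<forall>p\<in>carrier G.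
        push A (\<lambda>h. g \<otimes>\<^bsub>G\<^esub> h) (p, X p) = (g \<otimes>\<^bsub>G\<^esub> p, X (g \<otimes>\<^bsub>G\<^esub> p)))"

definition right_invariant :: "('a, 'n::finite) atlas \<Rightarrow> ('a, 'b) monoid_scheme \<Rightarrow> 'a tfield \<Rightarrow> bool" where
  "right_invariant A G X \<longleftrightarrow>
     (\<forall>g\<in>carrier G. \<forall>p\<in>carrier G.
        push A (\<lambda>h. h \<otimes>\<^bsub>G\<^esub> g) (p, X p) = (p \<otimes>\<^bsub>G\<^esub> g, X (p \<otimes>\<^bsub>G\<^esub> g)))"

definition left_invariant_metric :: "('a, 'n::finite) atlas \<Rightarrow> ('a, 'b) monoid_scheme
    \<Rightarrow> ('a \<times> 'a tvec \<Rightarrow> real) \<Rightarrow> bool" where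
  "left_invariant_metric A G F \<longleftrightarrow>
     (\<forall>g\<in>carrier G. \<forall>y\<in>T10 A. F (push A (\<lambda>h. g \<otimes>\<^bsub>G\<^esub> h) y) = F y)"

definition complex_basis :: "('a, 'n::finite) atlas \<Rightarrow> 'a \<Rightarrow> ('n \<Rightarrow> 'a tvec) \<Rightarrow> bool" where
  "complex_basis A p e \<longleftrightarrow> (\<forall>i. e i \<in> T10_space A p) \<and>
     (\<forall>D\<in>T10_space A p. \<exists>!a::complex^'n. D = (\<lambda>f. \<Sum>i\<in>UNIV. a $ i * e i f))"

definition frame_coord :: "('n::finite \<Rightarrow> 'a tfield) \<Rightarrow> 'a \<times> 'a tvec \<Rightarrow> complex^'n" where
  "frame_coord U w = (THE u. snd w = (\<lambda>f. \<Sum>i\<in>UNIV. u $ i * U i (fst w) f))"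

text \<open>The field \<open>u\<^sup>i \<cdot> lift(U\<^sub>i)\<close> on \<open>T\<^sup>1\<^sup>,\<^sup>0G\<close>.\<close>

definition frame_spray :: "('a, 'n::finite) atlas \<Rightarrow> ('n \<Rightarrow> 'a tfield) \<Rightarrow> ('a \<times> 'a tvec) tfield" where
  "frame_spray A U w f = (\<Sum>i\<in>UNIV. frame_coord U w $ i * lift10 A (U i) w f)"

text \<open>The real dimension of \<open>G\<close> is twice the complex one, so that a basis of the left invariant
  real fields is indexed by \<open>'n + 'n\<close>.\<close>

definition left_invariant_real_basis :: "('a, 'n::finite) atlas \<Rightarrow> ('a, 'b) monoid_scheme
    \<Rightarrow> ('n + 'n \<Rightarrow> 'a tfield) \<Rightarrow> bool" where
  "left_invariant_real_basis A G X \<longleftrightarrow>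
     (\<forall>k. TR_field A (X k) \<and> left_invariant A G (X k)) \<and>
     (\<forall>Y. TR_field A Y \<and> left_invariant A G Y \<longrightarrow>
        (\<exists>!a::real^('n + 'n). \<forall>g\<in>carrier G. Y g = (\<lambda>f. \<Sum>k\<in>UNIV. of_real (a $ k) * X k g f)))"

definition real_frame_coord :: "('m::finite \<Rightarrow> 'a tfield) \<Rightarrow> 'a \<times> 'a tvec \<Rightarrow> real^'m" where
  "real_frame_coord X y = (THE x. snd y = (\<lambda>f. \<Sum>k\<in>UNIV. of_real (x $ k) * X k (fst y) f))"

text \<open>The canonical bi-invariant spray structure, computed in the basis \<open>X\<close>.\<close>

definition canonical_spray :: "('a, 'n::finite) atlas \<Rightarrow> ('n + 'n \<Rightarrow> 'a tfield) \<Rightarrow> ('a \<times> 'a tvec) tfield" where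
  "canonical_spray A X y f = (\<Sum>k\<in>UNIV. of_real (real_frame_coord X y $ k) * lift A (X k) y f)"

end

theory Submission
  imports Defs "HOL-Complex_Analysis.Cauchy_Integral_Formula"
begin

text \<open>
  The flow of a left invariant field is right multiplication by a curve through the identity. In
  charts the multiplication is a holomorphic function \<open>m (x, b)\<close>, so the field with value \<open>\<eta>\<close> at the
  identity has the coefficients \<open>Z x = \<partial>\<^sub>b m (x, e) \<eta>\<close>, and by symmetry of second derivatives its lift
  at \<open>(x, w)\<close> has the coefficients \<open>(Z x, DZ x w)\<close>. Hence the spray of any left invariant frame has
  the coefficients \<open>(w, DZ x w)\<close>, where \<open>\<eta>\<close> is chosen such that \<open>Z x = w\<close>; no frame appears in this
  expression. Right invariant fields are the left invariant ones of the opposite group, and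
  \<open>(a g) b = a (g b)\<close> identifies the two sprays: both are the same mixed derivative of \<open>a g b\<close>.

  A left invariant metric is preserved by the flows of right invariant fields, so the lifts of
  these fields annihilate \<open>F\<^sup>2\<close>. Taking the part of type (1,0) and then a derivative in the direction
  of the conjugate of \<open>w\<^sup>j\<close>, under which the coefficients of the lift are constant, gives the linear
  system that determines \<open>w\<^sup>k N\<^sup>i\<^sub>k\<close>.
\<close>

section \<open>Holomorphic functions of several variables\<close>

text \<open>\<open>holo_on\<close> asks only for a complex linear derivative at each point, without
  any continuity; yet mixed second derivatives of the multiplication must be interchanged, and the
  resulting coefficients must again be holomorphic. Cauchy's formula along complex lines supplies
  this regularity. A second obstacle is that \<open>lift\<close> is a definite description over all
  local flows, with no regularity in the initial point required of them: its value is determined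
  only once a flow has been constructed and any two flows have been shown to agree near the point.
  Because a flow is right multiplication by one curve, a differential equation has to be solved at
  the identity only, and smooth dependence on initial values never enters. Uniqueness must be proved
  on the manifold, across charts, and there the Hausdorff property is used. Finally, the metric is
  only real differentiable. Invariance makes one real derivative vanish; the same for
  \<open>\<i>\<close> times the field gives a second one, and together they say that the (1,0) part
  vanishes.\<close>

abbreviation FD :: "('a::real_normed_vector \<Rightarrow> 'b::real_normed_vector) \<Rightarrow> 'a \<Rightarrow> 'a \<Rightarrow> 'b" where
  "FD f x \<equiv> frechet_derivative f (at x)"

lemma FD_eq: "(f has_derivative f') (at x) \<Longrightarrow> FD f x = f'"
  by (rule frechet_derivative_at[symmetric])

lemma FD_works: "f differentiable (at x) \<Longrightarrow> (f has_derivative FD f x) (at x)"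
  by (simp add: frechet_derivative_works)

lemma FD_linear: "f differentiable (at x) \<Longrightarrow> bounded_linear (FD f x)"
  using FD_works has_derivative_bounded_linear by blast

lemma has_derivative_cong_ev:
  assumes ev: "eventually (\<lambda>y. f y = g y) (nhds x)" and f: "(f has_derivative D) (at x)"
  shows "(g has_derivative D) (at x)"
  using has_derivative_transform_eventually[OF f, of g] ev eventually_nhds_x_imp_x[OF ev]
    eventually_nhds_conv_at by fastforce

lemma differentiable_cong_ev:
  assumes ev: "eventually (\<lambda>y. f y = g y) (nhds x)"
  shows "f differentiable (at x) \<longleftrightarrow> g differentiable (at x)" "FD f x = FD g x"
proof -
  have "eventually (\<lambda>y. g y = f y) (nhds x)"
    using ev by eventually_elim simp
  then have *: "(f has_derivative D) (at x) \<longleftrightarrow> (g has_derivative D) (at x)" for D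
    using has_derivative_cong_ev ev by blast
  show "f differentiable (at x) \<longleftrightarrow> g differentiable (at x)"
    unfolding differentiable_def * ..
  show "FD f x = FD g x"
    unfolding frechet_derivative_def * ..
qed

lemma differentiable_cong_open:
  assumes "open S" "x \<in> S" "\<And>y. y \<in> S \<Longrightarrow> f y = g y"
  shows "f differentiable (at x) \<longleftrightarrow> g differentiable (at x)" "FD f x = FD g x"
  using differentiable_cong_ev[of f g x] assms eventually_nhds by (blast+)

lemma norm_vmult: "norm (a *s (v::complex^'n)) = cmod a * norm v"
  by (simp add: norm_vec_def L2_set_def norm_mult power_mult_distrib real_sqrt_mult
      flip: sum_distrib_left)

lemma bounded_bilinear_vmult: "bounded_bilinear (\<lambda>(a::complex) (v::complex^'n). a *s v)"
proof
  show "\<exists>K. \<forall>a b. norm (a *s b :: complex^'n) \<le> norm a * norm b * K"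
    by (rule exI[of _ 1]) (simp add: norm_vmult)
qed (auto simp: vec_eq_iff algebra_simps)

lemmas has_derivative_vmult [derivative_intros] = bounded_bilinear.FDERIV[OF bounded_bilinear_vmult]
lemmas continuous_on_vmult [continuous_intros] = bounded_bilinear.continuous_on[OF bounded_bilinear_vmult]
lemmas bounded_linear_vmult_right = bounded_bilinear.bounded_linear_right[OF bounded_bilinear_vmult]
lemmas bounded_linear_vmult_left = bounded_bilinear.bounded_linear_left[OF bounded_bilinear_vmult]

lemma of_real_vmult: "of_real r *s (v::complex^'n) = r *\<^sub>R v"
  by (simp add: vec_eq_iff scaleR_conv_of_real[symmetric])

lemma holo_onI:
  assumes "\<And>x. x \<in> S \<Longrightarrow> (f has_derivative f' x) (at x)"
    and "\<And>x a v. x \<in> S \<Longrightarrow> f' x (a *s v) = a *s f' x v"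
  shows "holo_on f S"
  using assms unfolding holo_on_def by blast

lemma holo_onD:
  assumes "holo_on f S" "x \<in> S"
  shows "f differentiable (at x)" "(f has_derivative FD f x) (at x)"
    "FD f x (a *s v) = a *s FD f x v"
  using assms FD_eq[of f _ x] unfolding holo_on_def differentiable_def by blast+

lemma holo_on_subset: "holo_on f S \<Longrightarrow> T \<subseteq> S \<Longrightarrow> holo_on f T"
  unfolding holo_on_def by blast

lemma holo_on_cong:
  assumes "holo_on f S" "open S" "\<And>x. x \<in> S \<Longrightarrow> f x = g x"
  shows "holo_on g S"
proof (rule holo_onI)
  fix x assume x: "x \<in> S"
  show "(g has_derivative FD f x) (at x)"
    using has_derivative_transform_within_open[OF holo_onD(2)[OF assms(1) x] assms(2) x] assms(3) by auto
  show "FD f x (a *s v) = a *s FD f x v" for a v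
    by (rule holo_onD(3)[OF assms(1) x])
qed

lemma holo_on_locally:
  assumes "\<And>x. x \<in> S \<Longrightarrow> \<exists>T. x \<in> T \<and> holo_on f T"
  shows "holo_on f S"
  using assms unfolding holo_on_def by blast

lemma holo_on_continuous: "holo_on f S \<Longrightarrow> continuous_on S f"
  by (meson continuous_at_imp_continuous_on has_derivative_continuous holo_on_def)

lemma holo_on_compose:
  assumes "holo_on f S" "holo_on g T" "\<And>x. x \<in> S \<Longrightarrow> f x \<in> T"
  shows "holo_on (\<lambda>x. g (f x)) S"
  by (rule holo_onI[where f'="\<lambda>x v. FD g (f x) (FD f x v)"])
    (use assms in \<open>auto intro!: has_derivative_compose[OF holo_onD(2) holo_onD(2)] simp: holo_onD(3)\<close>)

section \<open>Cauchy's formula on complex lines\<close>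

definition circle_pt :: "real \<Rightarrow> real \<Rightarrow> complex" where
  "circle_pt r t = of_real r * exp (2 * of_real pi * \<i> * of_real t)"

lemma cmod_circle_pt [simp]: "r \<ge> 0 \<Longrightarrow> cmod (circle_pt r t) = r"
  by (simp add: circle_pt_def norm_mult)

lemma circle_pt_nz: "r > 0 \<Longrightarrow> circle_pt r t \<noteq> 0"
  by (simp add: circle_pt_def)

lemma continuous_circle_pt [continuous_intros]:
  "continuous_on S f \<Longrightarrow> continuous_on S (\<lambda>x. circle_pt r (f x))"
  unfolding circle_pt_def by (intro continuous_intros)

text \<open>Since this expresses the derivative by values of \<open>f\<close>, the derivative inherits differentiability.\<close>

lemma Cauchy_directional:
  fixes f :: "complex^'n \<Rightarrow> complex^'m"
  assumes f: "holo_on f S" and S: "open S" and r: "r > 0"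
    and sub: "\<And>\<zeta>. cmod \<zeta> \<le> r \<Longrightarrow> x + \<zeta> *s v \<in> S"
  shows "FD f x v = integral {0..1} (\<lambda>t. inverse (circle_pt r t) *s f (x + circle_pt r t *s v))"
proof -
  define T where "T = {\<zeta>. x + \<zeta> *s v \<in> S}"
  have cont_l: "continuous_on UNIV (\<lambda>\<zeta>. x + \<zeta> *s v)"
    by (intro continuous_intros)
  have T: "open T"
    using open_vimage[OF S cont_l] by (simp add: T_def vimage_def)
  have xS: "x \<in> S" using sub[of 0] r by simp
  let ?I = "\<lambda>t. inverse (circle_pt r t) *s f (x + circle_pt r t *s v)"
  have contI: "continuous_on {0..1} ?I"
    by (intro continuous_intros continuous_on_compose2[OF holo_on_continuous[OF f]])
       (use sub r circle_pt_nz[OF r] in \<open>auto\<close>)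
  have comp: "FD f x v $ i = integral {0..1} (\<lambda>t. ?I t $ i)" for i
  proof -
    \<comment> \<open>One component of \<open>f\<close> on the complex line through \<open>x\<close>
      in direction \<open>v\<close>: a holomorphic function of one variable whose derivative at 0 is
      wanted.\<close>
    define g where "g \<zeta> = f (x + \<zeta> *s v) $ i" for \<zeta>
    have gd: "(g has_field_derivative FD f (x + \<zeta> *s v) v $ i) (at \<zeta>)" if "\<zeta> \<in> T" for \<zeta>
    proof -
      have "(f has_derivative FD f (x + \<zeta> *s v)) (at (x + \<zeta> *s v))"
        using holo_onD(2)[OF f] that by (simp add: T_def)
      moreover have "((\<lambda>\<zeta>. x + \<zeta> *s v) has_derivative (\<lambda>h. h *s v)) (at \<zeta>)"
        by (auto intro!: derivative_eq_intros)
      ultimately have "((\<lambda>\<zeta>. f (x + \<zeta> *s v)) has_derivative (\<lambda>h. FD f (x + \<zeta> *s v) (h *s v))) (at \<zeta>)"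
        by (rule has_derivative_compose[rotated])
      from bounded_linear.has_derivative[OF bounded_linear_vec_nth[of i] this]
      have "(g has_derivative (\<lambda>h. FD f (x + \<zeta> *s v) (h *s v) $ i)) (at \<zeta>)"
        by (simp add: g_def[abs_def])
      moreover have "(\<lambda>h. FD f (x + \<zeta> *s v) (h *s v) $ i) = (*) (FD f (x + \<zeta> *s v) v $ i)"
        using holo_onD(3)[OF f] that by (auto simp: T_def fun_eq_iff)
      ultimately show ?thesis by (simp add: has_field_derivative_def)
    qed
    have hol: "g holomorphic_on T"
      using gd holomorphic_on_open[OF T] by blast
    have cb: "cball 0 r \<subseteq> T" using sub by (auto simp: T_def)
    have "contour_integral (circlepath 0 r) (\<lambda>u. g u/(u-0)^2) = (2 * pi * \<i>) * deriv g 0"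
      using cb r hol by (intro Cauchy_contour_integral_circlepath_2)
         (auto intro: holomorphic_on_imp_continuous_on holomorphic_on_subset dest: ball_subset_cball[THEN subsetD])
    \<comment> \<open>With \<open>u = circle_pt r t\<close> one has \<open>du = 2 pi i u dt\<close>,
      which cancels one of the two factors \<open>u\<close> in the denominator and leaves the
      constant that Cauchy's formula divides out.\<close>
    also have "contour_integral (circlepath 0 r) (\<lambda>u. g u/(u-0)^2) =
      integral {0..1} (\<lambda>t. (2 * pi * \<i>) * (?I t $ i))"
      unfolding contour_integral_integral
    proof (rule integral_cong)
      fix t :: real assume t: "t \<in> {0..1}"
      have "vector_derivative (circlepath 0 r) (at t within {0..1}) = 2 * pi * \<i> * r * exp (2 * of_real pi * \<i> * t)"
        using t by (simp add: vector_derivative_circlepath01)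
      moreover have "circlepath 0 r t = circle_pt r t"
        by (simp add: circlepath circle_pt_def)
      moreover have "circle_pt r t \<noteq> 0" using circle_pt_nz r by auto
      ultimately show "g (circlepath 0 r t) / (circlepath 0 r t - 0)\<^sup>2 * vector_derivative (circlepath 0 r) (at t)
          = (2 * pi * \<i>) * (?I t $ i)"
        using has_vector_derivative_circlepath[of 0 r t UNIV, THEN vector_derivative_at]
        by (simp add: g_def circle_pt_def power2_eq_square field_simps)
    qed
    also have "\<dots> = (2 * pi * \<i>) * integral {0..1} (\<lambda>t. ?I t $ i)"
      by (rule integral_mult_right)
    finally have "deriv g 0 = integral {0..1} (\<lambda>t. ?I t $ i)" by simp
    moreover have "deriv g 0 = FD f x v $ i"
      using DERIV_imp_deriv[OF gd[of 0]] xS by (simp add: T_def)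
    ultimately show ?thesis by simp
  qed
  show ?thesis
    unfolding vec_eq_iff comp
    using integral_linear[OF integrable_continuous_real[OF contI] bounded_linear_vec_nth]
    by (simp add: o_def)
qed

text \<open>Supplies one radius for all base points near \<open>x0\<close>. The circle in Cauchy's
  formula can then stay fixed while \<open>x\<close> varies, so that the formula may be
  differentiated under the integral sign.\<close>

lemma Cauchy_nbhd:
  fixes x0 v :: "complex^'n"
  assumes "open S" "x0 \<in> S"
  obtains r \<delta> where "r > 0" "\<delta> > 0" "\<And>x \<zeta>. x \<in> ball x0 \<delta> \<Longrightarrow> cmod \<zeta> \<le> r \<Longrightarrow> x + \<zeta> *s v \<in> S"
proof -
  obtain e where e: "e > 0" "ball x0 e \<subseteq> S" using assms openE by blast
  \<comment> \<open>Half of \<open>e\<close> is reserved for moving \<open>x\<close>, the other half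
    for the circle; the summand 1 covers \<open>v = 0\<close>.\<close>
  define r where "r = e / (2 * (norm v + 1))"
  have r: "r > 0" using e by (auto simp: r_def intro!: divide_pos_pos add_nonneg_pos)
  have rv: "r * norm v < e / 2"
  proof -
    have "r * norm v < r * (norm v + 1)" using r by simp
    also have "\<dots> = e / 2"
    proof -
      have "norm v + 1 > 0" by (simp add: add_nonneg_pos)
      then show ?thesis by (simp add: r_def field_simps)
    qed
    finally show ?thesis .
  qed
  show thesis
  proof (rule that[of r "e/2"])
    fix x \<zeta> assume x: "x \<in> ball x0 (e/2)" and z: "cmod \<zeta> \<le> r"
    have "dist x0 (x + \<zeta> *s v) \<le> dist x0 x + norm (\<zeta> *s v)"
      by (metis add.commute add_diff_cancel_left' dist_norm dist_triangle norm_minus_commute)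
    also have "norm (\<zeta> *s v) \<le> r * norm v" using z by (simp add: norm_vmult mult_right_mono)
    finally show "x + \<zeta> *s v \<in> S" using rv x e by auto
  qed (use r e in auto)
qed

text \<open>A parameter integral with continuous integrand is continuous. This weaker statement has
  to precede \<open>holo_FD\<close>: the Leibniz rule used there needs a continuous derivative of
  the integrand, and that derivative is again given by \<open>FD f\<close>.\<close>

lemma holo_FD_continuous:
  fixes f :: "complex^'n \<Rightarrow> complex^'m"
  assumes f: "holo_on f S" and S: "open S"
  shows "continuous_on S (\<lambda>x. FD f x v)"
proof -
  have "continuous (at x0) (\<lambda>x. FD f x v)" if x0: "x0 \<in> S" for x0
  proof -
    obtain r \<delta> where rd: "r > 0" "\<delta> > 0" "\<And>x \<zeta>. x \<in> ball x0 \<delta> \<Longrightarrow> cmod \<zeta> \<le> r \<Longrightarrow> x + \<zeta> *s v \<in> S"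
      using Cauchy_nbhd[OF S x0, of v] by blast
    let ?I = "\<lambda>x t. inverse (circle_pt r t) *s f (x + circle_pt r t *s v)"
    have "continuous_on (ball x0 \<delta>) (\<lambda>x. integral (cbox 0 1) (?I x))"
      unfolding split_def
      by (intro integral_continuous_on_param, unfold split_def,
          intro continuous_intros continuous_on_compose2[OF holo_on_continuous[OF f]])
         (use rd circle_pt_nz[OF rd(1)] in \<open>auto\<close>)
    then have "continuous_on (ball x0 \<delta>) (\<lambda>x. FD f x v)"
      by (rule continuous_on_eq) (use rd Cauchy_directional[OF f S rd(1)] in \<open>simp add: cbox_interval\<close>)
    then show ?thesis using rd by (simp add: continuous_on_eq_continuous_at)
  qed
  then show ?thesis by (simp add: continuous_at_imp_continuous_on)
qed

text \<open>Cauchy's integral may be differentiated under the integral sign; the result is complex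
  linear as an integral of complex linear maps. Iteration makes holomorphic maps smooth.\<close>

lemma holo_FD:
  fixes f :: "complex^'n \<Rightarrow> complex^'m"
  assumes f: "holo_on f S" and S: "open S"
  shows "holo_on (\<lambda>x. FD f x v) S"
proof (rule holo_on_locally)
  fix x0 assume x0: "x0 \<in> S"
  obtain r \<delta> where rd: "r > 0" "\<delta> > 0" "\<And>x \<zeta>. x \<in> ball x0 \<delta> \<Longrightarrow> cmod \<zeta> \<le> r \<Longrightarrow> x + \<zeta> *s v \<in> S"
    using Cauchy_nbhd[OF S x0, of v] by blast
  define k where "k t = inverse (circle_pt r t)" for t
  let ?I = "\<lambda>x t. k t *s f (x + circle_pt r t *s v)"
  \<comment> \<open>The derivative of the integrand in \<open>x\<close>, packed as a bounded linear
    map because the Leibniz rule integrates the whole derivative.\<close>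
  define fx where "fx x t = Blinfun (\<lambda>h. k t *s FD f (x + circle_pt r t *s v) h)" for x t
  have inS: "x + circle_pt r t *s v \<in> S" if "x \<in> ball x0 \<delta>" for x t
    using rd that by auto
  have fx: "blinfun_apply (fx x t) = (\<lambda>h. k t *s FD f (x + circle_pt r t *s v) h)" if "x \<in> ball x0 \<delta>" for x t
  proof -
    have "bounded_linear (\<lambda>h. k t *s FD f (x + circle_pt r t *s v) h)"
      using bounded_linear_compose[OF bounded_linear_vmult_right FD_linear[OF holo_onD(1)[OF f inS[OF that]]]] .
    then show ?thesis unfolding fx_def by (rule bounded_linear_Blinfun_apply)
  qed
  have k_cont: "continuous_on T (\<lambda>x. k (g x))" if "continuous_on T g" for T :: "'z::t2_space set" and g
    unfolding k_def by (intro continuous_intros that) (use circle_pt_nz[OF rd(1)] in auto)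
  have main: "((\<lambda>x. integral (cbox 0 1) (?I x)) has_derivative integral (cbox 0 1) (fx x)) (at x within ball x0 \<delta>)"
    if x: "x \<in> ball x0 \<delta>" for x
  proof (rule leibniz_rule)
    fix y :: "complex^'n" and t :: real assume y: "y \<in> ball x0 \<delta>"
    show "((\<lambda>x. ?I x t) has_derivative blinfun_apply (fx y t)) (at y within ball x0 \<delta>)"
      unfolding fx[OF y]
      by (rule has_derivative_at_withinI, rule bounded_linear.has_derivative[OF bounded_linear_vmult_right],
          rule has_derivative_eq_rhs, rule has_derivative_compose[where f="\<lambda>x. x + circle_pt r t *s v" and g=f])
        (auto intro!: derivative_eq_intros holo_onD(2)[OF f inS[OF y]])
  next
    fix y assume y: "y \<in> ball x0 \<delta>"
    show "?I y integrable_on cbox 0 1"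
      by (intro integrable_continuous continuous_intros k_cont continuous_on_compose2[OF holo_on_continuous[OF f]])
       (use inS y in auto)
  next
    \<comment> \<open>In finite dimension, continuity of a family of linear maps can be tested on
      single vectors, where \<open>holo_FD_continuous\<close> applies.\<close>
    have "continuous_on (ball x0 \<delta> \<times> cbox 0 1) (\<lambda>z. fx (fst z) (snd z))"
    proof (rule continuous_on_blinfun_componentwise)
      fix i :: "complex^'n"
      have "continuous_on (ball x0 \<delta> \<times> cbox 0 1) (\<lambda>z. k (snd z) *s FD f (fst z + circle_pt r (snd z) *s v) i)"
        by (intro continuous_intros k_cont continuous_on_compose2[OF holo_FD_continuous[OF f S]])
          (use inS in auto)
      then show "continuous_on (ball x0 \<delta> \<times> cbox 0 1) (\<lambda>z. blinfun_apply (fx (fst z) (snd z)) i)"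
        by (rule continuous_on_eq) (auto simp: fx)
    qed
    then show "continuous_on (ball x0 \<delta> \<times> cbox 0 1) (\<lambda>(x, t). fx x t)"
      by (simp add: split_def)
  qed (use x in auto)
  have int_fx: "fx x integrable_on cbox 0 1" if x: "x \<in> ball x0 \<delta>" for x
  proof (rule integrable_continuous, rule continuous_on_blinfun_componentwise)
      fix i :: "complex^'n"
      have "continuous_on (cbox 0 1) (\<lambda>t. k t *s FD f (x + circle_pt r t *s v) i)"
        by (intro continuous_intros k_cont continuous_on_compose2[OF holo_FD_continuous[OF f S]])
          (use inS x in auto)
      then show "continuous_on (cbox 0 1) (\<lambda>t. blinfun_apply (fx x t) i)"
        by (rule continuous_on_eq) (simp add: fx[OF x])
  qed
  have "holo_on (\<lambda>x. integral (cbox 0 1) (?I x)) (ball x0 \<delta>)"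
  proof (rule holo_onI)
    fix x assume x: "x \<in> ball x0 \<delta>"
    show "((\<lambda>x. integral (cbox 0 1) (?I x)) has_derivative integral (cbox 0 1) (fx x)) (at x)"
      using main[OF x] x at_within_open[OF x open_ball] by simp
    fix a w
    have "blinfun_apply (integral (cbox 0 1) (fx x)) (a *s w)
        = integral (cbox 0 1) (\<lambda>t. a *s (k t *s FD f (x + circle_pt r t *s v) w))"
      unfolding blinfun_apply_integral[OF int_fx[OF x]] fx[OF x]
      by (simp add: holo_onD(3)[OF f inS[OF x]] mult.commute)
    also have "\<dots> = a *s integral (cbox 0 1) (\<lambda>t. k t *s FD f (x + circle_pt r t *s v) w)"
    proof -
      have "(\<lambda>t. k t *s FD f (x + circle_pt r t *s v) w) integrable_on cbox 0 1"
        by (intro integrable_continuous continuous_intros k_cont continuous_on_compose2[OF holo_FD_continuous[OF f S]])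
          (use inS x in auto)
      from integral_linear[OF this bounded_linear_vmult_right[of a]] show ?thesis by (simp add: o_def)
    qed
    also have "\<dots> = a *s blinfun_apply (integral (cbox 0 1) (fx x)) w"
      unfolding blinfun_apply_integral[OF int_fx[OF x]] fx[OF x] ..
    finally show "blinfun_apply (integral (cbox 0 1) (fx x)) (a *s w) = a *s blinfun_apply (integral (cbox 0 1) (fx x)) w" .
  qed
  then have "holo_on (\<lambda>x. FD f x v) (ball x0 \<delta>)"
    by (rule holo_on_cong) (use Cauchy_directional[OF f S rd(1)] rd in \<open>auto simp: cbox_interval k_def\<close>)
  then show "\<exists>T. x0 \<in> T \<and> holo_on (\<lambda>x. FD f x v) T" using rd by (intro exI[of _ "ball x0 \<delta>"]) simp
qed

section \<open>Calculus rules for holomorphic maps\<close>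

lemma FD_add: "f differentiable (at x) \<Longrightarrow> FD f x (v + w) = FD f x v + FD f x w"
  using FD_linear linear_add[OF bounded_linear.linear] by blast

lemma FD_scaleR: "f differentiable (at x) \<Longrightarrow> FD f x (r *\<^sub>R v) = r *\<^sub>R FD f x v"
  using FD_linear linear_scale[OF bounded_linear.linear] by blast

lemma FD_0: "f differentiable (at x) \<Longrightarrow> FD f x 0 = 0"
  using FD_linear linear_0[OF bounded_linear.linear] by blast

lemma FD_sum: "f differentiable (at x) \<Longrightarrow> FD f x (\<Sum>i\<in>I. v i) = (\<Sum>i\<in>I. FD f x (v i))"
  using FD_linear linear_sum[OF bounded_linear.linear] by blast

text \<open>Complex linearity leaves only the directions \<open>axis j 1\<close>. Dependence on
  \<open>v\<close> is thereby reduced to scalar factors, which yields joint holomorphy in point and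
  direction and also the Lipschitz bound.\<close>

lemma FD_expansion:
  fixes f :: "complex^'n::finite \<Rightarrow> complex^'m"
  assumes "holo_on f S" "x \<in> S"
  shows "FD f x v = (\<Sum>j\<in>UNIV. v $ j *s FD f x (axis j 1))"
proof -
  have "FD f x v = FD f x (\<Sum>j\<in>UNIV. v $ j *s axis j 1)"
    by (simp only: basis_expansion)
  also have "\<dots> = (\<Sum>j\<in>UNIV. v $ j *s FD f x (axis j 1))"
    using holo_onD[OF assms] by (simp add: FD_sum)
  finally show ?thesis .
qed

lemma holo_on_sum:
  assumes "\<And>i. i \<in> I \<Longrightarrow> holo_on (f i) S"
  shows "holo_on (\<lambda>x. \<Sum>i\<in>I. f i x) S"
proof (rule holo_onI)
  fix x assume x: "x \<in> S"
  show "((\<lambda>x. \<Sum>i\<in>I. f i x) has_derivative (\<lambda>v. \<Sum>i\<in>I. FD (f i) x v)) (at x)"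
    by (intro has_derivative_sum holo_onD(2)[OF assms x])
  show "(\<Sum>i\<in>I. FD (f i) x (a *s v)) = a *s (\<Sum>i\<in>I. FD (f i) x v)" for a v
    unfolding vec.scale_sum_right by (intro sum.cong refl holo_onD(3)[OF assms x])
qed

lemma holo_on_scale:
  assumes "holo_on g S" "holo_on f S"
  shows "holo_on (\<lambda>x. g x $ i *s f x) S"
proof (rule holo_onI)
  fix x assume x: "x \<in> S"
  show "((\<lambda>x. g x $ i *s f x) has_derivative (\<lambda>v. g x $ i *s FD f x v + FD g x v $ i *s f x)) (at x)"
    by (intro has_derivative_vmult bounded_linear.has_derivative[OF bounded_linear_vec_nth]
        holo_onD(2)[OF assms(1) x] holo_onD(2)[OF assms(2) x])
  show "g x $ i *s FD f x (a *s v) + FD g x (a *s v) $ i *s f x = a *s (g x $ i *s FD f x v + FD g x v $ i *s f x)" for a v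
    by (simp add: holo_onD(3)[OF assms(1) x] holo_onD(3)[OF assms(2) x] vec_eq_iff algebra_simps)
qed

lemma holo_on_linear:
  fixes f :: "complex^'n \<Rightarrow> complex^'m"
  assumes "linear f" "\<And>a v. f (a *s v) = a *s f v"
  shows "holo_on f S"
  using assms linear_conv_bounded_linear bounded_linear_imp_has_derivative by (intro holo_onI) blast+

lemma holo_on_const [simp]: "holo_on (\<lambda>x. c) S"
  by (rule holo_onI[where f'="\<lambda>x v. 0"]) auto

subsection \<open>Pairs of vectors\<close>

text \<open>Pairs are again vectors, indexed by the sum type, so that \<open>holo_on\<close> applies
  to functions of two variables. The index convention is that of
  \<open>induced_coord\<close>.\<close>

definition vpair :: "complex^'n \<Rightarrow> complex^'m \<Rightarrow> complex^('n::finite + 'm::finite)" where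
  "vpair x w = (\<chi> k. case k of Inl i \<Rightarrow> x $ i | Inr j \<Rightarrow> w $ j)"

definition vfst :: "complex^('n::finite + 'm::finite) \<Rightarrow> complex^'n" where "vfst p = (\<chi> i. p $ Inl i)"
definition vsnd :: "complex^('n::finite + 'm::finite) \<Rightarrow> complex^'m" where "vsnd p = (\<chi> j. p $ Inr j)"

lemma vpair_nth [simp]: "vpair x w $ Inl i = x $ i" "vpair x w $ Inr j = w $ j"
  by (simp_all add: vpair_def)

lemma vfst_nth [simp]: "vfst p $ i = p $ Inl i" and vsnd_nth [simp]: "vsnd p $ j = p $ Inr j"
  by (simp_all add: vfst_def vsnd_def)

lemma vfst_vpair [simp]: "vfst (vpair x w) = x" and vsnd_vpair [simp]: "vsnd (vpair x w) = w"
  by (simp_all add: vec_eq_iff)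

lemma vpair_eqI: "(\<And>i. p $ Inl i = q $ Inl i) \<Longrightarrow> (\<And>j. p $ Inr j = q $ Inr j) \<Longrightarrow> p = q"
  for p q :: "complex^('n::finite + 'm::finite)"
  unfolding vec_eq_iff by (metis sum.exhaust)

lemma vpair_collapse [simp]: "vpair (vfst p) (vsnd p) = p"
  by (rule vpair_eqI) simp_all

lemma vpair_eq_iff [simp]: "vpair x w = vpair x' w' \<longleftrightarrow> x = x' \<and> w = w'"
  by (metis vfst_vpair vsnd_vpair)

lemma vpair_add: "vpair x w + vpair x' w' = vpair (x + x') (w + w')"
  by (rule vpair_eqI) simp_all

lemma vpair_scale: "a *s vpair x w = vpair (a *s x) (a *s w)"
  by (rule vpair_eqI) simp_all

lemma vpair_scaleR: "r *\<^sub>R vpair x w = vpair (r *\<^sub>R x) (r *\<^sub>R w)"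
  by (rule vpair_eqI) simp_all

lemma vpair_0 [simp]: "vpair 0 0 = 0"
  by (rule vpair_eqI) simp_all

lemma vpair_sum: "(\<Sum>i\<in>I. vpair (f i) (g i)) = vpair (sum f I) (sum g I)"
  by (rule vpair_eqI) simp_all

lemma linear_vfst: "linear (vfst :: complex^('n::finite + 'm::finite) \<Rightarrow> _)"
  and linear_vsnd: "linear (vsnd :: complex^('n::finite + 'm::finite) \<Rightarrow> _)"
  by (auto intro!: linearI simp: vec_eq_iff)

lemmas bounded_linear_vfst = linear_vfst[unfolded linear_conv_bounded_linear]
lemmas bounded_linear_vsnd = linear_vsnd[unfolded linear_conv_bounded_linear]

lemma vfst_scale: "vfst (a *s p) = a *s vfst p" and vsnd_scale: "vsnd (a *s p) = a *s vsnd p"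
  by (simp_all add: vec_eq_iff)

lemmas continuous_on_vfst [continuous_intros] = bounded_linear.continuous_on[OF bounded_linear_vfst]
lemmas continuous_on_vsnd [continuous_intros] = bounded_linear.continuous_on[OF bounded_linear_vsnd]

lemma bounded_linear_vpair1: "bounded_linear (\<lambda>x. vpair x 0 :: complex^('n::finite + 'm::finite))"
  and bounded_linear_vpair2: "bounded_linear (\<lambda>w. vpair 0 w :: complex^('n::finite + 'm::finite))"
  by (auto intro!: linearI vpair_eqI simp flip: linear_conv_bounded_linear)

lemma has_derivative_vpair [derivative_intros]:
  assumes "(f has_derivative f') F" "(g has_derivative g') F"
  shows "((\<lambda>x. vpair (f x) (g x) :: complex^('n::finite + 'm::finite)) has_derivative (\<lambda>h. vpair (f' h) (g' h))) F"
  using has_derivative_add[OF bounded_linear.has_derivative[OF bounded_linear_vpair1 assms(1)]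
      bounded_linear.has_derivative[OF bounded_linear_vpair2 assms(2)]]
  by (simp add: vpair_add)

lemma continuous_on_vpair [continuous_intros]:
  assumes "continuous_on S f" "continuous_on S g"
  shows "continuous_on S (\<lambda>x. vpair (f x) (g x) :: complex^('n::finite + 'm::finite))"
  using continuous_on_add[OF bounded_linear.continuous_on[OF bounded_linear_vpair1 assms(1)]
      bounded_linear.continuous_on[OF bounded_linear_vpair2 assms(2)]]
  by (simp add: vpair_add)

lemma has_vector_derivative_vpair [derivative_intros]:
  assumes "(f has_vector_derivative f') F" "(g has_vector_derivative g') F"
  shows "((\<lambda>x. vpair (f x) (g x) :: complex^('n::finite + 'm::finite)) has_vector_derivative vpair f' g') F"
  using has_derivative_vpair[OF assms[unfolded has_vector_derivative_def]]
  by (simp add: has_vector_derivative_def vpair_scaleR)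

lemma holo_on_vfst: "holo_on (vfst :: complex^('n::finite + 'm::finite) \<Rightarrow> _) S"
  and holo_on_vsnd: "holo_on (vsnd :: complex^('n::finite + 'm::finite) \<Rightarrow> _) S"
  by (auto intro!: holo_on_linear linear_vfst linear_vsnd vfst_scale vsnd_scale)

lemma holo_on_vpair:
  assumes "holo_on f S" "holo_on g S"
  shows "holo_on (\<lambda>x. vpair (f x) (g x) :: complex^('n::finite + 'm::finite)) S"
  by (rule holo_onI[where f'="\<lambda>x v. vpair (FD f x v) (FD g x v)"])
    (use assms in \<open>auto intro!: derivative_intros holo_onD(2) simp: holo_onD(3) vpair_scale\<close>)

lemma open_vfst_vimage: "open S \<Longrightarrow> open {p :: complex^('n::finite + 'm::finite). vfst p \<in> S}"
  using open_vimage[of S vfst] by (simp add: vimage_def bounded_linear.continuous_on[OF bounded_linear_vfst])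

lemma open_vsnd_vimage: "open S \<Longrightarrow> open {p :: complex^('n::finite + 'm::finite). vsnd p \<in> S}"
  using open_vimage[of S vsnd] by (simp add: vimage_def bounded_linear.continuous_on[OF bounded_linear_vsnd])

text \<open>Linear in the direction with coefficients holomorphic in the point, hence a finite sum
  of products of holomorphic maps.\<close>

lemma holo_FD_joint:
  fixes f :: "complex^'n::finite \<Rightarrow> complex^'m::finite"
  assumes f: "holo_on f S" and S: "open S"
  shows "holo_on (\<lambda>p :: complex^('n + 'n). FD f (vfst p) (vsnd p)) {p. vfst p \<in> S}"
proof -
  have "holo_on (\<lambda>p :: complex^('n + 'n). \<Sum>j\<in>UNIV. vsnd p $ j *s FD f (vfst p) (axis j 1)) {p. vfst p \<in> S}"
    by (intro holo_on_sum holo_on_scale holo_on_vsnd holo_on_compose[OF holo_on_vfst holo_FD[OF f S]]) auto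
  then show ?thesis
    by (rule holo_on_cong) (use FD_expansion[OF f] open_vfst_vimage[OF S] in auto)
qed

subsection \<open>Second derivatives\<close>

text \<open>Clairaut's theorem, with continuity known only for second derivatives in fixed
  directions. The increment of \<open>f\<close> along \<open>w\<close> is the integral of its
  \<open>w\<close> derivative; differentiating this identity along \<open>v\<close> under the
  integral, and then at 0 in the length \<open>t\<close> of the increment, produces the two orders
  of differentiation.\<close>

lemma symmetric_FD:
  fixes f :: "'a::real_normed_vector \<Rightarrow> 'b::banach"
  assumes f: "Ck_on 2 f S" and S: "open S" and x: "x \<in> S"
  shows "FD (\<lambda>x. FD f x v) x w = FD (\<lambda>x. FD f x w) x v"
proof -
  have f1: "f differentiable (at y)" if "y \<in> S" for y
    using f that by (simp add: numeral_2_eq_2)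
  have f2: "(\<lambda>x. FD f x v) differentiable (at y)" if "y \<in> S" for y v
    using f that by (simp add: numeral_2_eq_2)
  have f3: "continuous_on S (\<lambda>x. FD (\<lambda>x. FD f x v) x w)" for v w
    using f by (simp add: numeral_2_eq_2)
  obtain \<delta> where d: "\<delta> > 0" "\<And>s t. \<bar>s\<bar> \<le> \<delta> \<Longrightarrow> \<bar>t\<bar> \<le> \<delta> \<Longrightarrow> x + s *\<^sub>R v + t *\<^sub>R w \<in> S"
  proof -
    have "((\<lambda>(s,t). x + s *\<^sub>R v + t *\<^sub>R w) \<longlongrightarrow> x + 0 *\<^sub>R v + 0 *\<^sub>R w) (nhds 0 \<times>\<^sub>F nhds (0::real))"
      unfolding split_def by (intro tendsto_intros filterlim_fst filterlim_snd)
    then have "eventually (\<lambda>(s,t). x + s *\<^sub>R v + t *\<^sub>R w \<in> S) (nhds 0 \<times>\<^sub>F nhds (0::real))"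
      using topological_tendstoD[OF _ S] x by (fastforce simp: split_def)
    then obtain P Q where PQ: "eventually P (nhds (0::real))" "eventually Q (nhds (0::real))"
      "\<And>s t. P s \<Longrightarrow> Q t \<Longrightarrow> x + s *\<^sub>R v + t *\<^sub>R w \<in> S"
      unfolding eventually_prod_filter by auto
    then obtain a b where "a > 0" "b > 0" "\<And>s. \<bar>s\<bar> < a \<Longrightarrow> P s" "\<And>s. \<bar>s\<bar> < b \<Longrightarrow> Q s"
      unfolding eventually_nhds_metric dist_real_def by auto
    then show ?thesis using PQ(3) by (intro that[of "min a b / 2"]) auto
  qed
  have dv: "((\<lambda>s. g (y + s *\<^sub>R u)) has_vector_derivative FD g (y + s *\<^sub>R u) u) (at s within T)"
    if "g differentiable (at (y + s *\<^sub>R u))" for g :: "'a \<Rightarrow> 'b" and y u s T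
  proof -
    have "((\<lambda>s. g (y + s *\<^sub>R u)) has_derivative (\<lambda>h. FD g (y + s *\<^sub>R u) (h *\<^sub>R u))) (at s within T)"
      by (rule has_derivative_compose[where f="\<lambda>s. y + s *\<^sub>R u", OF _ FD_works[OF that]])
        (auto intro!: derivative_eq_intros)
    then show ?thesis by (simp add: has_vector_derivative_def FD_scaleR[OF that])
  qed
  let ?H = "\<lambda>t. FD (\<lambda>x. FD f x w) (x + t *\<^sub>R w) v"
  have inc: "FD f (x + t *\<^sub>R w) v - FD f x v = integral {0..t} ?H" if t: "t \<in> {0..\<delta>}" for t
  proof -
    \<comment> \<open>The interval for \<open>s\<close> has 0 in its interior, whereas
      \<open>t\<close> runs through \<open>[0, \<delta>]\<close> only; one-sided derivatives at
      \<open>t = 0\<close> suffice, since derivatives within a nondegenerate interval are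
      unique.\<close>
    let ?U = "{-\<delta>..\<delta>}"
    have fl: "f (x + s *\<^sub>R v + t *\<^sub>R w) - f (x + s *\<^sub>R v) = integral {0..t} (\<lambda>\<tau>. FD f (x + s *\<^sub>R v + \<tau> *\<^sub>R w) w)"
      if s: "s \<in> ?U" for s
    proof -
      have "((\<lambda>\<tau>. FD f (x + s *\<^sub>R v + \<tau> *\<^sub>R w) w) has_integral
         (f (x + s *\<^sub>R v + t *\<^sub>R w) - f (x + s *\<^sub>R v + 0 *\<^sub>R w))) {0..t}"
        by (rule fundamental_theorem_of_calculus) (use t s d in \<open>auto intro!: dv f1\<close>)
      then show ?thesis by (simp add: integral_unique)
    qed
    have "((\<lambda>s. integral (cbox 0 t) (\<lambda>\<tau>. FD f (x + s *\<^sub>R v + \<tau> *\<^sub>R w) w)) has_vector_derivative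
        integral (cbox 0 t) (\<lambda>\<tau>. FD (\<lambda>x. FD f x w) (x + 0 *\<^sub>R v + \<tau> *\<^sub>R w) v)) (at 0 within ?U)"
    proof (rule leibniz_rule_vector_derivative)
      fix s \<tau> assume st: "s \<in> ?U" "\<tau> \<in> cbox 0 t"
      have "(\<lambda>x. FD f x w) differentiable at (x + \<tau> *\<^sub>R w + s *\<^sub>R v)"
        by (rule f2) (use st t d(2)[of s \<tau>] in \<open>auto simp: add.commute add.left_commute\<close>)
      from dv[OF this] show "((\<lambda>s. FD f (x + s *\<^sub>R v + \<tau> *\<^sub>R w) w) has_vector_derivative
          FD (\<lambda>x. FD f x w) (x + s *\<^sub>R v + \<tau> *\<^sub>R w) v) (at s within ?U)"
        by (simp add: add.commute add.left_commute)
    next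
      fix s assume s: "s \<in> ?U"
      have "continuous_on S (\<lambda>x. FD f x w)"
        using f2 by (meson continuous_at_imp_continuous_on differentiable_imp_continuous_within)
      then have "continuous_on {0..t} (\<lambda>\<tau>. FD f (x + s *\<^sub>R v + \<tau> *\<^sub>R w) w)"
        by (rule continuous_on_compose2) (use s t d in \<open>auto intro!: continuous_intros\<close>)
      then show "(\<lambda>\<tau>. FD f (x + s *\<^sub>R v + \<tau> *\<^sub>R w) w) integrable_on cbox 0 t"
        by (simp add: integrable_continuous_real)
    next
      show "continuous_on (?U \<times> cbox 0 t) (\<lambda>(s, \<tau>). FD (\<lambda>x. FD f x w) (x + s *\<^sub>R v + \<tau> *\<^sub>R w) v)"
        unfolding split_def by (rule continuous_on_compose2[OF f3])
          (use t d in \<open>auto intro!: continuous_intros\<close>)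
    qed (use d in auto)
    then have "((\<lambda>s. f (x + s *\<^sub>R v + t *\<^sub>R w) - f (x + s *\<^sub>R v)) has_vector_derivative
        integral (cbox 0 t) (\<lambda>\<tau>. FD (\<lambda>x. FD f x w) (x + 0 *\<^sub>R v + \<tau> *\<^sub>R w) v)) (at 0 within ?U)"
      by (rule has_vector_derivative_transform[rotated 2]) (use fl d in \<open>auto simp: cbox_interval\<close>)
    then have "((\<lambda>s. f (x + s *\<^sub>R v + t *\<^sub>R w) - f (x + s *\<^sub>R v)) has_vector_derivative integral {0..t} ?H) (at 0 within ?U)"
      by (simp add: cbox_interval)
    moreover have "((\<lambda>s. f (x + t *\<^sub>R w + s *\<^sub>R v) - f (x + s *\<^sub>R v)) has_vector_derivative
        (FD f (x + t *\<^sub>R w + 0 *\<^sub>R v) v - FD f (x + 0 *\<^sub>R v) v)) (at 0 within ?U)"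
      using d(2)[of 0 t] t x by (intro has_vector_derivative_diff dv f1) auto
    ultimately show ?thesis
      using vector_derivative_unique_within_closed_interval[of "-\<delta>" \<delta> 0] d(1)
      by (simp add: add.commute add.left_commute)
  qed
  have "((\<lambda>t. integral {0..t} ?H) has_vector_derivative ?H 0) (at 0 within {0..\<delta>})"
  proof (rule integral_has_vector_derivative)
    show "continuous_on {0..\<delta>} ?H"
      by (rule continuous_on_compose2[OF f3]) (use d(2)[of 0] d(1) in \<open>auto intro!: continuous_intros\<close>)
  qed (use d in auto)
  then have "((\<lambda>t. FD f (x + t *\<^sub>R w) v - FD f x v) has_vector_derivative ?H 0) (at 0 within {0..\<delta>})"
    by (rule has_vector_derivative_transform[rotated 2]) (use inc d in auto)
  moreover have "((\<lambda>t. FD f (x + t *\<^sub>R w) v - FD f x v) has_vector_derivative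
     (FD (\<lambda>x. FD f x v) (x + 0 *\<^sub>R w) w - 0)) (at 0 within {0..\<delta>})"
    using x by (intro has_vector_derivative_diff dv f2) auto
  ultimately show ?thesis
    using vector_derivative_unique_within_closed_interval[of 0 \<delta> 0] d(1) by simp
qed

lemma holo_Ck:
  fixes f :: "complex^'n::finite \<Rightarrow> complex^'m::finite"
  assumes "holo_on f S" "open S"
  shows "Ck_on k f S"
  using assms
proof (induction k arbitrary: f)
  case (Suc k)
  then show ?case using holo_FD[OF Suc.prems] holo_onD(1)[OF Suc.prems(1)] by simp
qed (simp add: holo_on_continuous)

lemma holo_symmetric_FD:
  fixes f :: "complex^'n::finite \<Rightarrow> complex^'m::finite"
  assumes "holo_on f S" "open S" "x \<in> S"
  shows "FD (\<lambda>x. FD f x v) x w = FD (\<lambda>x. FD f x w) x v"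
  using symmetric_FD[OF holo_Ck[OF assms(1,2)] assms(2,3)] .

subsection \<open>Ordinary differential equations\<close>

text \<open>On a closed ball inside \<open>S\<close> the finitely many continuous partial
  derivatives are bounded, and the ball is convex, so the mean value inequality applies.\<close>

lemma holo_locally_lipschitz:
  fixes f :: "complex^'n::finite \<Rightarrow> complex^'m::finite"
  assumes f: "holo_on f S" and S: "open S" and x0: "x0 \<in> S"
  obtains r L where "r > 0" "L \<ge> 0" "cball x0 r \<subseteq> S" "L-lipschitz_on (cball x0 r) f"
proof -
  obtain r where r: "r > 0" "cball x0 r \<subseteq> S"
    using S x0 open_contains_cball by blast
  have "\<exists>K. \<forall>x\<in>cball x0 r. norm (FD f x (axis j 1)) \<le> K" for j
  proof -
    have "compact ((\<lambda>x. FD f x (axis j 1)) ` cball x0 r)"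
      by (intro compact_continuous_image continuous_on_subset[OF holo_FD_continuous[OF f S] r(2)] compact_cball)
    then show ?thesis by (meson compact_imp_bounded bounded_iff imageI)
  qed
  then obtain K where K: "\<And>j x. x \<in> cball x0 r \<Longrightarrow> norm (FD f x (axis j 1)) \<le> K j" by metis
  have K0: "K j \<ge> 0" for j using K[of x0 j] r norm_ge_zero order_trans
    by (metis centre_in_cball less_imp_le)
  have on: "onorm (FD f x) \<le> (\<Sum>j\<in>UNIV. K j)" if x: "x \<in> cball x0 r" for x
  proof (rule onorm_le)
    fix v
    have "norm (FD f x v) = norm (\<Sum>j\<in>UNIV. v $ j *s FD f x (axis j 1))"
      using FD_expansion[OF f] r(2) x by (metis subsetD)
    also have "\<dots> \<le> (\<Sum>j\<in>UNIV. norm (v $ j *s FD f x (axis j 1)))" by (rule norm_sum)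
    also have "\<dots> \<le> (\<Sum>j\<in>UNIV. norm v * K j)"
      by (intro sum_mono, unfold norm_vmult) (intro mult_mono Finite_Cartesian_Product.norm_nth_le K[OF x] norm_ge_zero)
    finally show "norm (FD f x v) \<le> (\<Sum>j\<in>UNIV. K j) * norm v"
      by (simp add: sum_distrib_left sum_distrib_right mult.commute)
  qed
  have "(\<Sum>j\<in>UNIV. K j)-lipschitz_on (cball x0 r) f"
  proof (rule lipschitz_onI)
    fix x y assume xy: "x \<in> cball x0 r" "y \<in> cball x0 r"
    show "dist (f x) (f y) \<le> (\<Sum>j\<in>UNIV. K j) * dist x y"
      unfolding dist_norm
    proof (rule differentiable_bound[where S="cball x0 r" and f'="FD f"])
      fix z assume z: "z \<in> cball x0 r"
      show "(f has_derivative FD f z) (at z within cball x0 r)"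
        using has_derivative_at_withinI[OF holo_onD(2)[OF f]] r(2) z by blast
      show "onorm (FD f z) \<le> (\<Sum>j\<in>UNIV. K j)" by (rule on[OF z])
    qed (use xy in auto)
  qed (simp add: sum_nonneg K0)
  then show thesis using that[of r "\<Sum>j\<in>UNIV. K j"] r K0 by (simp add: sum_nonneg)
qed

lemma onorm_scaleR_le:
  fixes v :: "'a::real_normed_vector"
  assumes "norm v \<le> c"
  shows "onorm (\<lambda>r. r *\<^sub>R v) \<le> c"
  using mult_right_mono[OF assms abs_ge_zero] by (intro onorm_le) (simp add: mult.commute)

text \<open>On an interval of half-length \<open>h\<close> with \<open>L * h\<close> at most 1/2,
  the mean value inequality bounds the largest distance of the two curves by half of itself.\<close>

lemma ode_local_unique:
  fixes \<alpha> \<beta> :: "real \<Rightarrow> 'a::euclidean_space"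
  assumes L: "L-lipschitz_on B f" and d: "\<delta> > 0" and t0: "\<alpha> t0 = \<beta> t0"
    and a: "\<And>t. \<bar>t - t0\<bar> < \<delta> \<Longrightarrow> \<alpha> t \<in> B \<and> (\<alpha> has_vector_derivative f (\<alpha> t)) (at t)"
    and b: "\<And>t. \<bar>t - t0\<bar> < \<delta> \<Longrightarrow> \<beta> t \<in> B \<and> (\<beta> has_vector_derivative f (\<beta> t)) (at t)"
  shows "\<exists>\<epsilon>>0. \<forall>t. \<bar>t - t0\<bar> < \<epsilon> \<longrightarrow> \<alpha> t = \<beta> t"
proof -
  have L0: "L \<ge> 0" using L lipschitz_on_nonneg by blast
  \<comment> \<open>The bound \<open>\<delta> / 2\<close> keeps the closed interval \<open>I\<close>
    inside the domain of both curves; the other one makes \<open>L * h\<close> at most 1/2, with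
    \<open>L + 1\<close> because \<open>L\<close> may be 0.\<close>
  define h where "h = min (\<delta> / 2) (1 / (2 * (L + 1)))"
  have h: "h > 0" "h < \<delta>" "L * h \<le> 1 / 2"
  proof -
    show "h > 0" "h < \<delta>" using d L0 by (auto simp: h_def)
    have "L * h \<le> L * (1 / (2 * (L + 1)))" using L0 by (intro mult_left_mono) (auto simp: h_def)
    also have "\<dots> \<le> 1 / 2" using L0 by (simp add: field_simps)
    finally show "L * h \<le> 1 / 2" .
  qed
  define I where "I = {t0 - h..t0 + h}"
  have I: "\<bar>t - t0\<bar> < \<delta>" if "t \<in> I" for t using that h by (auto simp: I_def abs_if)
  define D where "D = (\<lambda>t. \<alpha> t - \<beta> t)"
  have Dd: "(D has_vector_derivative f (\<alpha> t) - f (\<beta> t)) (at t within I)" if "t \<in> I" for t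
    unfolding D_def
    by (rule has_vector_derivative_diff; rule has_vector_derivative_at_within; use a b I[OF that] in blast)
  have cD: "continuous_on I (\<lambda>t. norm (D t))"
    by (intro continuous_on_norm) (use Dd has_vector_derivative_continuous continuous_on_eq_continuous_within in blast)
  have "compact I" "I \<noteq> {}" using h by (auto simp: I_def)
  then obtain s where s: "s \<in> I" "\<And>t. t \<in> I \<Longrightarrow> norm (D t) \<le> norm (D s)"
    using continuous_attains_sup[OF _ _ cD] by blast
  have "norm (D s - D t0) \<le> (L * norm (D s)) * norm (s - t0)"
  proof (rule differentiable_bound[where S=I and f'="\<lambda>t r. r *\<^sub>R (f (\<alpha> t) - f (\<beta> t))"])
    show "convex I" by (simp add: I_def)
    show "t0 \<in> I" using h by (simp add: I_def)
    fix t assume t: "t \<in> I"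
    show "(D has_derivative (\<lambda>r. r *\<^sub>R (f (\<alpha> t) - f (\<beta> t)))) (at t within I)"
      using Dd[OF t] by (simp add: has_vector_derivative_def)
    have "norm (f (\<alpha> t) - f (\<beta> t)) \<le> L * norm (D t)"
      using lipschitz_onD[OF L] a[OF I[OF t]] b[OF I[OF t]] by (simp add: D_def dist_norm)
    also have "\<dots> \<le> L * norm (D s)" using s(2)[OF t] L0 by (rule mult_left_mono)
    finally show "onorm (\<lambda>r. r *\<^sub>R (f (\<alpha> t) - f (\<beta> t))) \<le> L * norm (D s)"
      by (rule onorm_scaleR_le)
  qed (use s in auto)
  also have "\<dots> \<le> (L * norm (D s)) * h"
    using s(1) L0 by (intro mult_left_mono) (auto simp: I_def abs_if)
  also have "\<dots> = (L * h) * norm (D s)" by simp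
  also have "\<dots> \<le> 1 / 2 * norm (D s)" using h(3) by (rule mult_right_mono) simp
  finally have "norm (D s) = 0" using t0 by (simp add: D_def)
  then have "D t = 0" if "t \<in> I" for t using s(2)[OF that] by simp
  then show ?thesis using h(1) by (intro exI[of _ h]) (auto simp: D_def I_def abs_if split: if_splits)
qed

text \<open>Picard iteration. Curves are bounded continuous functions on the whole line, which form
  a complete space; time is cut off outside \<open>[-T, T]\<close> so that the iterates belong to
  this space.\<close>

lemma ode_local_exists:
  fixes f :: "'a::euclidean_space \<Rightarrow> 'a"
  assumes L: "L-lipschitz_on (cball x0 r) f" and r: "r > 0"
  obtains \<epsilon> \<gamma> where "\<epsilon> > 0" "\<gamma> 0 = x0"
    "\<And>t. \<bar>t\<bar> < \<epsilon> \<Longrightarrow> \<gamma> t \<in> cball x0 r \<and> (\<gamma> has_vector_derivative f (\<gamma> t)) (at t)"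
proof -
  have L0: "L \<ge> 0" using L lipschitz_on_nonneg by blast
  have cf: "continuous_on (cball x0 r) f" using L by (rule lipschitz_on_continuous_on)
  have "bounded (f ` cball x0 r)"
    by (intro compact_imp_bounded compact_continuous_image cf compact_cball)
  then obtain M where M: "\<And>x. x \<in> cball x0 r \<Longrightarrow> norm (f x) \<le> M" "M \<ge> 0"
    by (metis bounded_iff imageI norm_ge_zero order_trans centre_in_cball less_imp_le r)
  \<comment> \<open>\<open>M * T \<le> r\<close> keeps the iterates in the ball;
    \<open>L * T \<le> 1 / 2\<close> makes the iteration a contraction.\<close>
  define T where "T = min (r / (M + 1)) (1 / (2 * (L + 1)))"
  have T: "T > 0" "M * T \<le> r" "L * T \<le> 1 / 2"
  proof -
    show "T > 0" using r M L0 by (auto simp: T_def)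
    have "M * T \<le> M * (r / (M + 1))" using M by (intro mult_left_mono) (auto simp: T_def)
    also have "\<dots> \<le> r" using M r by (simp add: field_simps)
    finally show "M * T \<le> r" .
    have "L * T \<le> L * (1 / (2 * (L + 1)))" using L0 by (intro mult_left_mono) (auto simp: T_def)
    also have "\<dots> \<le> 1 / 2" using L0 by (simp add: field_simps)
    finally show "L * T \<le> 1 / 2" .
  qed
  define cl where "cl t = max (-T) (min T t)" for t :: real
  have cl: "cl t \<in> {-T..T}" for t using T by (auto simp: cl_def)
  have ccl: "continuous_on UNIV cl" unfolding cl_def by (intro continuous_intros)
  \<comment> \<open>The integral from 0 to \<open>t\<close>, also for negative \<open>t\<close>:
    both integrals start at \<open>-T\<close>, and their difference carries the correct
    sign.\<close>
  define J where "J g t = integral {-T..t} (\<lambda>s. f (g s)) - integral {-T..0} (\<lambda>s. f (g s))" for g t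
  define E where "E = {g :: real \<Rightarrow>\<^sub>C 'a. \<forall>t. apply_bcontfun g t \<in> cball x0 r}"
  have cont: "continuous_on A (\<lambda>s. f (apply_bcontfun g s))" if "g \<in> E" for g A
    by (rule continuous_on_compose2[OF cf]) (use that in \<open>auto simp: E_def intro: continuous_on_apply_bcontfun\<close>)
  have J_vd: "((J g) has_vector_derivative f (g t)) (at t within {-T..T})" if "t \<in> {-T..T}" "g \<in> E" for t and g :: "real \<Rightarrow>\<^sub>C 'a"
    unfolding J_def using integral_has_vector_derivative[OF cont[OF that(2)] that(1)]
    by (auto intro!: derivative_eq_intros)
  have J0: "J g 0 = 0" for g by (simp add: J_def)
  have J_lip: "norm (J g t - J h t) \<le> c * \<bar>t\<bar>"
    if "t \<in> {-T..T}" "g \<in> E" "h \<in> E" "\<And>t. norm (f (g t) - f (h t)) \<le> c" for g h :: "real \<Rightarrow>\<^sub>C 'a" and t c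
  proof -
    have "norm ((J g t - J h t) - (J g 0 - J h 0)) \<le> c * norm (t - 0)"
    proof (rule differentiable_bound[where S="{-T..T}" and f'="\<lambda>t r. r *\<^sub>R (f (g t) - f (h t))"])
      fix u assume u: "u \<in> {-T..T}"
      show "((\<lambda>t. J g t - J h t) has_derivative (\<lambda>r. r *\<^sub>R (f (g u) - f (h u)))) (at u within {-T..T})"
        using has_vector_derivative_diff[OF J_vd[OF u that(2)] J_vd[OF u that(3)]]
        by (simp add: has_vector_derivative_def)
      show "onorm (\<lambda>r. r *\<^sub>R (f (g u) - f (h u))) \<le> c"
        by (rule onorm_scaleR_le[OF that(4)])
    qed (use T that in auto)
    then show ?thesis by (simp add: J0)
  qed
  have J_bd: "norm (J g t) \<le> r" if "t \<in> {-T..T}" "g \<in> E" for g :: "real \<Rightarrow>\<^sub>C 'a" and t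
  proof -
    have "norm (J g t - J g 0) \<le> M * norm (t - 0)"
    proof (rule differentiable_bound[where S="{-T..T}" and f'="\<lambda>t r. r *\<^sub>R (f (g t))"])
      fix u assume u: "u \<in> {-T..T}"
      show "((J g) has_derivative (\<lambda>r. r *\<^sub>R (f (g u)))) (at u within {-T..T})"
        using J_vd[OF u that(2)] by (simp add: has_vector_derivative_def)
      have "norm (f (g u)) \<le> M" using M(1) that(2) by (auto simp: E_def)
      then show "onorm (\<lambda>r. r *\<^sub>R (f (g u))) \<le> M"
        by (rule onorm_scaleR_le)
    qed (use T that in auto)
    also have "M * norm (t - 0) \<le> M * T" using that(1) M(2) by (intro mult_left_mono) auto
    finally show ?thesis using T by (simp add: J0)
  qed
  have Jc: "continuous_on {-T..T} (J g)" if "g \<in> E" for g :: "real \<Rightarrow>\<^sub>C 'a"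
    using J_vd[OF _ that] has_vector_derivative_continuous continuous_on_eq_continuous_within by blast
  define P where "P g = Bcontfun (\<lambda>t. x0 + J (apply_bcontfun g) (cl t))" for g
  have P: "apply_bcontfun (P g) = (\<lambda>t. x0 + J (apply_bcontfun g) (cl t))" if "g \<in> E" for g
    unfolding P_def
  proof (rule Bcontfun_inverse, rule bcontfun_normI)
    show "continuous_on UNIV (\<lambda>t. x0 + J (apply_bcontfun g) (cl t))"
      by (intro continuous_intros continuous_on_compose2[OF Jc[OF that] ccl]) (use cl in auto)
    show "norm (x0 + J (apply_bcontfun g) (cl t)) \<le> norm x0 + r" for t
      using J_bd[OF cl that] norm_triangle_mono by blast
  qed
  have PE: "P ` E \<subseteq> E"
    using J_bd[OF cl] by (auto simp: E_def P dist_norm)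
  have "closed E"
  proof -
    have "E = (\<Inter>t. (\<lambda>g. apply_bcontfun g t) -` cball x0 r)" by (auto simp: E_def)
    moreover have "closed ((\<lambda>g :: real \<Rightarrow>\<^sub>C 'a. apply_bcontfun g t) -` cball x0 r)" for t
    proof -
      have "continuous_on UNIV (\<lambda>g :: real \<Rightarrow>\<^sub>C 'a. apply_bcontfun g t)"
      proof (rule lipschitz_on_continuous_on[of 1], rule lipschitz_onI)
        show "dist (apply_bcontfun g t) (apply_bcontfun h t) \<le> 1 * dist g h" for g h :: "real \<Rightarrow>\<^sub>C 'a"
          by (simp add: dist_bounded)
      qed simp
      then show ?thesis by (intro closed_vimage) auto
    qed
    ultimately show ?thesis by (simp only: closed_INT ball_UNIV simp_thms)
  qed
  then have "complete E" by (simp add: complete_eq_closed)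
  moreover have "E \<noteq> {}"
    using r by (auto simp: E_def intro!: exI[of _ "const_bcontfun x0"])
  moreover have "dist (P g) (P h) \<le> 1 / 2 * dist g h" if "g \<in> E" "h \<in> E" for g h
  proof (rule dist_bound)
    fix t
    have "norm (f (g s) - f (h s)) \<le> L * dist g h" for s
    proof -
      have "norm (f (g s) - f (h s)) \<le> L * dist (g s) (h s)"
        using lipschitz_onD[OF L] that by (auto simp: E_def dist_norm)
      also have "\<dots> \<le> L * dist g h" using L0 by (intro mult_left_mono dist_bounded)
      finally show ?thesis .
    qed
    from J_lip[OF cl that this]
    have "dist (P g t) (P h t) \<le> L * dist g h * \<bar>cl t\<bar>"
      by (simp add: P that dist_norm)
    also have "\<dots> \<le> L * dist g h * T" using cl[of t] L0 by (intro mult_left_mono) auto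
    also have "\<dots> = (L * T) * dist g h" by simp
    also have "\<dots> \<le> 1 / 2 * dist g h" using T(3) by (rule mult_right_mono) simp
    finally show "dist (P g t) (P h t) \<le> 1 / 2 * dist g h" .
  qed
  ultimately obtain g where g: "g \<in> E" "P g = g"
    using Banach_fix[of E "1/2" P] PE by auto
  show thesis
  proof (rule that[of T "apply_bcontfun g"])
    have gt: "g t = x0 + J g (cl t)" for t using P[OF g(1)] g(2) by metis
    show "g 0 = x0" using gt[of 0] T by (simp add: cl_def J0)
    fix t assume t: "\<bar>t\<bar> < T"
    \<comment> \<open>Inside the open interval the cutoff \<open>cl\<close> is the identity and the
      derivative is two-sided, so the fixed point equation becomes the differential
      equation.\<close>
    then have t': "t \<in> {-T<..<T}" by auto
    have "(J g has_vector_derivative f (g t)) (at t)"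
      using has_vector_derivative_within_subset[OF J_vd[OF _ g(1)], of t "{-T<..<T}"] t'
      by (simp add: at_within_open[OF t'] greaterThanLessThan_subseteq_atLeastAtMost_iff)
    then have "((\<lambda>t. x0 + J g t) has_vector_derivative f (g t)) (at t)"
      by (auto intro!: derivative_eq_intros)
    then have "(apply_bcontfun g has_vector_derivative f (g t)) (at t)"
      by (rule has_vector_derivative_transform_within_open[OF _ open_greaterThanLessThan t'])
        (subst gt, auto simp: cl_def)
    then show "g t \<in> cball x0 r \<and> (apply_bcontfun g has_vector_derivative f (g t)) (at t)"
      using g(1) by (simp add: E_def)
  qed (use T in auto)
qed

section \<open>Charts and tangent vectors\<close>

type_synonym 'n cpair = "complex^('n + 'n)"

lemma eventually_in_open:
  fixes f :: "'a::t2_space \<Rightarrow> 'b::t1_space"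
  assumes "isCont f x" "open S" "f x \<in> S"
  shows "eventually (\<lambda>y. f y \<in> S) (nhds x)"
  by (rule topological_tendstoD[of f "f x"]) (use assms in \<open>auto simp: isCont_def tendsto_nhds_iff\<close>)

lemma eventually_abs_less: "\<bar>t\<bar> < \<epsilon> \<Longrightarrow> eventually (\<lambda>s. \<bar>s\<bar> < \<epsilon>) (nhds (t::real))"
  by (rule eventually_nhds_in_open[of "{s. \<bar>s\<bar> < \<epsilon>}", simplified]) (auto intro!: open_Collect_less continuous_intros)

text \<open>The right-hand side is the complex linear part of the real derivative. As
  \<open>h\<close> is only real differentiable, the expansion has to run over the real basis
  \<open>axis j 1\<close>, \<open>axis j \<i>\<close>.\<close>

lemma wirt_sum:
  fixes h :: "complex^'n::finite \<Rightarrow> complex"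
  assumes h: "h differentiable (at x)"
  shows "(\<Sum>i\<in>UNIV. w $ i * wirt i h x) = (FD h x w - \<i> * FD h x (\<i> *s w)) / 2"
proof -
  have exp: "FD h x v = (\<Sum>j\<in>UNIV. of_real (Re (v $ j)) * FD h x (axis j 1) + of_real (Im (v $ j)) * FD h x (axis j \<i>))" for v
  proof -
    have "v = (\<Sum>j\<in>UNIV. Re (v $ j) *\<^sub>R axis j 1 + Im (v $ j) *\<^sub>R axis j \<i>)"
      by (simp add: vec_eq_iff axis_def if_distrib[of "\<lambda>x. _ *\<^sub>R x"] sum.distrib complex_eq_iff
          cong: if_cong)
    then have "FD h x v = FD h x (\<Sum>j\<in>UNIV. Re (v $ j) *\<^sub>R axis j 1 + Im (v $ j) *\<^sub>R axis j \<i>)"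
      by simp
    also have "\<dots> = (\<Sum>j\<in>UNIV. of_real (Re (v $ j)) * FD h x (axis j 1) + of_real (Im (v $ j)) * FD h x (axis j \<i>))"
      using h by (simp add: FD_sum FD_add FD_scaleR scaleR_conv_of_real[where 'a=complex])
    finally show ?thesis .
  qed
  show ?thesis
    unfolding exp[of w] exp[of "\<i> *s w"] sum_distrib_left sum_subtractf[symmetric] sum_divide_distrib
  proof (rule sum.cong[OF refl])
    fix j
    have "w $ j = of_real (Re (w $ j)) + \<i> * of_real (Im (w $ j))" by (rule complex_eq)
    then show "w $ j * wirt j h x =
         (of_real (Re (w $ j)) * FD h x (axis j 1) + of_real (Im (w $ j)) * FD h x (axis j \<i>) -
          \<i> * (of_real (Re ((\<i> *s w) $ j)) * FD h x (axis j 1) + of_real (Im ((\<i> *s w) $ j)) * FD h x (axis j \<i>))) / 2"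
      by (simp add: wirt_def algebra_simps complex_eq_iff)
  qed
qed

abbreviation cdiff :: "('a, 'n::finite) chart \<Rightarrow> ('a \<Rightarrow> complex) \<Rightarrow> 'a \<Rightarrow> bool" where
  "cdiff c f p \<equiv> (f \<circ> chart_inv c) differentiable (at (snd c p))"

text \<open>The (1,0) vector with components \<open>w\<close>, written through real derivatives
  instead of a sum over \<open>pd\<close>: facts on \<open>real_vec\<close> then transfer at once.
  Both forms agree on every \<open>f\<close>, since both vanish where \<open>f\<close> is not
  differentiable.\<close>

definition t10 :: "('a, 'n::finite) chart \<Rightarrow> complex^'n \<Rightarrow> 'a tfield" where
  "t10 c w p f = (real_vec c w p f - \<i> * real_vec c (\<i> *s w) p f) / 2"

lemma t10_eq_sum: "t10 c w p = (\<lambda>f. \<Sum>i\<in>UNIV. w $ i * pd c i p f)"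
  by (rule ext) (simp add: t10_def real_vec_def pd_def wirt_sum)

lemma real_vec_add: "real_vec c (v + w) p f = real_vec c v p f + real_vec c w p f"
  by (simp add: real_vec_def FD_add)

lemma real_vec_scaleR: "real_vec c (r *\<^sub>R v) p f = of_real r * real_vec c v p f"
  by (simp add: real_vec_def FD_scaleR scaleR_conv_of_real[where 'a=complex])

lemma real_vec_0: "real_vec c 0 p f = 0"
  by (simp add: real_vec_def FD_0)

lemma real_vec_sum: "real_vec c (\<Sum>i\<in>I. v i) p f = (\<Sum>i\<in>I. real_vec c (v i) p f)"
  by (simp add: real_vec_def FD_sum)

lemma t10_add: "t10 c (v + w) p f = t10 c v p f + t10 c w p f"
  by (simp add: t10_def real_vec_add vec.scale_right_distrib field_simps)

lemma t10_0: "t10 c 0 p f = 0"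
  by (simp add: t10_def real_vec_0)

lemma t10_scale: "t10 c (a *s v) p f = a * t10 c v p f"
  by (simp add: t10_eq_sum sum_distrib_left mult.assoc)

lemma t10_sum: "t10 c (\<Sum>i\<in>I. v i) p f = (\<Sum>i\<in>I. t10 c (v i) p f)"
  by (induction I rule: infinite_finite_induct) (simp_all add: t10_0 t10_add)

text \<open>The derivative commutes with conjugation, and conjugation preserves
  non-differentiability, so the default value 0 agrees as well. This expresses that
  \<open>real_vec\<close> is a real tangent vector.\<close>

lemma real_vec_cnj: "real_vec c v p (\<lambda>q. cnj (f q)) = cnj (real_vec c v p f)"
proof -
  let ?h = "f \<circ> chart_inv c"
  have eq: "(\<lambda>q. cnj (f q)) \<circ> chart_inv c = (\<lambda>x. cnj (?h x))" by auto
  show ?thesis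
  proof (cases "?h differentiable (at (snd c p))")
    case True
    note D = has_derivative_cnj[OF FD_works[OF True]]
    then have "(\<lambda>x. cnj (?h x)) differentiable (at (snd c p))" by (auto simp: differentiable_def)
    then show ?thesis using FD_eq[OF D] True by (simp add: real_vec_def eq)
  next
    case False
    have "\<not> (\<lambda>x. cnj (?h x)) differentiable (at (snd c p))"
    proof
      assume "(\<lambda>x. cnj (?h x)) differentiable (at (snd c p))"
      from has_derivative_cnj[OF FD_works[OF this]] have "?h differentiable (at (snd c p))"
        by (auto simp: differentiable_def o_def)
      with False show False ..
    qed
    then show ?thesis using False unfolding real_vec_def eq by simp
  qed
qed

text \<open>Conjugation fixes real vectors and changes the sign of the \<open>\<i>\<close> term,
  which therefore cancels. In coordinates the identification of the two bundles is the identity on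
  components.\<close>

lemma circ_t10: "circ (t10 c w p) = real_vec c w p"
  by (rule ext) (simp add: circ_def conj_vec_def t10_def real_vec_cnj field_simps)

lemma chart_inv_left: "inj_on (snd c) (fst c) \<Longrightarrow> p \<in> fst c \<Longrightarrow> chart_inv c (snd c p) = p"
  by (simp add: chart_inv_def)

lemma chart_inv_right: "x \<in> snd c ` fst c \<Longrightarrow> snd c (chart_inv c x) = x"
  by (simp add: chart_inv_def f_inv_into_f)

lemma chart_inv_into: "x \<in> snd c ` fst c \<Longrightarrow> chart_inv c x \<in> fst c"
  by (simp add: chart_inv_def inv_into_into)

text \<open>The tangent bundles come with an atlas but without a topology, so base and bundles share
  a notion stated by charts alone.\<close>

locale holo_atlas =
  fixes A :: "('a, 'n::finite) atlas"
  assumes inj: "c \<in> A \<Longrightarrow> inj_on (snd c) (fst c)"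
    and open_overlap: "c \<in> A \<Longrightarrow> d \<in> A \<Longrightarrow> open (snd c ` (fst c \<inter> fst d))"
    and holo_trans: "c \<in> A \<Longrightarrow> d \<in> A \<Longrightarrow> holo_on (snd d \<circ> chart_inv c) (snd c ` (fst c \<inter> fst d))"
begin

lemma open_img: "c \<in> A \<Longrightarrow> open (snd c ` fst c)"
  using open_overlap[of c c] by simp

lemma ci_left [simp]: "c \<in> A \<Longrightarrow> p \<in> fst c \<Longrightarrow> chart_inv c (snd c p) = p"
  by (rule chart_inv_left[OF inj])

lemma mem_img_Int: "c \<in> A \<Longrightarrow> x \<in> snd c ` (fst c \<inter> S) \<longleftrightarrow> x \<in> snd c ` fst c \<and> chart_inv c x \<in> S"
  by (auto simp: chart_inv_right)

lemma trans_derivative: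
  assumes "c \<in> A" "d \<in> A" "p \<in> fst c" "p \<in> fst d"
  shows "((snd d \<circ> chart_inv c) has_derivative FD (snd d \<circ> chart_inv c) (snd c p)) (at (snd c p))"
    "FD (snd d \<circ> chart_inv c) (snd c p) (a *s v) = a *s FD (snd d \<circ> chart_inv c) (snd c p) v"
  using holo_onD(2,3)[OF holo_trans[OF assms(1,2)]] assms by auto

lemma derivative_change:
  assumes c: "c \<in> A" "p \<in> fst c" and d: "d \<in> A" "p \<in> fst d"
    and f: "cdiff d f p"
  shows "((f \<circ> chart_inv c) has_derivative
     (\<lambda>v. FD (f \<circ> chart_inv d) (snd d p) (FD (snd d \<circ> chart_inv c) (snd c p) v))) (at (snd c p))"
proof -
  have "((\<lambda>x. (f \<circ> chart_inv d) ((snd d \<circ> chart_inv c) x)) has_derivative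
     (\<lambda>v. FD (f \<circ> chart_inv d) (snd d p) (FD (snd d \<circ> chart_inv c) (snd c p) v))) (at (snd c p))"
    by (rule has_derivative_compose[OF trans_derivative(1)[OF c(1) d(1) c(2) d(2)]])
      (use FD_works[OF f] c d in \<open>simp add: o_def\<close>)
  then show ?thesis
    by (rule has_derivative_transform_within_open[OF _ open_overlap[OF c(1) d(1)]])
      (use c d in auto)
qed

lemma cdiff_change:
  assumes "c \<in> A" "p \<in> fst c" "d \<in> A" "p \<in> fst d"
  shows "cdiff c f p \<longleftrightarrow> cdiff d f p"
  using derivative_change[OF assms, of f] derivative_change[OF assms(3,4,1,2), of f]
  unfolding differentiable_def by blast

lemma mdiff_iff: "c \<in> A \<Longrightarrow> p \<in> fst c \<Longrightarrow> mdiff A f p \<longleftrightarrow> cdiff c f p"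
  unfolding mdiff_def using cdiff_change by blast

lemma real_vec_change:
  assumes "c \<in> A" "p \<in> fst c" "d \<in> A" "p \<in> fst d"
  shows "real_vec c v p = real_vec d (FD (snd d \<circ> chart_inv c) (snd c p) v) p"
  unfolding real_vec_def using cdiff_change[OF assms] FD_eq[OF derivative_change[OF assms]] by auto

lemma t10_change:
  assumes "c \<in> A" "p \<in> fst c" "d \<in> A" "p \<in> fst d"
  shows "t10 c v p = t10 d (FD (snd d \<circ> chart_inv c) (snd c p) v) p"
  unfolding t10_def real_vec_change[OF assms] trans_derivative(2)[OF assms(1,3,2,4)] ..

lemma T10_space_eq:
  assumes "c \<in> A" "p \<in> fst c"
  shows "T10_space A p = range (\<lambda>w. t10 c w p)"
proof -
  have "t10 d w p \<in> range (\<lambda>w. t10 c w p)" if "d \<in> A" "p \<in> fst d" for d w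
    by (rule range_eqI, rule t10_change[OF that assms])
  then show ?thesis unfolding T10_space_def t10_eq_sum[symmetric] using assms by blast
qed

lemma TR_space_eq:
  assumes "c \<in> A" "p \<in> fst c"
  shows "TR_space A p = range (\<lambda>w. real_vec c w p)"
proof -
  have "real_vec d w p \<in> range (\<lambda>w. real_vec c w p)" if "d \<in> A" "p \<in> fst d" for d w
    by (rule range_eqI, rule real_vec_change[OF that assms])
  then show ?thesis unfolding TR_space_def using assms by blast
qed

lemma real_vec_coord:
  assumes c: "c \<in> A" "p \<in> fst c"
  shows "real_vec c v p (\<lambda>q. snd c q $ i) = v $ i"
proof -
  have "((\<lambda>x. x $ i) has_derivative (\<lambda>v. v $ i)) (at (snd c p))"
    by (rule bounded_linear_imp_has_derivative[OF bounded_linear_vec_nth])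
  then have "(((\<lambda>q. snd c q $ i) \<circ> chart_inv c) has_derivative (\<lambda>v. v $ i)) (at (snd c p))"
    by (rule has_derivative_transform_within_open[OF _ open_img[OF c(1)]])
      (use c in \<open>auto simp: chart_inv_right\<close>)
  then show ?thesis using FD_eq unfolding real_vec_def differentiable_def by metis
qed

lemma t10_coord: "c \<in> A \<Longrightarrow> p \<in> fst c \<Longrightarrow> t10 c v p (\<lambda>q. snd c q $ i) = v $ i"
  by (simp add: t10_def real_vec_coord)

lemma real_vec_inject: "c \<in> A \<Longrightarrow> p \<in> fst c \<Longrightarrow> real_vec c v p = real_vec c w p \<longleftrightarrow> v = w"
  by (metis real_vec_coord vec_eq_iff)

lemma t10_inject: "c \<in> A \<Longrightarrow> p \<in> fst c \<Longrightarrow> t10 c v p = t10 c w p \<longleftrightarrow> v = w"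
  by (metis t10_coord vec_eq_iff)

lemma compose_derivative:
  fixes \<Phi> :: "'b \<Rightarrow> 'a" and c :: "('b, 'm::finite) chart"
  assumes d: "d \<in> A" "\<Phi> p \<in> fst d" and c: "inj_on (snd c) (fst c)" "p \<in> fst c"
    and ev: "eventually (\<lambda>x. \<Phi> (chart_inv c x) \<in> fst d) (nhds (snd c p))"
    and D: "((snd d \<circ> \<Phi> \<circ> chart_inv c) has_derivative D) (at (snd c p))"
    and f: "mdiff A f (\<Phi> p)"
  shows "((f \<circ> \<Phi> \<circ> chart_inv c) has_derivative (\<lambda>v. real_vec d (D v) (\<Phi> p) f)) (at (snd c p))"
proof -
  have f: "cdiff d f (\<Phi> p)" using mdiff_iff d f by blast
  let ?F = "f \<circ> chart_inv d" and ?\<phi> = "snd d \<circ> \<Phi> \<circ> chart_inv c"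
  have "((\<lambda>x. ?F (?\<phi> x)) has_derivative (\<lambda>v. FD ?F (snd d (\<Phi> p)) (D v))) (at (snd c p))"
    by (rule has_derivative_compose[OF D]) (use FD_works[OF f] c in \<open>simp add: chart_inv_left o_def\<close>)
  moreover have "eventually (\<lambda>x. ?F (?\<phi> x) = (f \<circ> \<Phi> \<circ> chart_inv c) x) (nhds (snd c p))"
    using ev by eventually_elim (simp add: d)
  ultimately have "((f \<circ> \<Phi> \<circ> chart_inv c) has_derivative (\<lambda>v. FD ?F (snd d (\<Phi> p)) (D v))) (at (snd c p))"
    by (rule has_derivative_cong_ev[rotated])
  then show ?thesis using f by (simp add: real_vec_def)
qed

text \<open>The chain rule in charts, plus agreement on the remaining \<open>f\<close>: if
  \<open>f\<close> is not differentiable at the image point, \<open>f \<circ> \<Phi>\<close> may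
  still be differentiable at \<open>p\<close>, and the case distinction in \<open>push\<close> makes
  both sides 0.\<close>

lemma push_real_vec:
  fixes \<Phi> :: "'b \<Rightarrow> 'a" and c :: "('b, 'm::finite) chart"
  assumes d: "d \<in> A" "\<Phi> p \<in> fst d" and c: "inj_on (snd c) (fst c)" "p \<in> fst c"
    and ev: "eventually (\<lambda>x. \<Phi> (chart_inv c x) \<in> fst d) (nhds (snd c p))"
    and D: "((snd d \<circ> \<Phi> \<circ> chart_inv c) has_derivative D) (at (snd c p))"
  shows "push A \<Phi> (p, real_vec c v p) = (\<Phi> p, real_vec d (D v) (\<Phi> p))"
proof -
  have "(if mdiff A f (\<Phi> p) then real_vec c v p (f \<circ> \<Phi>) else 0) = real_vec d (D v) (\<Phi> p) f" for f
  proof (cases "mdiff A f (\<Phi> p)")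
    case True
    note compose_derivative[OF assms True]
    from FD_eq[OF this] this show ?thesis
      using True by (auto simp: real_vec_def[of c] differentiable_def)
  next
    case False
    then show ?thesis using mdiff_iff d by (simp add: real_vec_def)
  qed
  then show ?thesis unfolding push_def fst_conv snd_conv by simp
qed

text \<open>\<open>t10\<close> is built from \<open>real_vec\<close> at \<open>v\<close> and at
  \<open>\<i> *s v\<close>, so commutation of \<open>D\<close> with \<open>\<i>\<close> at
  \<open>v\<close> is what carries type (1,0) to type (1,0).\<close>

lemma push_t10:
  fixes \<Phi> :: "'b \<Rightarrow> 'a" and c :: "('b, 'm::finite) chart"
  assumes d: "d \<in> A" "\<Phi> p \<in> fst d" and c: "inj_on (snd c) (fst c)" "p \<in> fst c"
    and ev: "eventually (\<lambda>x. \<Phi> (chart_inv c x) \<in> fst d) (nhds (snd c p))"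
    and D: "((snd d \<circ> \<Phi> \<circ> chart_inv c) has_derivative D) (at (snd c p))"
    and lin: "D (\<i> *s v) = \<i> *s D v"
  shows "push A \<Phi> (p, t10 c v p) = (\<Phi> p, t10 d (D v) (\<Phi> p))"
proof -
  have r: "(if mdiff A f (\<Phi> p) then real_vec c v p (f \<circ> \<Phi>) else 0) = real_vec d (D v) (\<Phi> p) f" for f v
    using fun_cong[OF arg_cong[where f=snd, OF push_real_vec[OF d c ev D, of v]], of f]
    by (simp only: push_def fst_conv snd_conv)
  have "(if mdiff A f (\<Phi> p) then t10 c v p (f \<circ> \<Phi>) else 0) = t10 d (D v) (\<Phi> p) f" for f
    unfolding t10_def lin[symmetric] r[symmetric] by simp
  then show ?thesis unfolding push_def fst_conv snd_conv by simp
qed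

end

section \<open>Atlases of the tangent bundles\<close>

definition TR_chart :: "('a, 'n::finite) atlas \<Rightarrow> ('a, 'n) chart \<Rightarrow> ('a \<times> 'a tvec, 'n + 'n) chart" where
  "TR_chart A c = ({y \<in> TR A. fst y \<in> fst c}, induced_coord c)"

lemma TR_atlas_eq: "TR_atlas A = TR_chart A ` A"
  by (simp add: TR_atlas_def TR_chart_def[abs_def])

lemma induced_coord_vpair:
  "induced_coord c y = vpair (snd c (fst y)) (\<chi> i. snd y (\<lambda>q. snd c q $ i))"
  by (simp add: induced_coord_def vpair_def cong: sum.case_cong)

context holo_atlas
begin

lemma points_mem: "c \<in> A \<Longrightarrow> p \<in> fst c \<Longrightarrow> p \<in> points A"
  by (auto simp: points_def)

lemma T10_E:
  assumes "y \<in> T10 A" "c \<in> A" "fst y \<in> fst c"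
  obtains w where "y = (fst y, t10 c w (fst y))"
  using assms T10_space_eq[OF assms(2,3)] by (cases y) (auto simp: T10_def)

lemma TR_E:
  assumes "y \<in> TR A" "c \<in> A" "fst y \<in> fst c"
  obtains w where "y = (fst y, real_vec c w (fst y))"
  using assms TR_space_eq[OF assms(2,3)] by (cases y) (auto simp: TR_def)

lemma t10_mem: "c \<in> A \<Longrightarrow> p \<in> fst c \<Longrightarrow> (p, t10 c w p) \<in> T10 A"
  using T10_space_eq points_mem by (auto simp: T10_def)

lemma real_vec_mem: "c \<in> A \<Longrightarrow> p \<in> fst c \<Longrightarrow> (p, real_vec c w p) \<in> TR A"
  using TR_space_eq points_mem by (auto simp: TR_def)

lemma coord_t10: "c \<in> A \<Longrightarrow> p \<in> fst c \<Longrightarrow> induced_coord c (p, t10 c w p) = vpair (snd c p) w"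
  by (simp add: induced_coord_vpair t10_coord vec_eq_iff)

lemma coord_real_vec: "c \<in> A \<Longrightarrow> p \<in> fst c \<Longrightarrow> induced_coord c (p, real_vec c w p) = vpair (snd c p) w"
  by (simp add: induced_coord_vpair real_vec_coord vec_eq_iff)

end

text \<open>\<open>T10 A\<close> and \<open>TR A\<close> have the same induced coordinates and the
  same transformation law, with \<open>t10\<close> or \<open>real_vec\<close> as the vector of given
  components; this locale serves both.\<close>

locale bundle_atlas = holo_atlas A for A :: "('a, 'n::finite) atlas" +
  fixes E :: "('a \<times> 'a tvec) set" and vec :: "('a, 'n) chart \<Rightarrow> complex^'n \<Rightarrow> 'a tfield"
  assumes vec_E: "y \<in> E \<Longrightarrow> c \<in> A \<Longrightarrow> fst y \<in> fst c \<Longrightarrow> (\<And>w. y = (fst y, vec c w (fst y)) \<Longrightarrow> thesis) \<Longrightarrow> thesis"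
    and vec_mem: "c \<in> A \<Longrightarrow> p \<in> fst c \<Longrightarrow> (p, vec c w p) \<in> E"
    and vec_coord: "c \<in> A \<Longrightarrow> p \<in> fst c \<Longrightarrow> induced_coord c (p, vec c w p) = vpair (snd c p) w"
    and vec_change: "c \<in> A \<Longrightarrow> p \<in> fst c \<Longrightarrow> d \<in> A \<Longrightarrow> p \<in> fst d \<Longrightarrow>
      vec c w p = vec d (FD (snd d \<circ> chart_inv c) (snd c p) w) p"
begin

definition bundle_chart :: "('a, 'n) chart \<Rightarrow> ('a \<times> 'a tvec, 'n + 'n) chart" where
  "bundle_chart c = ({y \<in> E. fst y \<in> fst c}, induced_coord c)"

lemma bundle_chart_inj:
  assumes c: "c \<in> A"
  shows "inj_on (snd (bundle_chart c)) (fst (bundle_chart c))"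
proof (rule inj_on_inverseI[where g="\<lambda>q. (chart_inv c (vfst q), vec c (vsnd q) (chart_inv c (vfst q)))"])
  fix y assume "y \<in> fst (bundle_chart c)"
  then have y: "y \<in> E" "fst y \<in> fst c" by (auto simp: bundle_chart_def)
  then obtain w where w: "y = (fst y, vec c w (fst y))" by (rule vec_E[OF _ c])
  then have "induced_coord c y = vpair (snd c (fst y)) w" using vec_coord[OF c y(2)] by metis
  then show "(chart_inv c (vfst (snd (bundle_chart c) y)), vec c (vsnd (snd (bundle_chart c) y))
      (chart_inv c (vfst (snd (bundle_chart c) y)))) = y"
    using w c y(2) by (simp add: bundle_chart_def)
qed

lemma bundle_chart_img:
  assumes c: "c \<in> A"
  shows "snd (bundle_chart c) ` (fst (bundle_chart c) \<inter> {y. fst y \<in> S}) = {q :: 'n cpair. vfst q \<in> snd c ` (fst c \<inter> S)}"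
proof (intro equalityI subsetI)
  fix q assume "q \<in> snd (bundle_chart c) ` (fst (bundle_chart c) \<inter> {y. fst y \<in> S})"
  then obtain y where y: "q = induced_coord c y" "y \<in> E" "fst y \<in> fst c" "fst y \<in> S"
    by (auto simp: bundle_chart_def)
  then show "q \<in> {q. vfst q \<in> snd c ` (fst c \<inter> S)}"
    by (auto simp: induced_coord_vpair)
next
  fix q :: "'n cpair" assume "q \<in> {q. vfst q \<in> snd c ` (fst c \<inter> S)}"
  then obtain p where p: "vfst q = snd c p" "p \<in> fst c" "p \<in> S" by auto
  then have "q = induced_coord c (p, vec c (vsnd q) p)" "(p, vec c (vsnd q) p) \<in> E"
    using vec_coord[OF c p(2)] vec_mem[OF c p(2)] by (simp_all flip: p(1))
  then show "q \<in> snd (bundle_chart c) ` (fst (bundle_chart c) \<inter> {y. fst y \<in> S})"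
    using p by (auto simp: bundle_chart_def)
qed

lemma bundle_chart_inv:
  assumes c: "c \<in> A" and q: "vfst q \<in> snd c ` fst c"
  shows "chart_inv (bundle_chart c) q = (chart_inv c (vfst q), vec c (vsnd q) (chart_inv c (vfst q)))"
proof -
  let ?p = "chart_inv c (vfst q)"
  have p: "?p \<in> fst c" "snd c ?p = vfst q" using chart_inv_into[OF q] chart_inv_right[OF q] .
  have "q = snd (bundle_chart c) (?p, vec c (vsnd q) ?p)"
    using vec_coord[OF c p(1)] p(2) by (simp add: bundle_chart_def)
  then show ?thesis
    using chart_inv_left[OF bundle_chart_inj[OF c], of "(?p, vec c (vsnd q) ?p)"] vec_mem[OF c p(1)] p(1)
    by (simp add: bundle_chart_def)
qed

text \<open>These maps are the chart changes of both tangent bundles. Holomorphy of the fibre part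
  needs the derivative to be holomorphic jointly in point and direction.\<close>

lemma holo_bundle_trans:
  assumes c: "c \<in> A" and d: "d \<in> A"
  shows "holo_on (\<lambda>q :: 'n cpair. vpair ((snd d \<circ> chart_inv c) (vfst q)) (FD (snd d \<circ> chart_inv c) (vfst q) (vsnd q)))
     {q. vfst q \<in> snd c ` (fst c \<inter> fst d)}"
  by (intro holo_on_vpair holo_on_compose[OF holo_on_vfst holo_trans[OF c d]]
      holo_FD_joint[OF holo_trans[OF c d] open_overlap[OF c d]]) auto

lemma holo_atlas_bundle: "holo_atlas (bundle_chart ` A)"
proof
  fix c' d' assume "c' \<in> bundle_chart ` A" "d' \<in> bundle_chart ` A"
  then obtain c d where c: "c \<in> A" "c' = bundle_chart c" and d: "d \<in> A" "d' = bundle_chart d"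
    by auto
  show "inj_on (snd c') (fst c')" using bundle_chart_inj c by simp
  have img: "snd c' ` (fst c' \<inter> fst d') = {q. vfst q \<in> snd c ` (fst c \<inter> fst d)}"
  proof -
    have "fst c' \<inter> fst d' = fst (bundle_chart c) \<inter> {y. fst y \<in> fst d}"
      by (auto simp: c d bundle_chart_def)
    then show ?thesis using bundle_chart_img[OF c(1), of "fst d"] by (simp add: c)
  qed
  show op: "open (snd c' ` (fst c' \<inter> fst d'))"
    unfolding img by (rule open_vfst_vimage[OF open_overlap[OF c(1) d(1)]])
  show "holo_on (snd d' \<circ> chart_inv c') (snd c' ` (fst c' \<inter> fst d'))"
    unfolding img
  proof (rule holo_on_cong[OF holo_bundle_trans[OF c(1) d(1)]])
    show "open {q :: 'n cpair. vfst q \<in> snd c ` (fst c \<inter> fst d)}" using op img by simp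
    fix q :: "'n cpair" assume q: "q \<in> {q. vfst q \<in> snd c ` (fst c \<inter> fst d)}"
    then obtain p where p: "vfst q = snd c p" "p \<in> fst c" "p \<in> fst d" by auto
    have "chart_inv c' q = (p, vec c (vsnd q) p)"
      using bundle_chart_inv[OF c(1), of q] p c by simp
    also have "\<dots> = (p, vec d (FD (snd d \<circ> chart_inv c) (snd c p) (vsnd q)) p)"
      using vec_change[OF c(1) p(2) d(1) p(3)] by simp
    finally have "snd d' (chart_inv c' q) = vpair (snd d p) (FD (snd d \<circ> chart_inv c) (snd c p) (vsnd q))"
      using vec_coord[OF d(1) p(3)] by (simp add: d(2) bundle_chart_def)
    then show "vpair ((snd d \<circ> chart_inv c) (vfst q)) (FD (snd d \<circ> chart_inv c) (vfst q) (vsnd q))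
        = (snd d' \<circ> chart_inv c') q"
      using p c by simp
  qed
qed

end

context holo_atlas
begin

lemma bundle_T10: "bundle_atlas A (T10 A) t10"
  by unfold_locales (erule T10_E, assumption+, (rule t10_mem coord_t10 t10_change, assumption+)+)

lemma bundle_TR: "bundle_atlas A (TR A) real_vec"
  by unfold_locales (erule TR_E, assumption+, (rule real_vec_mem coord_real_vec real_vec_change, assumption+)+)

lemma bundle_chart_T10: "bundle_atlas.bundle_chart (T10 A) = T10_chart A"
  by (simp add: fun_eq_iff bundle_atlas.bundle_chart_def[OF bundle_T10] T10_chart_def)

lemma bundle_chart_TR: "bundle_atlas.bundle_chart (TR A) = TR_chart A"
  by (simp add: fun_eq_iff bundle_atlas.bundle_chart_def[OF bundle_TR] TR_chart_def)

lemmas T10_chart_inj = bundle_atlas.bundle_chart_inj[OF bundle_T10, unfolded bundle_chart_T10]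
lemmas T10_chart_img = bundle_atlas.bundle_chart_img[OF bundle_T10, unfolded bundle_chart_T10]
lemmas T10_chart_inv = bundle_atlas.bundle_chart_inv[OF bundle_T10, unfolded bundle_chart_T10]
lemmas holo_atlas_T10 = bundle_atlas.holo_atlas_bundle[OF bundle_T10,
    unfolded bundle_chart_T10, folded T10_atlas_def]
  and holo_atlas_TR = bundle_atlas.holo_atlas_bundle[OF bundle_TR,
    unfolded bundle_chart_TR, folded TR_atlas_eq]

lemma T10_chart_mem: "c \<in> A \<Longrightarrow> T10_chart A c \<in> T10_atlas A"
  by (simp add: T10_atlas_def)

lemma TR_chart_mem: "c \<in> A \<Longrightarrow> TR_chart A c \<in> TR_atlas A"
  by (simp add: TR_atlas_eq)

lemma circ_map_t10: "circ_map (p, t10 c w p) = (p, real_vec c w p)"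
  by (simp add: circ_map_def circ_t10)

lemma t10_in_chart: "c \<in> A \<Longrightarrow> p \<in> fst c \<Longrightarrow> (p, t10 c w p) \<in> fst (T10_chart A c)"
  by (simp add: T10_chart_def t10_mem)

lemma real_vec_in_chart: "c \<in> A \<Longrightarrow> p \<in> fst c \<Longrightarrow> (p, real_vec c w p) \<in> fst (TR_chart A c)"
  by (simp add: TR_chart_def real_vec_mem)

text \<open>In induced coordinates \<open>circ_map\<close> is the identity, so its differential
  keeps components, as \<open>circ\<close> itself does.\<close>

lemma circ_TM_t10:
  assumes c: "c \<in> A" "p \<in> fst c"
  shows "circ_TM A (p, t10 c w p) (t10 (T10_chart A c) a (p, t10 c w p))
     = real_vec (TR_chart A c) a (p, real_vec c w p)"
proof -
  interpret TR: holo_atlas "TR_atlas A" by (rule holo_atlas_TR)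
  interpret T10: holo_atlas "T10_atlas A" by (rule holo_atlas_T10)
  let ?y = "(p, t10 c w p)" and ?S = "{q :: 'n cpair. vfst q \<in> snd c ` fst c}"
  have S: "open ?S" by (rule open_vfst_vimage[OF open_img[OF c(1)]])
  have ceq: "snd (T10_chart A c) ?y = vpair (snd c p) w"
    using coord_t10[OF c] by (simp add: T10_chart_def)
  then have qS: "snd (T10_chart A c) ?y \<in> ?S" using c by simp
  have ev: "chart_inv (T10_chart A c) q \<in> fst (T10_chart A c) \<and> circ_map (chart_inv (T10_chart A c) q) \<in> fst (TR_chart A c)
    \<and> snd (TR_chart A c) (circ_map (chart_inv (T10_chart A c) q)) = q"
    if q: "q \<in> ?S" for q
  proof -
    have q': "vfst q \<in> snd c ` fst c" using q by simp
    note p = chart_inv_into[OF q'] chart_inv_right[OF q']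
    show ?thesis
      using T10_chart_inv[OF c(1) q'] real_vec_mem[OF c(1) p(1)] t10_mem[OF c(1) p(1)] coord_real_vec[OF c(1) p(1)] p
      by (simp add: circ_map_t10 TR_chart_def T10_chart_def)
  qed
  have "push (TR_atlas A) circ_map (?y, real_vec (T10_chart A c) a ?y)
    = (circ_map ?y, real_vec (TR_chart A c) (id a) (circ_map ?y))"
  proof (rule TR.push_real_vec[OF TR_chart_mem[OF c(1)]])
    show "circ_map ?y \<in> fst (TR_chart A c)" "?y \<in> fst (T10_chart A c)"
      using real_vec_in_chart[OF c] t10_in_chart[OF c] by (simp_all add: circ_map_t10)
    show "inj_on (snd (T10_chart A c)) (fst (T10_chart A c))" by (rule T10_chart_inj[OF c(1)])
    show "eventually (\<lambda>x. circ_map (chart_inv (T10_chart A c) x) \<in> fst (TR_chart A c)) (nhds (snd (T10_chart A c) ?y))"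
      using eventually_nhds_in_open[OF S qS] by eventually_elim (use ev in simp)
    show "(snd (TR_chart A c) \<circ> circ_map \<circ> chart_inv (T10_chart A c) has_derivative id) (at (snd (T10_chart A c) ?y))"
      by (rule has_derivative_transform_within_open[OF has_derivative_id[unfolded id_def[symmetric]] S qS]) (use ev in auto)
  qed
  then show ?thesis by (simp add: circ_TM_def circ_t10 circ_map_t10)
qed

text \<open>Continuity of a curve is extracted from its velocity: \<open>has_velocity\<close> tests
  with all functions differentiable at the point, among them the indicator of \<open>S\<close>,
  which is locally constant there. Along the curve this indicator is differentiable, hence
  continuous, hence nonzero near \<open>t\<close>.\<close>

lemma velocity_open:
  assumes c: "c \<in> A" "\<gamma> t \<in> fst c" and v: "has_velocity A \<gamma> D t"
    and S: "open (snd c ` (fst c \<inter> S))" "\<gamma> t \<in> S"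
  shows "eventually (\<lambda>s. \<gamma> s \<in> S) (nhds t)"
proof -
  define f where "f q = (if q \<in> S then 1 else 0 :: complex)" for q
  have x: "snd c (\<gamma> t) \<in> snd c ` (fst c \<inter> S)" using c S by auto
  have "((f \<circ> chart_inv c) has_derivative (\<lambda>v. 0)) (at (snd c (\<gamma> t)))"
    by (rule has_derivative_transform_within_open[OF has_derivative_const[of 1] S(1) x])
      (use mem_img_Int[OF c(1)] in \<open>auto simp: f_def\<close>)
  then have "mdiff A f (\<gamma> t)" using mdiff_iff[OF c] by (auto simp: differentiable_def)
  then have "((\<lambda>s. f (\<gamma> s)) has_vector_derivative D f) (at t)"
    using v by (simp add: has_velocity_def)
  then have "eventually (\<lambda>s. f (\<gamma> s) \<in> ball 1 1) (nhds t)"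
    by (intro eventually_in_open has_vector_derivative_continuous) (use S(2) in \<open>auto simp: f_def\<close>)
  then show ?thesis by eventually_elim (auto simp: f_def split: if_splits)
qed

lemma has_vector_derivative_vec:
  fixes g :: "real \<Rightarrow> complex^'m::finite"
  assumes "\<And>i. ((\<lambda>s. g s $ i) has_vector_derivative v $ i) F"
  shows "(g has_vector_derivative v) F"
proof -
  have "((\<lambda>s. \<Sum>i\<in>UNIV. g s $ i *s axis i 1) has_vector_derivative (\<Sum>i\<in>UNIV. v $ i *s axis i 1)) F"
    by (intro has_vector_derivative_sum bounded_linear.has_vector_derivative[OF bounded_linear_vmult_left] assms)
  then show ?thesis by (simp only: basis_expansion)
qed

lemma velocity_coord:
  assumes c: "c \<in> A" "\<gamma> t \<in> fst c" and v: "has_velocity A \<gamma> (real_vec c v (\<gamma> t)) t"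
  shows "eventually (\<lambda>s. \<gamma> s \<in> fst c) (nhds t)"
    "((\<lambda>s. snd c (\<gamma> s)) has_vector_derivative v) (at t)"
proof -
  show "eventually (\<lambda>s. \<gamma> s \<in> fst c) (nhds t)"
    by (rule velocity_open[OF c v]) (use open_img c in auto)
  have "((\<lambda>s. snd c (\<gamma> s) $ i) has_vector_derivative v $ i) (at t)" for i
  proof -
    have "((\<lambda>x. x $ i) has_derivative (\<lambda>v. v $ i)) (at (snd c (\<gamma> t)))"
      by (rule bounded_linear_imp_has_derivative[OF bounded_linear_vec_nth])
    then have "(((\<lambda>q. snd c q $ i) \<circ> chart_inv c) has_derivative (\<lambda>v. v $ i)) (at (snd c (\<gamma> t)))"
      by (rule has_derivative_transform_within_open[OF _ open_img[OF c(1)]])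
        (use c in \<open>auto simp: chart_inv_right\<close>)
    then have "mdiff A (\<lambda>q. snd c q $ i) (\<gamma> t)" using mdiff_iff[OF c] by (auto simp: differentiable_def)
    then show ?thesis using v real_vec_coord[OF c] by (fastforce simp: has_velocity_def)
  qed
  then show "((\<lambda>s. snd c (\<gamma> s)) has_vector_derivative v) (at t)"
    by (rule has_vector_derivative_vec)
qed

lemma velocityI:
  assumes c: "c \<in> A" "\<gamma> t \<in> fst c"
    and ev: "eventually (\<lambda>s. \<gamma> s \<in> fst c) (nhds t)"
    and d: "((\<lambda>s. snd c (\<gamma> s)) has_vector_derivative v) (at t)"
  shows "has_velocity A \<gamma> (real_vec c v (\<gamma> t)) t"
  unfolding has_velocity_def
proof (intro allI impI)
  fix f assume "mdiff A f (\<gamma> t)"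
  then have f: "cdiff c f (\<gamma> t)" using mdiff_iff[OF c] by simp
  have "((\<lambda>s. (f \<circ> chart_inv c) (snd c (\<gamma> s))) has_derivative (\<lambda>h. FD (f \<circ> chart_inv c) (snd c (\<gamma> t)) (h *\<^sub>R v))) (at t)"
    by (rule has_derivative_compose[OF d[unfolded has_vector_derivative_def] FD_works[OF f]])
  then have D: "((\<lambda>s. (f \<circ> chart_inv c) (snd c (\<gamma> s))) has_vector_derivative real_vec c v (\<gamma> t) f) (at t)"
    by (simp add: has_vector_derivative_def FD_scaleR[OF f] real_vec_def f)
  have "eventually (\<lambda>s. (f \<circ> chart_inv c) (snd c (\<gamma> s)) = f (\<gamma> s)) (nhds t)"
    using ev by eventually_elim (simp add: c)
  from has_derivative_cong_ev[OF this] D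
  show "((\<lambda>s. f (\<gamma> s)) has_vector_derivative real_vec c v (\<gamma> t) f) (at t)"
    unfolding has_vector_derivative_def by blast
qed

end

lemma complex_manifold_holo_atlas:
  assumes "complex_manifold X A"
  shows "holo_atlas A"
    and "\<And>c S. c \<in> A \<Longrightarrow> openin X S \<Longrightarrow> open (snd c ` (fst c \<inter> S))"
proof -
  have hm: "openin X (fst c)" "open (snd c ` fst c)"
    "homeomorphic_map (subtopology X (fst c)) (top_of_set (snd c ` fst c)) (snd c)" if "c \<in> A" for c
    using assms that by (auto simp: complex_manifold_def)
  show op: "open (snd c ` (fst c \<inter> S))" if c: "c \<in> A" and S: "openin X S" for c S
  proof -
    have "openin (subtopology X (fst c)) (fst c \<inter> S)"
      using S by (metis inf_commute openin_subtopology)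
    then have "openin (top_of_set (snd c ` fst c)) (snd c ` (fst c \<inter> S))"
      using homeomorphic_imp_open_map[OF hm(3)[OF c]] by (simp add: open_map_def)
    then show ?thesis using hm(2)[OF c] openin_open_eq by blast
  qed
  show "holo_atlas A"
  proof
    show "inj_on (snd c) (fst c)" if c: "c \<in> A" for c
    proof -
      have "fst c \<subseteq> topspace X" using hm(1)[OF c] openin_subset by blast
      then show ?thesis
        using homeomorphic_imp_injective_map[OF hm(3)[OF c]] by (simp add: Int_absorb1 Int_absorb2)
    qed
    show "open (snd c ` (fst c \<inter> fst d))" if "c \<in> A" "d \<in> A" for c d
      using op hm(1) that by blast
    show "holo_on (snd d \<circ> chart_inv c) (snd c ` (fst c \<inter> fst d))" if "c \<in> A" "d \<in> A" for c d
      using assms that by (auto simp: complex_manifold_def)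
  qed
qed

section \<open>Local charts of the multiplication\<close>

lemma real_vec_cong_open:
  assumes c: "inj_on (snd c) (fst c)" and W: "W \<subseteq> fst c" "open (snd c ` W)" "p \<in> W"
    and eq: "\<And>q. q \<in> W \<Longrightarrow> f q = g q"
  shows "real_vec c v p f = real_vec c v p g"
proof -
  have "eventually (\<lambda>x. (f \<circ> chart_inv c) x = (g \<circ> chart_inv c) x) (nhds (snd c p))"
    using eventually_nhds_in_open[OF W(2) imageI[OF W(3)]]
    by eventually_elim (use W(1) eq chart_inv_left[OF c] in auto)
  from differentiable_cong_ev[OF this] show ?thesis unfolding real_vec_def by argo
qed

context holo_atlas
begin

lemma mdiff_compose:
  fixes \<Phi> :: "'a \<Rightarrow> 'a"
  assumes d: "d \<in> A" "\<Phi> p \<in> fst d" and c: "c \<in> A" "p \<in> fst c"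
    and ev: "eventually (\<lambda>x. \<Phi> (chart_inv c x) \<in> fst d) (nhds (snd c p))"
    and D: "((snd d \<circ> \<Phi> \<circ> chart_inv c) has_derivative D) (at (snd c p))"
    and f: "mdiff A f (\<Phi> p)"
  shows "mdiff A (f \<circ> \<Phi>) p"
  using compose_derivative[OF d inj[OF c(1)] c(2) ev D f] mdiff_iff[OF c]
  by (auto simp: differentiable_def)

text \<open>Differentials depend only on values near the point. The neighbourhood \<open>W\<close>
  may sit in another chart than the vector, as happens for the domains of local flows.\<close>

lemma push_cong:
  assumes c: "c \<in> A" "p \<in> fst c" and W: "d \<in> A" "W \<subseteq> fst d" "open (snd d ` W)" "p \<in> W"
    and eq: "\<And>q. q \<in> W \<Longrightarrow> \<Phi> q = \<Psi> q"
  shows "push A \<Phi> (p, real_vec c v p) = push A \<Psi> (p, real_vec c v p)"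
proof -
  have p: "p \<in> fst d" using W by auto
  have "real_vec c v p (f \<circ> \<Phi>) = real_vec c v p (f \<circ> \<Psi>)" for f
    unfolding real_vec_change[OF c W(1) p]
    by (rule real_vec_cong_open[OF inj[OF W(1)] W(2-4)]) (simp add: eq)
  then show ?thesis using eq[OF W(4)] by (auto simp: push_def fun_eq_iff)
qed

lemma push_ident:
  assumes c: "c \<in> A" "p \<in> fst c" and eq: "\<And>q. q \<in> points A \<Longrightarrow> \<Phi> q = q"
  shows "push A \<Phi> (p, real_vec c v p) = (p, real_vec c v p)"
proof -
  have "push A \<Phi> (p, real_vec c v p) = push A id (p, real_vec c v p)"
    by (rule push_cong[OF c c(1) subset_refl open_img[OF c(1)] c(2)]) (use eq points_mem[OF c(1)] in auto)
  also have "\<dots> = (p, real_vec c v p)"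
    using mdiff_iff[OF c] by (auto simp: push_def fun_eq_iff real_vec_def)
  finally show ?thesis .
qed

end

text \<open>The group is recorded through a curried product and its unit, with holomorphy in every
  choice of charts, so that swapping the arguments gives another instance. The topology enters
  through Hausdorff separation and through open sets read in charts.\<close>

locale lie_charts = holo_atlas A for A :: "('a, 'n::finite) atlas" +
  fixes X :: "'a topology" and mul :: "'a \<Rightarrow> 'a \<Rightarrow> 'a" and e :: 'a
  assumes haus: "Hausdorff_space X" and top: "topspace X = points A"
    and openX: "c \<in> A \<Longrightarrow> openin X S \<Longrightarrow> open (snd c ` (fst c \<inter> S))"
    and mul_closed [simp, intro]: "p \<in> points A \<Longrightarrow> q \<in> points A \<Longrightarrow> mul p q \<in> points A"
    and mul_assoc: "p \<in> points A \<Longrightarrow> q \<in> points A \<Longrightarrow> r \<in> points A \<Longrightarrow> mul (mul p q) r = mul p (mul q r)"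
    and e_points [simp, intro]: "e \<in> points A"
    and mul_e [simp]: "p \<in> points A \<Longrightarrow> mul e p = p" "p \<in> points A \<Longrightarrow> mul p e = p"
    and mul_inv: "p \<in> points A \<Longrightarrow> \<exists>q\<in>points A. mul p q = e \<and> mul q p = e"
    and holo_mul: "c \<in> A \<Longrightarrow> d \<in> A \<Longrightarrow> k \<in> A \<Longrightarrow> g \<in> fst c \<Longrightarrow> h \<in> fst d \<Longrightarrow> mul g h \<in> fst k \<Longrightarrow>
      \<exists>\<Omega>. open \<Omega> \<and> vpair (snd c g) (snd d h) \<in> \<Omega> \<and>
        (\<forall>q\<in>\<Omega>. vfst q \<in> snd c ` fst c \<and> vsnd q \<in> snd d ` fst d \<and> mul (chart_inv c (vfst q)) (chart_inv d (vsnd q)) \<in> fst k) \<and>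
        holo_on (\<lambda>q :: 'n cpair. snd k (mul (chart_inv c (vfst q)) (chart_inv d (vsnd q)))) \<Omega>"
begin

text \<open>The opposite group, through which every fact on left invariant fields yields one on
  right invariant fields. The domain of holomorphy is the mirror image of the given one under
  exchange of the arguments.\<close>

lemma lie_charts_opp: "lie_charts A X (\<lambda>x y. mul y x) e"
proof unfold_locales
  show "Hausdorff_space X" "topspace X = points A" by (rule haus, rule top)
  show "open (snd c ` (fst c \<inter> S))" if "c \<in> A" "openin X S" for c S using openX that .
  show "mul q p \<in> points A" if "p \<in> points A" "q \<in> points A" for p q using that by simp
  show "mul r (mul q p) = mul (mul r q) p" if "p \<in> points A" "q \<in> points A" "r \<in> points A" for p q r
    using mul_assoc that by simp
  show "e \<in> points A" by simp
  show "mul p e = p" "mul e p = p" if "p \<in> points A" for p using that by simp_all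
  show "\<exists>q\<in>points A. mul q p = e \<and> mul p q = e" if "p \<in> points A" for p using mul_inv[OF that] by blast
  fix c d k g h assume H: "c \<in> A" "d \<in> A" "k \<in> A" "g \<in> fst c" "h \<in> fst d" "mul h g \<in> fst k"
  obtain \<Omega> where O: "open \<Omega>" "vpair (snd d h) (snd c g) \<in> \<Omega>"
     "\<forall>q\<in>\<Omega>. vfst q \<in> snd d ` fst d \<and> vsnd q \<in> snd c ` fst c \<and> mul (chart_inv d (vfst q)) (chart_inv c (vsnd q)) \<in> fst k"
     "holo_on (\<lambda>q :: 'n cpair. snd k (mul (chart_inv d (vfst q)) (chart_inv c (vsnd q)))) \<Omega>"
    using holo_mul[OF H(2,1,3,5,4,6)] by auto
  let ?sw = "\<lambda>q :: 'n cpair. vpair (vsnd q) (vfst q) :: 'n cpair"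
  let ?O = "{q. ?sw q \<in> \<Omega>}"
  have "holo_on ?sw ?O" by (intro holo_on_vpair holo_on_vsnd holo_on_vfst)
  from holo_on_compose[OF this O(4)]
  have "holo_on (\<lambda>q :: 'n cpair. snd k (mul (chart_inv d (vsnd q)) (chart_inv c (vfst q)))) ?O" by simp
  moreover have "open ?O"
    using open_vimage[OF O(1), of ?sw] by (simp add: vimage_def continuous_intros)
  moreover have "vpair (snd c g) (snd d h) \<in> ?O" using O by simp
  ultimately show "\<exists>\<Omega>. open \<Omega> \<and> vpair (snd c g) (snd d h) \<in> \<Omega> \<and>
        (\<forall>q\<in>\<Omega>. vfst q \<in> snd c ` fst c \<and> vsnd q \<in> snd d ` fst d \<and> mul (chart_inv d (vsnd q)) (chart_inv c (vfst q)) \<in> fst k) \<and>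
        holo_on (\<lambda>q :: 'n cpair. snd k (mul (chart_inv d (vsnd q)) (chart_inv c (vfst q)))) \<Omega>"
    using O(3) by (intro exI[of _ ?O]) auto
qed

definition mloc :: "('a, 'n) chart \<Rightarrow> ('a, 'n) chart \<Rightarrow> ('a, 'n) chart \<Rightarrow> 'n cpair \<Rightarrow> complex^'n" where
  "mloc c d k q = snd k (mul (chart_inv c (vfst q)) (chart_inv d (vsnd q)))"

definition mdom :: "('a, 'n) chart \<Rightarrow> ('a, 'n) chart \<Rightarrow> ('a, 'n) chart \<Rightarrow> ('n cpair) set" where
  "mdom c d k = {q. vfst q \<in> snd c ` fst c \<and> vsnd q \<in> snd d ` fst d \<and> mul (chart_inv c (vfst q)) (chart_inv d (vsnd q)) \<in> fst k}"

lemma mdom_local: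
  assumes "c \<in> A" "d \<in> A" "k \<in> A" "q \<in> mdom c d k"
  shows "\<exists>\<Omega>. open \<Omega> \<and> q \<in> \<Omega> \<and> \<Omega> \<subseteq> mdom c d k \<and> holo_on (mloc c d k) \<Omega>"
proof -
  obtain g h where g: "vfst q = snd c g" "g \<in> fst c" and h: "vsnd q = snd d h" "h \<in> fst d"
    using assms(4) by (auto simp: mdom_def)
  then have "vpair (snd c g) (snd d h) = q" by (metis vpair_collapse)
  moreover have "mul g h \<in> fst k" using assms g h by (simp add: mdom_def)
  ultimately show ?thesis
    using holo_mul[OF assms(1-3) g(2) h(2)] unfolding mdom_def mloc_def[abs_def] by blast
qed

lemma open_mdom:
  assumes "c \<in> A" "d \<in> A" "k \<in> A"
  shows "open (mdom c d k)"
proof (subst open_subopen, rule ballI)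
  fix q assume "q \<in> mdom c d k"
  from mdom_local[OF assms this] show "\<exists>T. open T \<and> q \<in> T \<and> T \<subseteq> mdom c d k" by blast
qed

lemma holo_mloc:
  assumes "c \<in> A" "d \<in> A" "k \<in> A"
  shows "holo_on (mloc c d k) (mdom c d k)"
proof (rule holo_on_locally)
  fix q assume "q \<in> mdom c d k"
  from mdom_local[OF assms this] show "\<exists>T. q \<in> T \<and> holo_on (mloc c d k) T" by blast
qed

lemma mdom_mem:
  "c \<in> A \<Longrightarrow> d \<in> A \<Longrightarrow> g \<in> fst c \<Longrightarrow> h \<in> fst d \<Longrightarrow> mul g h \<in> fst k \<Longrightarrow> vpair (snd c g) (snd d h) \<in> mdom c d k"
  by (simp add: mdom_def)

lemma left_local:
  assumes c: "c \<in> A" "g \<in> fst c" and d: "d \<in> A" "h \<in> fst d" and k: "k \<in> A" "mul g h \<in> fst k"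
  shows "eventually (\<lambda>y. mul g (chart_inv d y) \<in> fst k) (nhds (snd d h))"
    and "((snd k \<circ> mul g \<circ> chart_inv d) has_derivative
      (\<lambda>v. FD (mloc c d k) (vpair (snd c g) (snd d h)) (vpair 0 v))) (at (snd d h))"
proof -
  let ?V = "{y. vpair (snd c g) y \<in> mdom c d k}"
  have V: "open ?V"
    using open_vimage[OF open_mdom[OF c(1) d(1) k(1)], of "\<lambda>y. vpair (snd c g) y"]
    by (simp add: vimage_def continuous_intros)
  have hV: "snd d h \<in> ?V" using mdom_mem[OF c(1) d(1) c(2) d(2) k(2)] by simp
  have im: "mul g (chart_inv d y) \<in> fst k" if "y \<in> ?V" for y
    using that c by (simp add: mdom_def)
  show "eventually (\<lambda>y. mul g (chart_inv d y) \<in> fst k) (nhds (snd d h))"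
    using eventually_nhds_in_open[OF V hV] by eventually_elim (rule im)
  have "((\<lambda>y. mloc c d k (vpair (snd c g) y)) has_derivative
      (\<lambda>v. FD (mloc c d k) (vpair (snd c g) (snd d h)) (vpair 0 v))) (at (snd d h))"
    by (rule has_derivative_compose[OF _ holo_onD(2)[OF holo_mloc[OF c(1) d(1) k(1)]]])
      (use hV in \<open>auto intro!: derivative_eq_intros\<close>)
  moreover have "snd k \<circ> mul g \<circ> chart_inv d = (\<lambda>y. mloc c d k (vpair (snd c g) y))"
    by (auto simp: mloc_def c)
  ultimately show "((snd k \<circ> mul g \<circ> chart_inv d) has_derivative
      (\<lambda>v. FD (mloc c d k) (vpair (snd c g) (snd d h)) (vpair 0 v))) (at (snd d h))"
    by (simp only:)
qed

lemma right_local: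
  assumes c: "c \<in> A" "g \<in> fst c" and d: "d \<in> A" "h \<in> fst d" and k: "k \<in> A" "mul g h \<in> fst k"
  shows "eventually (\<lambda>x. mul (chart_inv c x) h \<in> fst k) (nhds (snd c g))"
    and "((snd k \<circ> (\<lambda>x. mul x h) \<circ> chart_inv c) has_derivative
      (\<lambda>v. FD (mloc c d k) (vpair (snd c g) (snd d h)) (vpair v 0))) (at (snd c g))"
proof -
  let ?V = "{x. vpair x (snd d h) \<in> mdom c d k}"
  have V: "open ?V"
    using open_vimage[OF open_mdom[OF c(1) d(1) k(1)], of "\<lambda>x. vpair x (snd d h)"]
    by (simp add: vimage_def continuous_intros)
  have hV: "snd c g \<in> ?V" using mdom_mem[OF c(1) d(1) c(2) d(2) k(2)] by simp
  have im: "mul (chart_inv c x) h \<in> fst k" if "x \<in> ?V" for x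
    using that d by (simp add: mdom_def)
  show "eventually (\<lambda>x. mul (chart_inv c x) h \<in> fst k) (nhds (snd c g))"
    using eventually_nhds_in_open[OF V hV] by eventually_elim (rule im)
  have "((\<lambda>x. mloc c d k (vpair x (snd d h))) has_derivative
      (\<lambda>v. FD (mloc c d k) (vpair (snd c g) (snd d h)) (vpair v 0))) (at (snd c g))"
    by (rule has_derivative_compose[OF _ holo_onD(2)[OF holo_mloc[OF c(1) d(1) k(1)]]])
      (use hV in \<open>auto intro!: derivative_eq_intros\<close>)
  moreover have "snd k \<circ> (\<lambda>x. mul x h) \<circ> chart_inv c = (\<lambda>x. mloc c d k (vpair x (snd d h)))"
    by (auto simp: mloc_def d)
  ultimately show "((snd k \<circ> (\<lambda>x. mul x h) \<circ> chart_inv c) has_derivative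
      (\<lambda>v. FD (mloc c d k) (vpair (snd c g) (snd d h)) (vpair v 0))) (at (snd c g))"
    by (simp only:)
qed

lemma push_left:
  assumes c: "c \<in> A" "g \<in> fst c" and d: "d \<in> A" "h \<in> fst d" and k: "k \<in> A" "mul g h \<in> fst k"
  shows "push A (mul g) (h, real_vec d v h) = (mul g h, real_vec k (FD (mloc c d k) (vpair (snd c g) (snd d h)) (vpair 0 v)) (mul g h))"
    by (rule push_real_vec[OF k inj[OF d(1)] d(2) left_local[OF assms]])

lemma push_right:
  assumes c: "c \<in> A" "g \<in> fst c" and d: "d \<in> A" "h \<in> fst d" and k: "k \<in> A" "mul g h \<in> fst k"
  shows "push A (\<lambda>x. mul x h) (g, real_vec c v g) = (mul g h, real_vec k (FD (mloc c d k) (vpair (snd c g) (snd d h)) (vpair v 0)) (mul g h))"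
    and "push A (\<lambda>x. mul x h) (g, t10 c v g) = (mul g h, t10 k (FD (mloc c d k) (vpair (snd c g) (snd d h)) (vpair v 0)) (mul g h))"
proof -
  show "push A (\<lambda>x. mul x h) (g, real_vec c v g) = (mul g h, real_vec k (FD (mloc c d k) (vpair (snd c g) (snd d h)) (vpair v 0)) (mul g h))"
    by (rule push_real_vec[OF k inj[OF c(1)] c(2) right_local[OF assms]])
  show "push A (\<lambda>x. mul x h) (g, t10 c v g) = (mul g h, t10 k (FD (mloc c d k) (vpair (snd c g) (snd d h)) (vpair v 0)) (mul g h))"
  proof (rule push_t10[OF k inj[OF c(1)] c(2) right_local[OF assms]])
    have "vpair (\<i> *s v) 0 = \<i> *s (vpair v 0 :: 'n cpair)" by (simp add: vpair_scale)
    then show "FD (mloc c d k) (vpair (snd c g) (snd d h)) (vpair (\<i> *s v) 0) = \<i> *s FD (mloc c d k) (vpair (snd c g) (snd d h)) (vpair v 0)"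
      using holo_onD(3)[OF holo_mloc[OF c(1) d(1) k(1)] mdom_mem[OF c(1) d(1) c(2) d(2) k(2)]] by simp
  qed
qed

lemma chart_at: "p \<in> points A \<Longrightarrow> \<exists>c\<in>A. p \<in> fst c"
  by (auto simp: points_def)

lemma mdiff_left:
  assumes "g \<in> points A" "p \<in> points A" "mdiff A f (mul g p)"
  shows "mdiff A (f \<circ> mul g) p"
proof -
  obtain c d k where "c \<in> A" "g \<in> fst c" "d \<in> A" "p \<in> fst d" "k \<in> A" "mul g p \<in> fst k"
    using chart_at assms mul_closed by meson
  then show ?thesis using mdiff_compose[OF _ _ _ _ left_local assms(3)] by blast
qed

text \<open>Functoriality of \<open>push\<close> together with associativity near \<open>p\<close>.
  The case distinction in the inner \<open>push\<close> is harmless because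
  \<open>f \<circ> mul g\<close> is differentiable whenever \<open>f\<close> is, by
  \<open>mdiff_left\<close>.\<close>

lemma push_left_comp:
  assumes c: "c \<in> A" "p \<in> fst c" and g: "g \<in> points A" and h: "h \<in> points A"
  shows "push A (mul g) (push A (mul h) (p, real_vec c v p)) = push A (mul (mul g h)) (p, real_vec c v p)"
proof -
  have p: "p \<in> points A" using points_mem[OF c] .
  have "push A (mul g) (push A (mul h) (p, real_vec c v p)) = push A (mul g \<circ> mul h) (p, real_vec c v p)"
    using mdiff_left[OF g mul_closed[OF h p]] unfolding push_def fst_conv snd_conv
    by (auto simp: fun_eq_iff o_assoc)
  also have "\<dots> = push A (mul (mul g h)) (p, real_vec c v p)"
    by (rule push_cong[OF c c(1) subset_refl open_img[OF c(1)] c(2)])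
      (use mul_assoc[OF g h] points_mem[OF c(1)] in auto)
  finally show ?thesis .
qed

section \<open>Left invariant fields\<close>

definition ce :: "('a, 'n) chart" where "ce = (SOME c. c \<in> A \<and> e \<in> fst c)"

lemma ce: "ce \<in> A" "e \<in> fst ce"
proof -
  have "\<exists>c. c \<in> A \<and> e \<in> fst c" using chart_at[OF e_points] by blast
  from someI_ex[OF this] show "ce \<in> A" "e \<in> fst ce" unfolding ce_def by blast+
qed

text \<open>The differential at the identity of left translation by the point with coordinates
  \<open>x\<close>, applied to \<open>\<eta>\<close>; this is \<open>Z x\<close> of the
  overview.\<close>

definition lcoeff :: "('a, 'n) chart \<Rightarrow> complex^'n \<Rightarrow> complex^'n \<Rightarrow> complex^'n" where
  "lcoeff c \<eta> x = FD (mloc c ce c) (vpair x (snd ce e)) (vpair 0 \<eta>)"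

lemma mdom_e:
  assumes c: "c \<in> A" and x: "x \<in> snd c ` fst c"
  shows "vpair x (snd ce e) \<in> mdom c ce c"
proof -
  obtain p where p: "p \<in> fst c" "x = snd c p" using x by auto
  then show ?thesis using mdom_mem[OF c ce(1) p(1) ce(2), of c] points_mem[OF c p(1)] by simp
qed

lemma lcoeff_add:
  assumes "c \<in> A" "x \<in> snd c ` fst c"
  shows "lcoeff c (v + w) x = lcoeff c v x + lcoeff c w x"
  using FD_add[OF holo_onD(1)[OF holo_mloc[OF assms(1) ce(1) assms(1)] mdom_e[OF assms]], of "vpair 0 v" "vpair 0 w"]
  by (simp add: vpair_add lcoeff_def)

lemma lcoeff_scale:
  assumes "c \<in> A" "x \<in> snd c ` fst c"
  shows "lcoeff c (a *s v) x = a *s lcoeff c v x"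
  using holo_onD(3)[OF holo_mloc[OF assms(1) ce(1) assms(1)] mdom_e[OF assms], of a "vpair 0 v"]
  by (simp add: vpair_scale lcoeff_def)

lemma lcoeff_0: "c \<in> A \<Longrightarrow> x \<in> snd c ` fst c \<Longrightarrow> lcoeff c 0 x = 0"
  using lcoeff_scale[of c x 0 0] by simp

lemma lcoeff_sum: "c \<in> A \<Longrightarrow> x \<in> snd c ` fst c \<Longrightarrow> lcoeff c (\<Sum>i\<in>I. v i) x = (\<Sum>i\<in>I. lcoeff c (v i) x)"
  by (induction I rule: infinite_finite_induct) (simp_all add: lcoeff_0 lcoeff_add)

lemma holo_lcoeff:
  assumes c: "c \<in> A"
  shows "holo_on (lcoeff c \<eta>) (snd c ` fst c)"
  unfolding lcoeff_def[abs_def]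
proof (rule holo_on_compose[OF _ holo_FD[OF holo_mloc[OF c ce(1) c] open_mdom[OF c ce(1) c]]])
  show "holo_on (\<lambda>x. vpair x (snd ce e)) (snd c ` fst c)"
    by (intro holo_on_vpair holo_on_linear[of "\<lambda>x. x"] holo_on_const) (auto intro: linearI)
qed (rule mdom_e[OF c])

definition left_inv :: "'a tfield \<Rightarrow> bool" where
  "left_inv Z \<longleftrightarrow> (\<forall>g\<in>points A. \<forall>p\<in>points A. push A (mul g) (p, Z p) = (mul g p, Z (mul g p)))"

lemma push_lcoeff:
  assumes c: "c \<in> A" "p \<in> fst c"
  shows "push A (mul p) (e, real_vec ce \<eta> e) = (p, real_vec c (lcoeff c \<eta> (snd c p)) p)"
  using push_left[OF c ce c(1), of \<eta>] c points_mem[OF c] by (simp add: lcoeff_def)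

lemma left_inv_coord:
  assumes Z: "left_inv Z" "Z e = real_vec ce \<eta> e" and c: "c \<in> A" "p \<in> fst c"
  shows "Z p = real_vec c (lcoeff c \<eta> (snd c p)) p"
proof -
  have p: "p \<in> points A" using points_mem[OF c] .
  then have "push A (mul p) (e, Z e) = (mul p e, Z (mul p e))" using Z(1) by (auto simp: left_inv_def)
  then show ?thesis using push_lcoeff[OF c] Z(2) p by simp
qed

lemma lcoeff_e: "lcoeff ce \<eta> (snd ce e) = \<eta>"
  using push_lcoeff[OF ce, of \<eta>] push_ident[OF ce, of "mul e" \<eta>] real_vec_inject[OF ce] by simp

text \<open>Left translation by the inverse of the point brings the field back to its value at the
  identity.\<close>

lemma lcoeff_eq_0:
  assumes c: "c \<in> A" and x: "x \<in> snd c ` fst c" and 0: "lcoeff c \<eta> x = 0"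
  shows "\<eta> = 0"
proof -
  obtain p where p: "p \<in> fst c" "x = snd c p" using x by auto
  have pp: "p \<in> points A" using points_mem[OF c p(1)] .
  obtain q where q: "q \<in> points A" "mul q p = e" using mul_inv[OF pp] by auto
  have "push A (mul (mul q p)) (e, real_vec ce \<eta> e) = push A (mul q) (p, real_vec c (lcoeff c \<eta> x) p)"
    using push_left_comp[OF ce q(1) pp, of \<eta>] push_lcoeff[OF c p(1)] p by simp
  also have "\<dots> = push A (mul q) (push A (mul p) (e, real_vec ce 0 e))"
    using 0 push_lcoeff[OF c p(1), of 0] lcoeff_0[OF c x] p by simp
  also have "\<dots> = push A (mul (mul q p)) (e, real_vec ce 0 e)"
    using push_left_comp[OF ce q(1) pp, of 0] by simp
  finally show ?thesis
    using q(2) push_ident[OF ce, of "mul e"] real_vec_inject[OF ce] by simp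
qed

lemma lcoeff_inj:
  assumes c: "c \<in> A" and x: "x \<in> snd c ` fst c" and eq: "lcoeff c \<eta> x = lcoeff c \<theta> x"
  shows "\<eta> = \<theta>"
proof -
  have "lcoeff c (\<eta> + (-1) *s \<theta>) x = 0"
    unfolding lcoeff_add[OF c x] lcoeff_scale[OF c x] eq by (simp add: vec_eq_iff)
  from lcoeff_eq_0[OF c x this] show ?thesis by (simp add: vec_eq_iff)
qed

lemma lcoeff_linear: "c \<in> A \<Longrightarrow> x \<in> snd c ` fst c \<Longrightarrow> linear (\<lambda>\<eta>. lcoeff c \<eta> x)"
  using lcoeff_scale[of c x "of_real _"] by (auto intro!: linearI simp: lcoeff_add of_real_vmult)

text \<open>An injective endomorphism of a finite-dimensional space is onto. Hence every tangent
  vector is the value of exactly one left invariant field.\<close>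

lemma lcoeff_surj:
  assumes c: "c \<in> A" and x: "x \<in> snd c ` fst c"
  obtains \<eta> where "lcoeff c \<eta> x = v"
proof -
  have "inj (\<lambda>\<eta>. lcoeff c \<eta> x)" by (rule injI) (rule lcoeff_inj[OF c x])
  from linear_injective_imp_surjective[OF lcoeff_linear[OF c x] this refl]
  obtain \<eta> where "v = lcoeff c \<eta> x" unfolding surj_def by blast
  then show thesis using that by simp
qed

text \<open>Realises each \<open>\<eta>\<close> by an actual invariant field; the basis property of
  real fields speaks of fields and is applied to this one.\<close>

definition left_field :: "complex^'n \<Rightarrow> 'a tfield" where
  "left_field \<eta> p = snd (push A (mul p) (e, real_vec ce \<eta> e))"

lemma left_field_coord: "c \<in> A \<Longrightarrow> p \<in> fst c \<Longrightarrow> left_field \<eta> p = real_vec c (lcoeff c \<eta> (snd c p)) p"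
  by (simp add: left_field_def push_lcoeff)

lemma left_inv_left_field: "left_inv (left_field \<eta>)"
  unfolding left_inv_def
proof (intro ballI)
  fix g p assume g: "g \<in> points A" and p: "p \<in> points A"
  have fst: "fst (push A (mul p) (e, real_vec ce \<eta> e)) = p" "fst (push A (mul (mul g p)) (e, real_vec ce \<eta> e)) = mul g p"
    using g p by (simp_all add: push_def)
  then show "push A (mul g) (p, left_field \<eta> p) = (mul g p, left_field \<eta> (mul g p))"
    using push_left_comp[OF ce g p, of \<eta>] unfolding left_field_def by (metis prod.collapse)
qed

lemma holo_lcoeff_joint:
  assumes c: "c \<in> A"
  shows "holo_on (\<lambda>q :: 'n cpair. lcoeff c (vsnd q) (vfst q)) {q. vfst q \<in> snd c ` fst c}"
proof -
  have "holo_on (\<lambda>q :: 'n cpair. \<Sum>j\<in>UNIV. vsnd q $ j *s lcoeff c (axis j 1) (vfst q)) {q. vfst q \<in> snd c ` fst c}"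
    by (intro holo_on_sum holo_on_scale holo_on_vsnd holo_on_compose[OF holo_on_vfst holo_lcoeff[OF c]]) auto
  then show ?thesis
  proof (rule holo_on_cong[OF _ open_vfst_vimage[OF open_img[OF c]]])
    fix q :: "'n cpair" assume q: "q \<in> {q. vfst q \<in> snd c ` fst c}"
    have "(\<Sum>j\<in>UNIV. vsnd q $ j *s lcoeff c (axis j 1) (vfst q)) = lcoeff c (\<Sum>j\<in>UNIV. vsnd q $ j *s axis j 1) (vfst q)"
      using q by (simp add: lcoeff_sum[OF c] lcoeff_scale[OF c])
    then show "(\<Sum>j\<in>UNIV. vsnd q $ j *s lcoeff c (axis j 1) (vfst q)) = lcoeff c (vsnd q) (vfst q)"
      by (simp only: basis_expansion)
  qed
qed

text \<open>The fibre component of the spray at \<open>(x, v)\<close>. The vector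
  \<open>\<eta>\<close> depends on \<open>(x, v)\<close> but is held fixed during the
  differentiation; it is well defined by \<open>lcoeff_inj\<close>.\<close>

definition scoeff :: "('a, 'n) chart \<Rightarrow> complex^'n \<Rightarrow> complex^'n \<Rightarrow> complex^'n" where
  "scoeff c x v = FD (lcoeff c (THE \<eta>. lcoeff c \<eta> x = v)) x v"

lemma lcoeff_the: "c \<in> A \<Longrightarrow> x \<in> snd c ` fst c \<Longrightarrow> lcoeff c \<eta> x = v \<Longrightarrow> (THE \<eta>. lcoeff c \<eta> x = v) = \<eta>"
  by (rule the_equality) (auto intro: lcoeff_inj)

lemma scoeff_eq: "c \<in> A \<Longrightarrow> x \<in> snd c ` fst c \<Longrightarrow> lcoeff c \<eta> x = v \<Longrightarrow> scoeff c x v = FD (lcoeff c \<eta>) x v"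
  by (simp add: scoeff_def lcoeff_the)

end

section \<open>Flows and lifts of left invariant fields\<close>

context lie_charts
begin

text \<open>This makes one integral curve through the identity enough: for an invariant field its
  left translates are the integral curves through the other points.\<close>

lemma velocity_left:
  assumes v: "has_velocity A \<gamma> D t" and g: "g \<in> points A" and p: "\<gamma> t \<in> points A"
  shows "has_velocity A (\<lambda>s. mul g (\<gamma> s)) (snd (push A (mul g) (\<gamma> t, D))) t"
  unfolding has_velocity_def
proof (intro allI impI)
  fix f assume f: "mdiff A f (mul g (\<gamma> t))"
  have "((\<lambda>s. (f \<circ> mul g) (\<gamma> s)) has_vector_derivative D (f \<circ> mul g)) (at t)"
    using v mdiff_left[OF g p f] unfolding has_velocity_def by blast
  then show "((\<lambda>s. f (mul g (\<gamma> s))) has_vector_derivative snd (push A (mul g) (\<gamma> t, D)) f) (at t)"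
    using f by (simp add: push_def)
qed

lemma local_curve:
  obtains \<epsilon> \<gamma> where "\<epsilon> > 0" "\<gamma> 0 = snd ce e"
    "\<forall>t. \<bar>t\<bar> < \<epsilon> \<longrightarrow> \<gamma> t \<in> snd ce ` fst ce \<and> (\<gamma> has_vector_derivative lcoeff ce \<eta> (\<gamma> t)) (at t)"
proof -
  obtain r L where r: "r > 0" "L \<ge> 0" "cball (snd ce e) r \<subseteq> snd ce ` fst ce"
    "L-lipschitz_on (cball (snd ce e) r) (lcoeff ce \<eta>)"
    using holo_locally_lipschitz[OF holo_lcoeff[OF ce(1)] open_img[OF ce(1)]] ce by blast
  obtain \<epsilon> \<gamma> where "\<epsilon> > 0" "\<gamma> 0 = snd ce e"
    "\<And>t. \<bar>t\<bar> < \<epsilon> \<Longrightarrow> \<gamma> t \<in> cball (snd ce e) r \<and> (\<gamma> has_vector_derivative lcoeff ce \<eta> (\<gamma> t)) (at t)"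
    using ode_local_exists[OF r(4,1)] by blast
  then show thesis by (intro that[of \<epsilon> \<gamma>] allI impI) (use r(3) in auto)
qed

text \<open>Near \<open>t0\<close> both curves stay in one chart and in one ball on which the
  coefficients are Lipschitz, so uniqueness for the equation in coordinates applies.\<close>

lemma curve_unique_local:
  assumes Z: "left_inv Z" "Z e = real_vec ce \<eta> e"
    and a: "\<And>t. \<bar>t\<bar> < \<epsilon> \<Longrightarrow> \<alpha> t \<in> points A \<and> has_velocity A \<alpha> (Z (\<alpha> t)) t"
    and b: "\<And>t. \<bar>t\<bar> < \<epsilon> \<Longrightarrow> \<beta> t \<in> points A \<and> has_velocity A \<beta> (Z (\<beta> t)) t"
    and t0: "\<bar>t0\<bar> < \<epsilon>" "\<alpha> t0 = \<beta> t0"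
  shows "eventually (\<lambda>t. \<alpha> t = \<beta> t) (nhds t0)"
proof -
  obtain c where c: "c \<in> A" "\<alpha> t0 \<in> fst c" using chart_at[of "\<alpha> t0"] a[OF t0(1)] by blast
  let ?x = "snd c (\<alpha> t0)"
  obtain r L where r: "r > 0" "cball ?x r \<subseteq> snd c ` fst c" "L-lipschitz_on (cball ?x r) (lcoeff c \<eta>)"
    using holo_locally_lipschitz[OF holo_lcoeff[OF c(1)] open_img[OF c(1)]] c by blast
  have near: "eventually (\<lambda>t. \<gamma> t \<in> fst c \<and> snd c (\<gamma> t) \<in> cball ?x r \<and>
      ((\<lambda>s. snd c (\<gamma> s)) has_vector_derivative lcoeff c \<eta> (snd c (\<gamma> t))) (at t)) (nhds t0)"
    if g: "\<And>t. \<bar>t\<bar> < \<epsilon> \<Longrightarrow> \<gamma> t \<in> points A \<and> has_velocity A \<gamma> (Z (\<gamma> t)) t"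
      and gt: "\<gamma> t0 = \<alpha> t0" for \<gamma>
  proof -
    have vel: "has_velocity A \<gamma> (real_vec c (lcoeff c \<eta> (snd c (\<gamma> t))) (\<gamma> t)) t"
      if "\<gamma> t \<in> fst c" "\<bar>t\<bar> < \<epsilon>" for t
      using g[OF that(2)] left_inv_coord[OF Z c(1) that(1)] by simp
    have c0: "\<gamma> t0 \<in> fst c" using c gt by simp
    note v0 = velocity_coord[OF c(1) c0 vel[OF c0 t0(1)]]
    have "eventually (\<lambda>s. snd c (\<gamma> s) \<in> ball ?x r) (nhds t0)"
      by (rule eventually_in_open[OF has_vector_derivative_continuous[OF v0(2)]]) (use r gt in auto)
    with eventually_abs_less[OF t0(1)] show ?thesis using v0(1)
    proof eventually_elim
      case (elim t)
      then show ?case using velocity_coord(2)[OF c(1) elim(3) vel[OF elim(3) elim(1)]] by auto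
    qed
  qed
  obtain \<delta> where d: "\<delta> > 0" "\<And>t. \<bar>t - t0\<bar> < \<delta> \<Longrightarrow> \<alpha> t \<in> fst c \<and> snd c (\<alpha> t) \<in> cball ?x r \<and>
      ((\<lambda>s. snd c (\<alpha> s)) has_vector_derivative lcoeff c \<eta> (snd c (\<alpha> t))) (at t)"
    "\<And>t. \<bar>t - t0\<bar> < \<delta> \<Longrightarrow> \<beta> t \<in> fst c \<and> snd c (\<beta> t) \<in> cball ?x r \<and>
      ((\<lambda>s. snd c (\<beta> s)) has_vector_derivative lcoeff c \<eta> (snd c (\<beta> t))) (at t)"
    using eventually_conj[OF near[OF a refl] near[OF b t0(2)[symmetric]]]
    unfolding eventually_nhds_metric dist_real_def by blast
  obtain h where h: "h > 0" "\<And>t. \<bar>t - t0\<bar> < h \<Longrightarrow> snd c (\<alpha> t) = snd c (\<beta> t)"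
    using ode_local_unique[OF r(3) d(1), of "\<lambda>s. snd c (\<alpha> s)" t0 "\<lambda>s. snd c (\<beta> s)"] d t0(2) by auto
  have "\<alpha> t = \<beta> t" if "\<bar>t - t0\<bar> < min h \<delta>" for t
    using h(2)[of t] d(2,3)[of t] that inj[OF c(1)] by (auto simp: inj_on_def)
  then show ?thesis unfolding eventually_nhds_metric dist_real_def using h(1) d(1)
    by (intro exI[of _ "min h \<delta>"]) auto
qed

text \<open>Connectedness of the common interval: the set of agreement is open by local uniqueness,
  the set of disagreement is open because the manifold is Hausdorff, and 0 lies in the
  former.\<close>

lemma curve_unique:
  assumes Z: "left_inv Z" "Z e = real_vec ce \<eta> e"
    and a: "\<And>t. \<bar>t\<bar> < \<epsilon> \<Longrightarrow> \<alpha> t \<in> points A \<and> has_velocity A \<alpha> (Z (\<alpha> t)) t"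
    and b: "\<And>t. \<bar>t\<bar> < \<epsilon> \<Longrightarrow> \<beta> t \<in> points A \<and> has_velocity A \<beta> (Z (\<beta> t)) t"
    and 0: "\<alpha> 0 = \<beta> 0" and t: "\<bar>t\<bar> < \<epsilon>"
  shows "\<alpha> t = \<beta> t"
proof -
  let ?I = "{-\<epsilon><..<\<epsilon>}"
  have I: "s \<in> ?I \<longleftrightarrow> \<bar>s\<bar> < \<epsilon>" for s by auto
  define E where "E = {s \<in> ?I. \<alpha> s = \<beta> s}"
  define N where "N = {s \<in> ?I. \<alpha> s \<noteq> \<beta> s}"
  have sub: "eventually (\<lambda>u. u \<in> ?I) (nhds s)" if "s \<in> ?I" for s
    using that by (intro eventually_nhds_in_open) auto
  have "open E"
  proof (subst open_subopen, rule ballI)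
    fix s assume "s \<in> E"
    then have s: "s \<in> ?I" "\<alpha> s = \<beta> s" by (auto simp: E_def)
    have s': "\<bar>s\<bar> < \<epsilon>" using s(1) I by blast
    have "eventually (\<lambda>t. \<alpha> t = \<beta> t) (nhds s)"
      by (rule curve_unique_local[of Z \<eta> \<epsilon> \<alpha> \<beta> s]) (use Z a b s' s(2) in blast)+
    with sub[OF s(1)]
    have "eventually (\<lambda>u. u \<in> E) (nhds s)" by eventually_elim (use E_def in blast)
    then show "\<exists>T. open T \<and> s \<in> T \<and> T \<subseteq> E" unfolding eventually_nhds by blast
  qed
  moreover have "open N"
  proof (subst open_subopen, rule ballI)
    fix s assume "s \<in> N"
    then have s: "s \<in> ?I" "\<alpha> s \<noteq> \<beta> s" by (auto simp: N_def)
    have s': "\<bar>s\<bar> < \<epsilon>" using s(1) I by blast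
    obtain S T where ST: "openin X S" "openin X T" "\<alpha> s \<in> S" "\<beta> s \<in> T" "disjnt S T"
      using haus s(2) a[OF s'] b[OF s'] unfolding Hausdorff_space_def top by blast
    obtain c where c: "c \<in> A" "\<alpha> s \<in> fst c"
      using chart_at[of "\<alpha> s"] a[OF s'] by blast
    obtain d where d: "d \<in> A" "\<beta> s \<in> fst d"
      using chart_at[of "\<beta> s"] b[OF s'] by blast
    have "eventually (\<lambda>u. \<alpha> u \<in> S) (nhds s)"
      by (rule velocity_open[OF c conjunct2[OF a[OF s']] openX[OF c(1) ST(1)] ST(3)])
    moreover have "eventually (\<lambda>u. \<beta> u \<in> T) (nhds s)"
      by (rule velocity_open[OF d conjunct2[OF b[OF s']] openX[OF d(1) ST(2)] ST(4)])
    ultimately have "eventually (\<lambda>u. u \<in> N) (nhds s)" using sub[OF s(1)]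
      by eventually_elim (use ST(5) in \<open>auto simp: N_def disjnt_iff\<close>)
    then show "\<exists>T. open T \<and> s \<in> T \<and> T \<subseteq> N" unfolding eventually_nhds by blast
  qed
  moreover have "E \<inter> N \<inter> ?I = {}" "?I \<subseteq> E \<union> N" by (auto simp: E_def N_def)
  moreover have "connected ?I" by (simp add: connected_Ioo)
  ultimately have "E \<inter> ?I = {} \<or> N \<inter> ?I = {}" using connectedD by blast
  moreover have "0 \<in> E \<inter> ?I" using 0 t by (auto simp: E_def)
  moreover have "t \<in> ?I" using t by auto
  ultimately show ?thesis by (auto simp: N_def)
qed

text \<open>The curve is the push of \<open>v\<close> along right translation by
  \<open>\<gamma> t\<close>, in induced coordinates. Its fibre part differentiates the product first
  in the left and then in the right factor; symmetry of second derivatives turns this into the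
  derivative of \<open>lcoeff c \<eta>\<close> along \<open>v\<close>. Only the value and the
  velocity of \<open>\<gamma>\<close> at 0 enter, so that curves other than integral curves may be
  inserted.\<close>

lemma kappa_derivative:
  assumes c: "c \<in> A" and x: "x \<in> snd c ` fst c"
    and g: "\<gamma> 0 = snd ce e" "(\<gamma> has_vector_derivative \<eta>) (at 0)"
  shows "((\<lambda>t. vpair (mloc c ce c (vpair x (\<gamma> t))) (FD (mloc c ce c) (vpair x (\<gamma> t)) (vpair v 0)) :: 'n cpair)
     has_vector_derivative vpair (lcoeff c \<eta> x) (FD (lcoeff c \<eta>) x v)) (at 0)"
proof -
  let ?mloc = "mloc c ce c" and ?q = "vpair x (snd ce e) :: 'n cpair"
  note h = holo_mloc[OF c ce(1) c] and o = open_mdom[OF c ce(1) c] and m = mdom_e[OF c x]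
  have g': "(\<gamma> has_derivative (\<lambda>s. s *\<^sub>R \<eta>)) (at 0)" using g(2) by (simp add: has_vector_derivative_def)
  have vg: "((\<lambda>t. vpair x (\<gamma> t) :: 'n cpair) has_derivative (\<lambda>s. s *\<^sub>R vpair 0 \<eta>)) (at 0)"
    by (rule has_derivative_eq_rhs, rule has_derivative_vpair[OF has_derivative_const g']) (simp add: vpair_scaleR)
  have chain: "((\<lambda>t. f (vpair x (\<gamma> t))) has_vector_derivative FD f ?q (vpair 0 \<eta>)) (at 0)"
    if f: "holo_on f (mdom c ce c)" for f :: "'n cpair \<Rightarrow> complex^'n"
  proof -
    have "((\<lambda>t. f (vpair x (\<gamma> t))) has_derivative (\<lambda>s. FD f ?q (s *\<^sub>R vpair 0 \<eta>))) (at 0)"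
      by (rule has_derivative_compose[OF vg]) (use holo_onD(2)[OF f m] g(1) in simp)
    then show ?thesis
      using FD_scaleR[OF holo_onD(1)[OF f m]] by (simp add: has_vector_derivative_def)
  qed
  have "FD (\<lambda>q. FD ?mloc q (vpair v 0)) ?q (vpair 0 \<eta>) = FD (\<lambda>q. FD ?mloc q (vpair 0 \<eta>)) ?q (vpair v 0)"
    by (rule holo_symmetric_FD[OF h o m])
  also have "\<dots> = FD (lcoeff c \<eta>) x v"
  proof -
    have "((\<lambda>y. vpair y (snd ce e) :: 'n cpair) has_derivative (\<lambda>v. vpair v 0)) (at x)"
      by (auto intro!: derivative_eq_intros)
    from has_derivative_compose[OF this holo_onD(2)[OF holo_FD[OF h o] m]]
    have "(lcoeff c \<eta> has_derivative (\<lambda>v. FD (\<lambda>q. FD ?mloc q (vpair 0 \<eta>)) ?q (vpair v 0))) (at x)"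
      by (simp add: lcoeff_def[abs_def])
    from FD_eq[OF this] show ?thesis by simp
  qed
  finally have "FD (\<lambda>q. FD ?mloc q (vpair v 0)) ?q (vpair 0 \<eta>) = FD (lcoeff c \<eta>) x v" .
  then show ?thesis
    using has_vector_derivative_vpair[OF chain[OF h] chain[OF holo_FD[OF h o, of "vpair v 0"]]]
    by (simp add: lcoeff_def)
qed

lemma flow_exists:
  assumes Z: "left_inv Z" "Z e = real_vec ce \<eta> e" and c: "c \<in> A" "p \<in> fst c"
  obtains \<rho> where "local_flow A Z p \<rho>"
    "has_velocity (TR_atlas A) (\<lambda>t. push A (\<rho> t) (p, real_vec c v p))
      (real_vec (TR_chart A c) (vpair (lcoeff c \<eta> (snd c p)) (FD (lcoeff c \<eta>) (snd c p) v)) (p, real_vec c v p)) 0"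
    "push A (\<rho> 0) (p, real_vec c v p) = (p, real_vec c v p)"
proof -
  obtain \<epsilon> \<gamma> where eg': "\<epsilon> > 0" "\<gamma> 0 = snd ce e"
    "\<forall>t. \<bar>t\<bar> < \<epsilon> \<longrightarrow> \<gamma> t \<in> snd ce ` fst ce \<and> (\<gamma> has_vector_derivative lcoeff ce \<eta> (\<gamma> t)) (at t)"
    by (rule local_curve)
  note eg = eg'(1,2) eg'(3)[rule_format]
  \<comment> \<open>One time interval serves all \<open>q\<close>, since the curve through
    \<open>q\<close> is the left translate of the curve through the identity.\<close>
  define \<rho> where "\<rho> t q = mul q (chart_inv ce (\<gamma> t))" for t q
  have gp: "chart_inv ce (\<gamma> t) \<in> fst ce" "snd ce (chart_inv ce (\<gamma> t)) = \<gamma> t" if "\<bar>t\<bar> < \<epsilon>" for t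
    by (rule chart_inv_into[OF conjunct1[OF eg(3)[OF that]]], rule chart_inv_right[OF conjunct1[OF eg(3)[OF that]]])
  have g0: "chart_inv ce (\<gamma> 0) = e" using eg(2) ce by simp
  have gvel: "has_velocity A (\<lambda>s. chart_inv ce (\<gamma> s)) (Z (chart_inv ce (\<gamma> t))) t" if t: "\<bar>t\<bar> < \<epsilon>" for t
  proof -
    note evI = eventually_abs_less[OF t]
    have "((\<lambda>s. snd ce (chart_inv ce (\<gamma> s))) has_derivative (\<lambda>s. s *\<^sub>R lcoeff ce \<eta> (\<gamma> t))) (at t)"
      by (rule has_derivative_cong_ev[of \<gamma>])
        (use evI gp(2) eg(3)[OF t] in \<open>auto elim!: eventually_mono simp: has_vector_derivative_def\<close>)
    then have d: "((\<lambda>s. snd ce (chart_inv ce (\<gamma> s))) has_vector_derivative lcoeff ce \<eta> (\<gamma> t)) (at t)"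
      by (simp add: has_vector_derivative_def)
    have evc: "eventually (\<lambda>s. chart_inv ce (\<gamma> s) \<in> fst ce) (nhds t)"
      using evI by eventually_elim (rule gp(1))
    have "has_velocity A (\<lambda>s. chart_inv ce (\<gamma> s)) (real_vec ce (lcoeff ce \<eta> (\<gamma> t)) (chart_inv ce (\<gamma> t))) t"
      by (rule velocityI[OF ce(1) gp(1)[OF t] evc d])
    then show ?thesis using left_inv_coord[OF Z ce(1) gp(1)[OF t]] gp(2)[OF t] by simp
  qed
  have gpt: "chart_inv ce (\<gamma> t) \<in> points A" if "\<bar>t\<bar> < \<epsilon>" for t
    by (rule points_mem[OF ce(1) gp(1)[OF that]])
  have flow: "local_flow A Z p \<rho>"
    unfolding local_flow_def
  proof (intro exI conjI bexI ballI allI impI)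
    show "\<epsilon> > 0" "c \<in> A" "fst c \<subseteq> fst c" "p \<in> fst c" "open (snd c ` fst c)"
      using eg c open_img by auto
    fix q assume q: "q \<in> fst c"
    then have qp: "q \<in> points A" by (rule points_mem[OF c(1)])
    then show "\<rho> 0 q = q" by (simp add: \<rho>_def g0)
    fix t assume t: "\<bar>t\<bar> < \<epsilon>"
    show "\<rho> t q \<in> points A" using qp gpt[OF t] by (simp add: \<rho>_def)
    show "has_velocity A (\<lambda>s. \<rho> s q) (Z (\<rho> t q)) t"
      using velocity_left[OF gvel[OF t] qp gpt[OF t]] Z(1) qp gpt[OF t]
      by (simp add: \<rho>_def left_inv_def)
  qed
  let ?y = "(p, real_vec c v p)" and ?x = "snd c p"
  have xS: "?x \<in> snd c ` fst c" using c by simp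
  have p0: "push A (\<rho> 0) ?y = ?y"
    by (rule push_ident[OF c]) (simp add: \<rho>_def g0)
  interpret TR: holo_atlas "TR_atlas A" by (rule holo_atlas_TR)
  have "eventually (\<lambda>t. vpair ?x (\<gamma> t) \<in> mdom c ce c) (nhds 0)"
  proof (rule eventually_in_open[OF _ open_mdom[OF c(1) ce(1) c(1)]])
    show "isCont (\<lambda>t. vpair ?x (\<gamma> t) :: 'n cpair) 0"
      using eg(1) eg(3)[of 0] by (intro has_vector_derivative_continuous[OF has_vector_derivative_vpair[OF has_vector_derivative_const]]) auto
    show "vpair ?x (\<gamma> 0) \<in> mdom c ce c" using mdom_e[OF c(1) xS] eg(2) by simp
  qed
  moreover have "eventually (\<lambda>t. \<bar>t\<bar> < \<epsilon>) (nhds (0::real))"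
    using eventually_abs_less[of 0] eg(1) by simp
  ultimately have ev: "eventually (\<lambda>t. push A (\<rho> t) ?y \<in> fst (TR_chart A c) \<and> snd (TR_chart A c) (push A (\<rho> t) ?y)
      = vpair (mloc c ce c (vpair ?x (\<gamma> t))) (FD (mloc c ce c) (vpair ?x (\<gamma> t)) (vpair v 0))) (nhds 0)"
  proof eventually_elim
    case (elim t)
    have m: "mul p (chart_inv ce (\<gamma> t)) \<in> fst c" using elim(1) c by (simp add: mdom_def)
    have "push A (\<rho> t) ?y = (mul p (chart_inv ce (\<gamma> t)),
        real_vec c (FD (mloc c ce c) (vpair ?x (\<gamma> t)) (vpair v 0)) (mul p (chart_inv ce (\<gamma> t))))"
      using push_right(1)[OF c ce(1) gp(1)[OF elim(2)] c(1) m] gp(2)[OF elim(2)] by (simp add: \<rho>_def[abs_def])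
    then show ?case
      using real_vec_mem[OF c(1) m] coord_real_vec[OF c(1) m] m c by (simp add: TR_chart_def mloc_def)
  qed
  have "((\<lambda>t. snd (TR_chart A c) (push A (\<rho> t) ?y)) has_derivative (\<lambda>s. s *\<^sub>R vpair (lcoeff c \<eta> ?x) (FD (lcoeff c \<eta>) ?x v))) (at 0)"
  proof (rule has_derivative_cong_ev)
    show "eventually (\<lambda>t. vpair (mloc c ce c (vpair ?x (\<gamma> t))) (FD (mloc c ce c) (vpair ?x (\<gamma> t)) (vpair v 0))
       = snd (TR_chart A c) (push A (\<rho> t) ?y)) (nhds 0)"
      using ev by eventually_elim simp
    show "((\<lambda>t. vpair (mloc c ce c (vpair ?x (\<gamma> t))) (FD (mloc c ce c) (vpair ?x (\<gamma> t)) (vpair v 0)))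
      has_derivative (\<lambda>s. s *\<^sub>R vpair (lcoeff c \<eta> ?x) (FD (lcoeff c \<eta>) ?x v))) (at 0)"
      using kappa_derivative[of c ?x \<gamma> \<eta> v, OF c(1) xS eg(2)] eg(1) eg(3)[of 0] eg(2) lcoeff_e
      by (simp add: has_vector_derivative_def)
  qed
  then have d: "((\<lambda>t. snd (TR_chart A c) (push A (\<rho> t) ?y)) has_vector_derivative vpair (lcoeff c \<eta> ?x) (FD (lcoeff c \<eta>) ?x v)) (at 0)"
    by (simp add: has_vector_derivative_def)
  have "has_velocity (TR_atlas A) (\<lambda>t. push A (\<rho> t) ?y)
      (real_vec (TR_chart A c) (vpair (lcoeff c \<eta> ?x) (FD (lcoeff c \<eta>) ?x v)) (push A (\<rho> 0) ?y)) 0"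
  proof (rule TR.velocityI[OF TR_chart_mem[OF c(1)] _ _ d])
    show "push A (\<rho> 0) ?y \<in> fst (TR_chart A c)" using p0 real_vec_in_chart[OF c] by simp
    show "eventually (\<lambda>s. push A (\<rho> s) ?y \<in> fst (TR_chart A c)) (nhds 0)"
      using ev by eventually_elim simp
  qed
  then show thesis using that[OF flow] p0 by simp
qed

text \<open>Two local flows agree for small times on a common neighbourhood of \<open>p\<close>, by
  uniqueness of integral curves; therefore their differentials at \<open>p\<close> agree. This makes
  the description in \<open>lift\<close> independent of the flow.\<close>

lemma flow_push_unique:
  assumes Z: "left_inv Z" "Z e = real_vec ce \<eta> e" and c: "c \<in> A" "p \<in> fst c"
    and f1: "local_flow A Z p \<rho>" and f2: "local_flow A Z p \<sigma>"
  shows "eventually (\<lambda>t. push A (\<rho> t) (p, real_vec c v p) = push A (\<sigma> t) (p, real_vec c v p)) (nhds 0)"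
proof -
  obtain \<epsilon>1 c1 W1 where 1: "\<epsilon>1 > 0" "c1 \<in> A" "W1 \<subseteq> fst c1" "open (snd c1 ` W1)" "p \<in> W1"
    "\<forall>q\<in>W1. \<rho> 0 q = q \<and> (\<forall>t. \<bar>t\<bar> < \<epsilon>1 \<longrightarrow> \<rho> t q \<in> points A \<and> has_velocity A (\<lambda>s. \<rho> s q) (Z (\<rho> t q)) t)"
    using f1 unfolding local_flow_def by blast
  obtain \<epsilon>2 c2 W2 where 2: "\<epsilon>2 > 0" "c2 \<in> A" "W2 \<subseteq> fst c2" "open (snd c2 ` W2)" "p \<in> W2"
    "\<forall>q\<in>W2. \<sigma> 0 q = q \<and> (\<forall>t. \<bar>t\<bar> < \<epsilon>2 \<longrightarrow> \<sigma> t q \<in> points A \<and> has_velocity A (\<lambda>s. \<sigma> s q) (Z (\<sigma> t q)) t)"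
    using f2 unfolding local_flow_def by blast
  \<comment> \<open>The two neighbourhoods are given in possibly different charts; the second one is
    pulled back to the first chart along the transition map.\<close>
  have W: "open (snd c1 ` (W1 \<inter> W2))"
  proof -
    let ?\<psi> = "snd c2 \<circ> chart_inv c1"
    have "open (snd c1 ` (fst c1 \<inter> fst c2) \<inter> ?\<psi> -` (snd c2 ` W2))"
      using continuous_open_preimage[OF holo_on_continuous[OF holo_trans] open_overlap] 1 2 by blast
    then have "open (snd c1 ` W1 \<inter> (snd c1 ` (fst c1 \<inter> fst c2) \<inter> ?\<psi> -` (snd c2 ` W2)))"
      using 1(4) by blast
    moreover have "snd c1 ` W1 \<inter> (snd c1 ` (fst c1 \<inter> fst c2) \<inter> ?\<psi> -` (snd c2 ` W2)) = snd c1 ` (W1 \<inter> W2)"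
      (is "?L = ?R")
    proof (intro equalityI subsetI)
      fix x assume "x \<in> ?L"
      then obtain q r where q: "x = snd c1 q" "q \<in> W1" and r: "snd c2 (chart_inv c1 x) = snd c2 r" "r \<in> W2"
        and xx: "x \<in> snd c1 ` (fst c1 \<inter> fst c2)" by auto
      have ciq: "chart_inv c1 x = q" using q 1 by auto
      moreover have "chart_inv c1 x \<in> fst c2" using xx mem_img_Int[OF 1(2)] by blast
      ultimately have "q = r" using r inj[OF 2(2)] 2(3) by (auto simp: inj_on_def)
      then show "x \<in> ?R" using q r by auto
    next
      fix x assume "x \<in> ?R"
      then obtain q where q: "x = snd c1 q" "q \<in> W1" "q \<in> W2" by auto
      then have "chart_inv c1 x = q" "q \<in> fst c1" "q \<in> fst c2" using 1 2 by auto
      then show "x \<in> ?L" using q by auto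
    qed
    ultimately show ?thesis by simp
  qed
  have eq: "\<rho> t q = \<sigma> t q" if t: "\<bar>t\<bar> < min \<epsilon>1 \<epsilon>2" and q: "q \<in> W1 \<inter> W2" for t q
    by (rule curve_unique[OF Z, of "min \<epsilon>1 \<epsilon>2" "\<lambda>t. \<rho> t q" "\<lambda>t. \<sigma> t q"]) (use 1(6) 2(6) t q in auto)
  have "push A (\<rho> t) (p, real_vec c v p) = push A (\<sigma> t) (p, real_vec c v p)" if "\<bar>t\<bar> < min \<epsilon>1 \<epsilon>2" for t
    by (rule push_cong[OF c 1(2) _ W]) (use 1(3,5) 2(5) eq[OF that] in auto)
  then show ?thesis unfolding eventually_nhds_metric dist_real_def using 1(1) 2(1)
    by (intro exI[of _ "min \<epsilon>1 \<epsilon>2"]) auto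
qed

text \<open>Existence of one flow gives a value for the description in \<open>lift\<close>, and
  agreement of flows makes it the only one. Where \<open>f\<close> is not differentiable, both sides
  are 0.\<close>

lemma lift_left_inv:
  assumes Z: "left_inv Z" "Z e = real_vec ce \<eta> e" and c: "c \<in> A" "p \<in> fst c"
  shows "lift A Z (p, real_vec c v p)
    = real_vec (TR_chart A c) (vpair (lcoeff c \<eta> (snd c p)) (FD (lcoeff c \<eta>) (snd c p) v)) (p, real_vec c v p)"
    (is "_ = ?R")
proof
  fix f
  let ?y = "(p, real_vec c v p)"
  interpret TR: holo_atlas "TR_atlas A" by (rule holo_atlas_TR)
  obtain \<rho> where r: "local_flow A Z p \<rho>" "has_velocity (TR_atlas A) (\<lambda>t. push A (\<rho> t) ?y) ?R 0"
     "push A (\<rho> 0) ?y = ?y"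
    using flow_exists[OF Z c] by blast
  show "lift A Z ?y f = ?R f"
  proof (cases "mdiff (TR_atlas A) f ?y")
    case True
    have d: "((\<lambda>t. f (push A (\<rho> t) ?y)) has_vector_derivative ?R f) (at 0)"
      using r(2,3) True unfolding has_velocity_def by simp
    have "d = ?R f" if "local_flow A Z p \<sigma>" "((\<lambda>t. f (push A (\<sigma> t) ?y)) has_vector_derivative d) (at 0)" for \<sigma> d
    proof -
      have "eventually (\<lambda>t. f (push A (\<sigma> t) ?y) = f (push A (\<rho> t) ?y)) (nhds 0)"
        using flow_push_unique[OF Z c that(1) r(1), of v] by eventually_elim simp
      from has_derivative_cong_ev[OF this that(2)[unfolded has_vector_derivative_def]]
      have "((\<lambda>t. f (push A (\<rho> t) ?y)) has_vector_derivative d) (at 0)"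
        by (simp add: has_vector_derivative_def)
      then show ?thesis using d vector_derivative_unique_at by blast
    qed
    then have "(THE d. \<exists>\<rho>. local_flow A Z p \<rho> \<and> ((\<lambda>t. f (push A (\<rho> t) ?y)) has_vector_derivative d) (at 0)) = ?R f"
      using r(1) d by (intro the_equality) blast+
    then show ?thesis using True by (simp add: lift_def)
  next
    case False
    then have "\<not> cdiff (TR_chart A c) f ?y"
      using TR.mdiff_iff[OF TR_chart_mem[OF c(1)] real_vec_in_chart[OF c]] by blast
    then show ?thesis using False by (simp add: lift_def real_vec_def[of "TR_chart A c"])
  qed
qed

end

section \<open>The spray of a frame\<close>

context lie_charts
begin

lemma coord_left_inv10:
  assumes Z: "T10_field A Z" "left_inv (\<lambda>p. circ (Z p))" "Z e = t10 ce \<eta> e" and c: "c \<in> A" "p \<in> fst c"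
  shows "Z p = t10 c (lcoeff c \<eta> (snd c p)) p"
proof -
  have "Z p \<in> T10_space A p" using Z(1) points_mem[OF c] by (simp add: T10_field_def)
  then obtain w where w: "Z p = t10 c w p" unfolding T10_space_eq[OF c] by blast
  have "circ (Z e) = real_vec ce \<eta> e" by (simp add: Z(3) circ_t10)
  from left_inv_coord[OF Z(2) this c] have "real_vec c w p = real_vec c (lcoeff c \<eta> (snd c p)) p"
    by (simp add: w circ_t10)
  then show ?thesis using real_vec_inject[OF c] w by simp
qed

text \<open>Since \<open>circ_TM\<close> keeps components, exactly one vector of type (1,0)
  corresponds to the real lift, and it has the same components.\<close>

lemma lift10_left_inv:
  assumes Z: "T10_field A Z" "left_inv (\<lambda>p. circ (Z p))" "Z e = t10 ce \<eta> e" and c: "c \<in> A" "p \<in> fst c"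
  shows "lift10 A Z (p, t10 c v p)
    = t10 (T10_chart A c) (vpair (lcoeff c \<eta> (snd c p)) (FD (lcoeff c \<eta>) (snd c p) v)) (p, t10 c v p)"
proof -
  interpret TR: holo_atlas "TR_atlas A" by (rule holo_atlas_TR)
  interpret T10: holo_atlas "T10_atlas A" by (rule holo_atlas_T10)
  let ?\<zeta> = "vpair (lcoeff c \<eta> (snd c p)) (FD (lcoeff c \<eta>) (snd c p) v)"
  have "circ (Z e) = real_vec ce \<eta> e" by (simp add: Z(3) circ_t10)
  from lift_left_inv[OF Z(2) this c]
  have lift: "lift A (\<lambda>p. circ (Z p)) (circ_map (p, t10 c v p)) = real_vec (TR_chart A c) ?\<zeta> (p, real_vec c v p)"
    by (simp add: circ_map_t10)
  have sp: "T10_space (T10_atlas A) (p, t10 c v p) = range (\<lambda>a. t10 (T10_chart A c) a (p, t10 c v p))"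
    by (rule T10.T10_space_eq[OF T10_chart_mem[OF c(1)] t10_in_chart[OF c]])
  show ?thesis
    unfolding lift10_def lift sp
  proof (rule the_equality)
    show "t10 (T10_chart A c) ?\<zeta> (p, t10 c v p) \<in> range (\<lambda>a. t10 (T10_chart A c) a (p, t10 c v p)) \<and>
      circ_TM A (p, t10 c v p) (t10 (T10_chart A c) ?\<zeta> (p, t10 c v p)) = real_vec (TR_chart A c) ?\<zeta> (p, real_vec c v p)"
      using circ_TM_t10[OF c] by blast
    fix W assume W: "W \<in> range (\<lambda>a. t10 (T10_chart A c) a (p, t10 c v p)) \<and>
      circ_TM A (p, t10 c v p) W = real_vec (TR_chart A c) ?\<zeta> (p, real_vec c v p)"
    then obtain a where a: "W = t10 (T10_chart A c) a (p, t10 c v p)" by blast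
    have "real_vec (TR_chart A c) a (p, real_vec c v p) = real_vec (TR_chart A c) ?\<zeta> (p, real_vec c v p)"
      using W circ_TM_t10[OF c, of v a] unfolding a by simp
    then have "a = ?\<zeta>"
      using TR.real_vec_inject[OF TR_chart_mem[OF c(1)] real_vec_in_chart[OF c]] by simp
    then show "W = t10 (T10_chart A c) ?\<zeta> (p, t10 c v p)" using a by simp
  qed
qed

lemma FD_lcoeff_sum:
  assumes c: "c \<in> A" and x: "x \<in> snd c ` fst c"
  shows "FD (lcoeff c (\<Sum>i\<in>I. a i *s \<eta> i)) x v = (\<Sum>i\<in>I. a i *s FD (lcoeff c (\<eta> i)) x v)"
proof -
  have "((\<lambda>y. \<Sum>i\<in>I. a i *s lcoeff c (\<eta> i) y) has_derivative (\<lambda>v. \<Sum>i\<in>I. a i *s FD (lcoeff c (\<eta> i)) x v)) (at x)"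
    by (intro has_derivative_sum bounded_linear.has_derivative[OF bounded_linear_vmult_right]
        holo_onD(2)[OF holo_lcoeff[OF c] x])
  then have "(lcoeff c (\<Sum>i\<in>I. a i *s \<eta> i) has_derivative (\<lambda>v. \<Sum>i\<in>I. a i *s FD (lcoeff c (\<eta> i)) x v)) (at x)"
    by (rule has_derivative_transform_within_open[OF _ open_img[OF c] x]) (simp add: lcoeff_sum[OF c] lcoeff_scale[OF c])
  then show ?thesis by (simp add: FD_eq)
qed

text \<open>At the vector with components \<open>v\<close>, the numbers \<open>u\<^sup>i\<close> are
  the coordinates in the basis \<open>E\<close> of the vector \<open>\<theta>\<close> whose field
  takes the value \<open>v\<close> at \<open>p\<close>. The combination of lifts with these
  constants is the lift of the field of \<open>\<theta>\<close>, and the basis disappears.\<close>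

lemma frame_spray_eq:
  assumes U: "\<And>i :: 'n. T10_field A (U i)" "\<And>i. left_inv (\<lambda>p. circ (U i p))" "\<And>i. U i e = E i"
    and E: "complex_basis A e E" and c: "c \<in> A" "p \<in> fst c"
  shows "frame_spray A U (p, t10 c v p) = t10 (T10_chart A c) (vpair v (scoeff c (snd c p) v)) (p, t10 c v p)"
proof -
  let ?x = "snd c p" and ?w = "(p, t10 c v p)"
  have x: "?x \<in> snd c ` fst c" using c by simp
  have "\<exists>\<eta>. E i = t10 ce \<eta> e" for i
    using E unfolding complex_basis_def T10_space_eq[OF ce] by blast
  then obtain \<eta> where \<eta>: "\<And>i. E i = t10 ce (\<eta> i) e" by metis
  have lin: "(\<lambda>f. \<Sum>i\<in>UNIV. a $ i * t10 d (\<zeta> i) q f) = t10 d (\<Sum>i\<in>UNIV. a $ i *s \<zeta> i) q"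
    for a :: "complex^'n" and d :: "('b, 'm::finite) chart" and \<zeta> q
    by (simp add: t10_sum t10_scale fun_eq_iff)
  obtain \<theta> where \<theta>: "lcoeff c \<theta> ?x = v" using lcoeff_surj[OF c(1) x] by blast
  have "t10 ce \<theta> e \<in> T10_space A e" unfolding T10_space_eq[OF ce] by blast
  then have "\<exists>!a::complex^'n. t10 ce \<theta> e = (\<lambda>f. \<Sum>i\<in>UNIV. a $ i * E i f)"
    using E unfolding complex_basis_def by blast
  then have ex1: "\<exists>!a::complex^'n. \<theta> = (\<Sum>i\<in>UNIV. a $ i *s \<eta> i)"
    unfolding \<eta> lin t10_inject[OF ce] .
  then obtain a :: "complex^'n" where a: "\<theta> = (\<Sum>i\<in>UNIV. a $ i *s \<eta> i)" by blast
  have Up: "U i p = t10 c (lcoeff c (\<eta> i) ?x) p" for i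
    by (rule coord_left_inv10[OF U(1,2) _ c]) (simp add: U(3) \<eta>)
  \<comment> \<open>Translation to \<open>p\<close> is linear and injective, so coordinates at the
    identity are coordinates with respect to the frame at \<open>p\<close>.\<close>
  have "frame_coord U ?w = a"
    unfolding frame_coord_def snd_conv fst_conv Up lin t10_inject[OF c]
  proof (rule the_equality)
    show "v = (\<Sum>i\<in>UNIV. a $ i *s lcoeff c (\<eta> i) ?x)"
      using \<theta> unfolding a by (simp add: lcoeff_sum[OF c(1) x] lcoeff_scale[OF c(1) x])
    fix b assume "v = (\<Sum>i\<in>UNIV. b $ i *s lcoeff c (\<eta> i) ?x)"
    then have "lcoeff c \<theta> ?x = lcoeff c (\<Sum>i\<in>UNIV. b $ i *s \<eta> i) ?x"
      using \<theta> by (simp add: lcoeff_sum[OF c(1) x] lcoeff_scale[OF c(1) x])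
    then show "b = a" using lcoeff_inj[OF c(1) x] ex1 a by blast
  qed
  moreover have L: "lift10 A (U i) ?w = t10 (T10_chart A c) (vpair (lcoeff c (\<eta> i) ?x) (FD (lcoeff c (\<eta> i)) ?x v)) ?w" for i
    by (rule lift10_left_inv[OF U(1,2) _ c]) (simp add: U(3) \<eta>)
  ultimately have "frame_spray A U ?w
     = t10 (T10_chart A c) (\<Sum>i\<in>UNIV. a $ i *s vpair (lcoeff c (\<eta> i) ?x) (FD (lcoeff c (\<eta> i)) ?x v)) ?w"
    unfolding lin[symmetric] by (simp add: frame_spray_def fun_eq_iff)
  also have "(\<Sum>i\<in>UNIV. a $ i *s vpair (lcoeff c (\<eta> i) ?x) (FD (lcoeff c (\<eta> i)) ?x v))
      = vpair v (FD (lcoeff c \<theta>) ?x v)"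
    unfolding vpair_scale vpair_sum FD_lcoeff_sum[OF c(1) x, symmetric] lcoeff_scale[OF c(1) x, symmetric]
      lcoeff_sum[OF c(1) x, symmetric] a[symmetric] \<theta> ..
  finally show ?thesis using scoeff_eq[OF c(1) x \<theta>] by simp
qed

text \<open>The inverse function theorem for the map sending \<open>(x, \<eta>)\<close> to
  \<open>(x, lcoeff c \<eta> x)\<close>. The inverse is known to exist globally, so only its
  differentiability is at stake; its derivative is complex linear as the inverse of a complex linear
  map.\<close>

lemma holo_lcoeff_inverse:
  assumes c: "c \<in> A"
  shows "holo_on (\<lambda>q :: 'n cpair. vpair (vfst q) (THE \<eta>. lcoeff c \<eta> (vfst q) = vsnd q) :: 'n cpair)
     {q. vfst q \<in> snd c ` fst c}"
proof -
  let ?S = "snd c ` fst c"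
  let ?P = "{q :: 'n cpair. vfst q \<in> ?S}"
  let ?K = "\<lambda>q :: 'n cpair. lcoeff c (vsnd q) (vfst q)"
  let ?\<Psi> = "\<lambda>q :: 'n cpair. vpair (vfst q) (?K q) :: 'n cpair"
  let ?g = "\<lambda>q :: 'n cpair. vpair (vfst q) (THE \<eta>. lcoeff c \<eta> (vfst q) = vsnd q) :: 'n cpair"
  have P: "open ?P" by (rule open_vfst_vimage[OF open_img[OF c]])
  have hK: "holo_on ?K ?P" by (rule holo_lcoeff_joint[OF c])
  have h\<Psi>: "holo_on ?\<Psi> ?P" by (intro holo_on_vpair holo_on_vfst hK)
  have g\<Psi>: "?g (?\<Psi> q) = q" if "q \<in> ?P" for q
    using that lcoeff_the[OF c, of "vfst q" "vsnd q"] by simp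
  have \<Psi>g: "?\<Psi> (?g q) = q" if q: "q \<in> ?P" for q
  proof -
    obtain \<eta> where "lcoeff c \<eta> (vfst q) = vsnd q" using lcoeff_surj[OF c] q by blast
    then show ?thesis using lcoeff_the[OF c, of "vfst q" \<eta>] q by simp
  qed
  have "\<exists>g'. (?g has_derivative g') (at q) \<and> (\<forall>a v. g' (a *s v) = a *s g' v)" if q: "q \<in> ?P" for q
  proof -
    let ?r = "?g q"
    have r: "?r \<in> ?P" using q by simp
    note D = holo_onD[OF h\<Psi> r]
    \<comment> \<open>The second component is linear in \<open>\<eta>\<close>, hence equal to its
      own partial derivative there.\<close>
    have FDK: "FD ?K ?r (vpair 0 b) = lcoeff c b (vfst q)" for b
    proof -
      have "((\<lambda>t. lcoeff c t (vfst q)) has_derivative (\<lambda>b. lcoeff c b (vfst q))) (at (vsnd ?r))"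
        using lcoeff_linear[OF c, of "vfst q"] q linear_conv_bounded_linear
        by (intro bounded_linear_imp_has_derivative) auto
      moreover have "((\<lambda>t. ?K (vpair (vfst q) t)) has_derivative (\<lambda>b. FD ?K ?r (vpair 0 b))) (at (vsnd ?r))"
        by (rule has_derivative_compose[where f="\<lambda>t. vpair (vfst q) t"])
          (use holo_onD(2)[OF hK r] in \<open>auto intro!: derivative_eq_intros\<close>)
      ultimately show ?thesis using has_derivative_unique by (fastforce dest: fun_cong)
    qed
    have D\<Psi>: "FD ?\<Psi> ?r = (\<lambda>v. vpair (vfst v) (FD ?K ?r v))"
      by (rule FD_eq) (intro derivative_intros bounded_linear_imp_has_derivative[OF bounded_linear_vfst] holo_onD(2)[OF hK r])
    have lin: "linear (FD ?\<Psi> ?r)" using FD_linear[OF D(1)] by (rule bounded_linear.linear)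
    \<comment> \<open>The derivative is block triangular with diagonal blocks the identity and
      \<open>lcoeff\<close>, and the latter is injective by \<open>lcoeff_eq_0\<close>.\<close>
    have inj: "inj (FD ?\<Psi> ?r)"
    proof (rule linear_injective_0[OF lin, THEN iffD2], intro allI impI)
      fix v assume "FD ?\<Psi> ?r v = 0"
      then have v1: "vfst v = 0" and v2: "FD ?K ?r v = 0"
        unfolding D\<Psi> vpair_0[symmetric] vpair_eq_iff by auto
      have v: "vpair 0 (vsnd v) = v" unfolding v1[symmetric] by (rule vpair_collapse)
      have "lcoeff c (vsnd v) (vfst q) = FD ?K ?r (vpair 0 (vsnd v))" by (rule FDK[symmetric])
      also have "\<dots> = 0" unfolding v by (rule v2)
      finally have "vsnd v = 0" using lcoeff_eq_0[OF c] q by simp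
      then show "v = 0" using v by simp
    qed
    obtain g' where g': "linear g'" "\<And>v. g' (FD ?\<Psi> ?r v) = v" "\<And>v. FD ?\<Psi> ?r (g' v) = v"
      using linear_injective_isomorphism[OF lin inj] by blast
    have "(?g has_derivative g') (at (?\<Psi> ?r))"
    proof (rule has_derivative_inverse_strong[OF P r])
      show "continuous_on ?P ?\<Psi>" by (rule holo_on_continuous[OF h\<Psi>])
      show "(?\<Psi> has_derivative FD ?\<Psi> ?r) (at ?r)" by (rule D(2))
      show "FD ?\<Psi> ?r \<circ> g' = id" using g'(3) by (simp add: fun_eq_iff)
      show "?g (?\<Psi> q) = q" if "q \<in> ?P" for q by (rule g\<Psi>[OF that])
    qed
    moreover have "g' (a *s v) = a *s g' v" for a v
    proof -
      have "FD ?\<Psi> ?r (g' (a *s v)) = FD ?\<Psi> ?r (a *s g' v)" by (simp only: g'(3) D(3))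
      then show ?thesis using inj by (simp add: inj_eq)
    qed
    ultimately show ?thesis unfolding \<Psi>g[OF q] by blast
  qed
  then show ?thesis unfolding holo_on_def by blast
qed

text \<open>The vector held fixed in \<open>scoeff\<close> moves with the point. Expanding it over
  the constant vectors \<open>axis j 1\<close> takes it out of the derivative, and only products of
  holomorphic functions remain.\<close>

lemma holo_scoeff:
  assumes c: "c \<in> A"
  shows "holo_on (\<lambda>q :: 'n cpair. scoeff c (vfst q) (vsnd q)) {q. vfst q \<in> snd c ` fst c}"
proof -
  let ?P = "{q :: 'n cpair. vfst q \<in> snd c ` fst c}"
  let ?\<eta> = "\<lambda>q :: 'n cpair. THE \<eta>. lcoeff c \<eta> (vfst q) = vsnd q"
  have "holo_on (\<lambda>q. \<Sum>j\<in>UNIV. ?\<eta> q $ j *s FD (lcoeff c (axis j 1)) (vfst q) (vsnd q)) ?P"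
  proof (intro holo_on_sum holo_on_scale)
    show "holo_on ?\<eta> ?P"
      using holo_on_compose[OF holo_lcoeff_inverse[OF c] holo_on_vsnd[of UNIV]] by simp
    show "holo_on (\<lambda>q :: 'n cpair. FD (lcoeff c (axis j 1)) (vfst q) (vsnd q)) ?P" for j
      by (rule holo_FD_joint[OF holo_lcoeff[OF c] open_img[OF c]])
  qed
  then show ?thesis
  proof (rule holo_on_cong[OF _ open_vfst_vimage[OF open_img[OF c]]])
    fix q :: "'n cpair" assume "q \<in> ?P"
    then have x: "vfst q \<in> snd c ` fst c" by simp
    have "scoeff c (vfst q) (vsnd q) = FD (lcoeff c (\<Sum>j\<in>UNIV. ?\<eta> q $ j *s axis j 1)) (vfst q) (vsnd q)"
      unfolding basis_expansion by (simp add: scoeff_def)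
    then show "(\<Sum>j\<in>UNIV. ?\<eta> q $ j *s FD (lcoeff c (axis j 1)) (vfst q) (vsnd q)) = scoeff c (vfst q) (vsnd q)"
      by (simp only: FD_lcoeff_sum[OF c x])
  qed
qed

subsection \<open>Left and right invariant fields give the same spray\<close>

text \<open>\<open>\<Phi>\<close> is the product \<open>a p b\<close> with \<open>a\<close> and
  \<open>b\<close> near the identity. Differentiating in \<open>b\<close> at the identity gives the
  left invariant field of \<open>\<eta>\<close> at \<open>a p\<close>; differentiating that in
  \<open>a\<close> moves the point along the right invariant field of \<open>\<theta>\<close>, and
  the chain rule gives the value.\<close>

lemma mixed_derivative:
  assumes c: "c \<in> A" "p \<in> fst c"
  defines "\<Phi> \<equiv> \<lambda>q :: 'n cpair. snd c (mul (mul (chart_inv ce (vfst q)) p) (chart_inv ce (vsnd q)))"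
    and "q0 \<equiv> vpair (snd ce e) (snd ce e)"
  shows "\<exists>\<Omega>. open \<Omega> \<and> q0 \<in> \<Omega> \<and> holo_on \<Phi> \<Omega> \<and> (\<forall>q\<in>\<Omega>. vfst q \<in> snd ce ` fst ce \<and> vsnd q \<in> snd ce ` fst ce)"
    and "FD (\<lambda>q. FD \<Phi> q (vpair 0 \<eta>)) q0 (vpair \<theta> 0)
      = FD (lcoeff c \<eta>) (snd c p) (lie_charts.lcoeff A (\<lambda>x y. mul y x) e c \<theta> (snd c p))"
proof -
  interpret opp: lie_charts A X "\<lambda>x y. mul y x" e by (rule lie_charts_opp)
  let ?x = "snd c p" and ?y0 = "snd ce e"
  have x: "?x \<in> snd c ` fst c" using c by simp
  \<comment> \<open>The product \<open>a p\<close> in the chart \<open>c\<close>, written with the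
    opposite multiplication so that its derivative at the identity is
    \<open>opp.lcoeff\<close>.\<close>
  let ?N = "\<lambda>a. opp.mloc c ce c (vpair ?x a)"
  let ?Oa = "{a. vpair ?x a \<in> opp.mdom c ce c}"
  have Oa: "open ?Oa"
    using open_vimage[OF opp.open_mdom[OF c(1) ce(1) c(1)], of "\<lambda>a. vpair ?x a"]
    by (simp add: vimage_def continuous_intros)
  have y0: "?y0 \<in> ?Oa" using opp.mdom_e[OF c(1) x] by simp
  have N0: "?N ?y0 = ?x" using points_mem[OF c] c ce by (simp add: opp.mloc_def)
  have holo_N: "holo_on ?N ?Oa"
    by (rule holo_on_compose[OF _ opp.holo_mloc[OF c(1) ce(1) c(1)]])
      (auto intro!: holo_on_vpair holo_on_const holo_on_linear[of "\<lambda>x. x"] linearI)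
  have N_img: "?N a \<in> snd c ` fst c" if "a \<in> ?Oa" for a
    using that by (auto simp: opp.mdom_def opp.mloc_def)
  let ?P = "{q :: 'n cpair. vfst q \<in> ?Oa}"
  let ?k = "\<lambda>q :: 'n cpair. vpair (?N (vfst q)) (vsnd q) :: 'n cpair"
  have P: "open ?P" by (rule open_vfst_vimage[OF Oa])
  have holo_k: "holo_on ?k ?P"
    by (intro holo_on_vpair holo_on_vsnd holo_on_compose[OF holo_on_vfst holo_N]) auto
  define \<Omega> where "\<Omega> = ?P \<inter> ?k -` mdom c ce c"
  have O: "open \<Omega>" unfolding \<Omega>_def
    by (rule continuous_open_preimage[OF holo_on_continuous[OF holo_k] P open_mdom[OF c(1) ce(1) c(1)]])
  have q0: "q0 \<in> \<Omega>"
    using y0 mdom_e[OF c(1) x] by (simp add: \<Omega>_def q0_def N0)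
  have holo_Mk: "holo_on (\<lambda>q. mloc c ce c (?k q)) \<Omega>"
    by (rule holo_on_compose[OF holo_on_subset[OF holo_k] holo_mloc[OF c(1) ce(1) c(1)]]) (auto simp: \<Omega>_def)
  have eq: "mloc c ce c (?k q) = \<Phi> q" if q: "q \<in> \<Omega>" for q
    using q c by (simp add: \<Omega>_def \<Phi>_def mloc_def opp.mloc_def opp.mdom_def)
  have holo_\<Phi>: "holo_on \<Phi> \<Omega>" by (rule holo_on_cong[OF holo_Mk O eq])
  show "\<exists>\<Omega>. open \<Omega> \<and> q0 \<in> \<Omega> \<and> holo_on \<Phi> \<Omega> \<and> (\<forall>q\<in>\<Omega>. vfst q \<in> snd ce ` fst ce \<and> vsnd q \<in> snd ce ` fst ce)"
    using O q0 holo_\<Phi> by (intro exI[of _ \<Omega>]) (auto simp: \<Omega>_def mdom_def opp.mdom_def)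
  have inner: "FD \<Phi> (vpair a ?y0) (vpair 0 \<eta>) = lcoeff c \<eta> (?N a)" if q: "vpair a ?y0 \<in> \<Omega>" for a
  proof -
    let ?q = "vpair a ?y0 :: 'n cpair"
    have a: "a \<in> ?Oa" and m: "?k ?q \<in> mdom c ce c" using q by (simp_all add: \<Omega>_def)
    have "FD \<Phi> ?q = FD (\<lambda>q. mloc c ce c (?k q)) ?q"
      by (rule differentiable_cong_open(2)[OF O q]) (rule eq[symmetric])
    also have "\<dots> = (\<lambda>v. FD (mloc c ce c) (?k ?q) (vpair (FD ?N (vfst ?q) (vfst v)) (vsnd v)))"
    proof (rule FD_eq, rule has_derivative_compose[where f="?k"])
      show "(?k has_derivative (\<lambda>v. vpair (FD ?N (vfst ?q) (vfst v)) (vsnd v))) (at ?q)"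
        by (intro has_derivative_vpair has_derivative_compose[where f=vfst and g="?N"]
            bounded_linear_imp_has_derivative[OF bounded_linear_vfst]
            bounded_linear_imp_has_derivative[OF bounded_linear_vsnd] holo_onD(2)[OF holo_N]) (use a in simp)
      show "(mloc c ce c has_derivative FD (mloc c ce c) (?k ?q)) (at (?k ?q))"
        by (rule holo_onD(2)[OF holo_mloc[OF c(1) ce(1) c(1)] m])
    qed
    finally show ?thesis
      using FD_0[OF holo_onD(1)[OF holo_N a]] by (simp add: lcoeff_def)
  qed
  let ?Q = "{a. vpair a ?y0 \<in> \<Omega>}"
  have Q: "open ?Q"
    using open_vimage[OF O, of "\<lambda>a. vpair a ?y0"] by (simp add: vimage_def continuous_intros)
  have yQ: "?y0 \<in> ?Q" using q0 by (simp add: q0_def)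
  have h: "holo_on (\<lambda>q. FD \<Phi> q (vpair 0 \<eta>)) \<Omega>" by (rule holo_FD[OF holo_\<Phi> O])
  have "((\<lambda>a. FD \<Phi> (vpair a ?y0) (vpair 0 \<eta>)) has_derivative (\<lambda>\<theta>. FD (\<lambda>q. FD \<Phi> q (vpair 0 \<eta>)) q0 (vpair \<theta> 0))) (at ?y0)"
    by (rule has_derivative_compose[where f="\<lambda>a. vpair a ?y0"])
      (use holo_onD(2)[OF h q0] in \<open>auto intro!: derivative_eq_intros simp: q0_def\<close>)
  then have "((\<lambda>a. lcoeff c \<eta> (?N a)) has_derivative (\<lambda>\<theta>. FD (\<lambda>q. FD \<Phi> q (vpair 0 \<eta>)) q0 (vpair \<theta> 0))) (at ?y0)"
    by (rule has_derivative_transform_within_open[OF _ Q yQ]) (use inner in simp)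
  moreover have "((\<lambda>a. lcoeff c \<eta> (?N a)) has_derivative (\<lambda>\<theta>. FD (lcoeff c \<eta>) ?x (opp.lcoeff c \<theta> ?x))) (at ?y0)"
  proof (rule has_derivative_compose[where f="?N" and g="lcoeff c \<eta>" and g'="FD (lcoeff c \<eta>) ?x"
      and f'="\<lambda>\<theta>. opp.lcoeff c \<theta> ?x"])
    have "((\<lambda>a. opp.mloc c ce c (vpair ?x a)) has_derivative (\<lambda>\<theta>. FD (opp.mloc c ce c) (vpair ?x ?y0) (vpair 0 \<theta>))) (at ?y0)"
      by (rule has_derivative_compose[where f="\<lambda>a. vpair ?x a"])
        (use holo_onD(2)[OF opp.holo_mloc[OF c(1) ce(1) c(1)]] y0 in \<open>auto intro!: derivative_eq_intros\<close>)
    then show "(?N has_derivative (\<lambda>\<theta>. opp.lcoeff c \<theta> ?x)) (at ?y0)" by (simp add: opp.lcoeff_def)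
    show "(lcoeff c \<eta> has_derivative FD (lcoeff c \<eta>) ?x) (at (?N ?y0))"
      unfolding N0 by (rule holo_onD(2)[OF holo_lcoeff[OF c(1)] x])
  qed
  ultimately have "(\<lambda>\<theta>. FD (\<lambda>q. FD \<Phi> q (vpair 0 \<eta>)) q0 (vpair \<theta> 0)) = (\<lambda>\<theta>. FD (lcoeff c \<eta>) ?x (opp.lcoeff c \<theta> ?x))"
    by (rule has_derivative_unique)
  then show "FD (\<lambda>q. FD \<Phi> q (vpair 0 \<eta>)) q0 (vpair \<theta> 0) = FD (lcoeff c \<eta>) ?x (opp.lcoeff c \<theta> ?x)"
    by (rule fun_cong)
qed

text \<open>If \<open>\<eta>\<close> and \<open>\<theta>\<close> are chosen such that the left and
  the right invariant field both equal \<open>v\<close> at \<open>p\<close>, the two coefficients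
  are the two orders of differentiating \<open>a p b\<close>.\<close>

lemma scoeff_opp:
  assumes c: "c \<in> A" "p \<in> fst c"
  shows "lie_charts.scoeff A (\<lambda>x y. mul y x) e c (snd c p) v = scoeff c (snd c p) v"
proof -
  interpret opp: lie_charts A X "\<lambda>x y. mul y x" e by (rule lie_charts_opp)
  let ?x = "snd c p"
  have x: "?x \<in> snd c ` fst c" using c by simp
  have pp: "p \<in> points A" using points_mem[OF c] .
  obtain \<eta> where \<eta>: "lcoeff c \<eta> ?x = v" using lcoeff_surj[OF c(1) x] by blast
  obtain \<theta> where \<theta>: "opp.lcoeff c \<theta> ?x = v" using opp.lcoeff_surj[OF c(1) x] by blast
  define \<Phi> where "\<Phi> = (\<lambda>q :: 'n cpair. snd c (mul (mul (chart_inv ce (vfst q)) p) (chart_inv ce (vsnd q))))"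
  define \<Psi> where "\<Psi> = (\<lambda>q :: 'n cpair. snd c (mul (chart_inv ce (vsnd q)) (mul p (chart_inv ce (vfst q)))))"
  define q0 where "q0 = (vpair (snd ce e) (snd ce e) :: 'n cpair)"
  let ?sw = "\<lambda>q :: 'n cpair. vpair (vsnd q) (vfst q) :: 'n cpair"
  have sw: "bounded_linear ?sw"
    unfolding linear_conv_bounded_linear[symmetric] by (auto intro!: linearI vpair_eqI)
  obtain \<Omega> where O: "open \<Omega>" "q0 \<in> \<Omega>" "holo_on \<Phi> \<Omega>" "\<forall>q\<in>\<Omega>. vfst q \<in> snd ce ` fst ce \<and> vsnd q \<in> snd ce ` fst ce"
    using mixed_derivative(1)[OF c] unfolding \<Phi>_def q0_def by blast
  have 1: "FD (\<lambda>q. FD \<Phi> q (vpair 0 \<eta>)) q0 (vpair \<theta> 0) = scoeff c ?x v"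
    using mixed_derivative(2)[OF c, of \<eta> \<theta>] \<theta> scoeff_eq[OF c(1) x \<eta>] by (simp add: \<Phi>_def q0_def)
  have 2: "FD (\<lambda>q. FD \<Psi> q (vpair 0 \<theta>)) q0 (vpair \<eta> 0) = opp.scoeff c ?x v"
    using opp.mixed_derivative(2)[OF c, of \<theta> \<eta>] \<eta> opp.scoeff_eq[OF c(1) x \<theta>] by (simp add: \<Psi>_def q0_def)
  let ?S = "{q. ?sw q \<in> \<Omega>}"
  have S: "open ?S"
    using open_vimage[OF O(1), of ?sw] by (simp add: vimage_def continuous_intros)
  have qS: "q0 \<in> ?S" using O(2) by (simp add: q0_def)
  \<comment> \<open>\<open>\<Psi>\<close> is the function \<open>\<Phi>\<close> of the opposite
    group; once its arguments are exchanged, only associativity is left.\<close>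
  have eq: "\<Phi> (?sw q) = \<Psi> q" if "q \<in> ?S" for q
  proof -
    have "vfst (?sw q) \<in> snd ce ` fst ce" "vsnd (?sw q) \<in> snd ce ` fst ce" using O(4) that by blast+
    then have "chart_inv ce (vfst q) \<in> points A" "chart_inv ce (vsnd q) \<in> points A"
      using points_mem[OF ce(1)] by (auto simp: ce)
    then show ?thesis by (simp add: \<Phi>_def \<Psi>_def mul_assoc pp)
  qed
  have FD\<Psi>: "FD \<Psi> q (vpair 0 \<theta>) = FD \<Phi> (?sw q) (vpair \<theta> 0)" if q: "q \<in> ?S" for q
  proof -
    have "((\<lambda>q. \<Phi> (?sw q)) has_derivative (\<lambda>v. FD \<Phi> (?sw q) (?sw v))) (at q)"
      by (rule has_derivative_compose[OF bounded_linear_imp_has_derivative[OF sw] holo_onD(2)[OF O(3)]]) (use q in simp)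
    then have "(\<Psi> has_derivative (\<lambda>v. FD \<Phi> (?sw q) (?sw v))) (at q)"
      by (rule has_derivative_transform_within_open[OF _ S q]) (rule eq)
    then show ?thesis by (simp add: FD_eq)
  qed
  note h = holo_FD[OF O(3,1), of "vpair \<theta> 0"]
  have "((\<lambda>q. FD \<Phi> (?sw q) (vpair \<theta> 0)) has_derivative (\<lambda>v. FD (\<lambda>q. FD \<Phi> q (vpair \<theta> 0)) q0 (?sw v))) (at q0)"
    by (rule has_derivative_compose[where f="?sw", OF bounded_linear_imp_has_derivative[OF sw]])
      (use holo_onD(2)[OF h O(2)] in \<open>simp add: q0_def\<close>)
  then have "((\<lambda>q. FD \<Psi> q (vpair 0 \<theta>)) has_derivative (\<lambda>v. FD (\<lambda>q. FD \<Phi> q (vpair \<theta> 0)) q0 (?sw v))) (at q0)"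
    by (rule has_derivative_transform_within_open[OF _ S qS]) (rule FD\<Psi>[symmetric])
  then have "opp.scoeff c ?x v = FD (\<lambda>q. FD \<Phi> q (vpair \<theta> 0)) q0 (vpair 0 \<eta>)"
    using 2 by (simp add: FD_eq)
  also have "\<dots> = FD (\<lambda>q. FD \<Phi> q (vpair 0 \<eta>)) q0 (vpair \<theta> 0)"
    by (rule holo_symmetric_FD[OF O(3,1,2)])
  finally show ?thesis using 1 by simp
qed

end

section \<open>The Finsler metric\<close>

lemma sum_UNIV_Plus:
  fixes f :: "'n::finite + 'm::finite \<Rightarrow> 'b::comm_monoid_add"
  shows "(\<Sum>k\<in>UNIV. f k) = (\<Sum>i\<in>UNIV. f (Inl i)) + (\<Sum>j\<in>UNIV. f (Inr j))"
  unfolding UNIV_Plus_UNIV[symmetric] by (subst sum.Plus) (simp_all add: o_def)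

lemma axis_imaginary: "axis j \<i> = \<i> *s (axis j 1 :: complex^'n::finite)"
  by (simp add: vec_eq_iff axis_def)

lemma wirt_derivative:
  fixes h :: "complex^'n::finite \<Rightarrow> complex"
  assumes h: "Ck_on 2 h P" and q: "q \<in> P"
  shows "(wirt k h has_derivative
    (\<lambda>u. (FD (\<lambda>q. FD h q (axis k 1)) q u - \<i> * FD (\<lambda>q. FD h q (axis k \<i>)) q u) / 2)) (at q)"
    and "(wirt_bar k h has_derivative
    (\<lambda>u. (FD (\<lambda>q. FD h q (axis k 1)) q u + \<i> * FD (\<lambda>q. FD h q (axis k \<i>)) q u) / 2)) (at q)"
proof -
  have d: "((\<lambda>q. FD h q v) has_derivative FD (\<lambda>q. FD h q v) q) (at q)" for v
    using h q by (intro FD_works) (simp add: numeral_2_eq_2)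
  show "(wirt k h has_derivative
    (\<lambda>u. (FD (\<lambda>q. FD h q (axis k 1)) q u - \<i> * FD (\<lambda>q. FD h q (axis k \<i>)) q u) / 2)) (at q)"
    unfolding wirt_def[abs_def] divide_inverse by (intro derivative_intros d)
  show "(wirt_bar k h has_derivative
    (\<lambda>u. (FD (\<lambda>q. FD h q (axis k 1)) q u + \<i> * FD (\<lambda>q. FD h q (axis k \<i>)) q u) / 2)) (at q)"
    unfolding wirt_bar_def[abs_def] divide_inverse by (intro derivative_intros d)
qed

text \<open>The Levi matrix takes the antiholomorphic derivative first, \<open>Ncoef\<close> takes
  it last; symmetry of second derivatives reconciles the two orders.\<close>

lemma wirt_commute:
  fixes h :: "complex^'n::finite \<Rightarrow> complex"
  assumes h: "Ck_on 2 h P" and P: "open P" and q: "q \<in> P"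
  shows "wirt_bar m (wirt k h) q = wirt k (wirt_bar m h) q"
proof -
  note s = symmetric_FD[OF h P q]
  show ?thesis
    unfolding wirt_def[of k "wirt_bar m h"] wirt_bar_def[of m "wirt k h"]
      FD_eq[OF wirt_derivative(1)[OF h q]] FD_eq[OF wirt_derivative(2)[OF h q]]
      s[of "axis m 1"] s[of "axis m \<i>"]
    by (simp add: field_simps)
qed

text \<open>The coefficients \<open>Z\<close> pass through the antiholomorphic derivative because they are holomorphic.\<close>

lemma wirt_bar_holo_combination:
  fixes h :: "complex^'n::finite \<Rightarrow> complex"
  assumes h: "Ck_on 2 h P" and P: "open P" and q: "q \<in> P" and Z: "holo_on Z P"
    and 0: "\<And>q. q \<in> P \<Longrightarrow> FD h q (Z q) = 0" "\<And>q. q \<in> P \<Longrightarrow> FD h q (\<i> *s Z q) = 0"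
  shows "(\<Sum>k\<in>UNIV. Z q $ k * wirt_bar m (wirt k h) q) = 0"
proof -
  let ?H = "\<lambda>q. \<Sum>k\<in>UNIV. Z q $ k * wirt k h q"
  have hd: "h differentiable (at q)" if "q \<in> P" for q
    using h that by (simp add: numeral_2_eq_2)
  \<comment> \<open>The two real equations together say that the (1,0) part vanishes on the whole
    open set, so this identity may be differentiated once more.\<close>
  have H0: "?H q = 0" if "q \<in> P" for q
    using wirt_sum[OF hd[OF that], of "Z q"] 0 that by simp
  have "(?H has_derivative (\<lambda>u. 0)) (at q)"
    by (rule has_derivative_transform_within_open[OF has_derivative_const P q]) (simp add: H0)
  moreover have "(?H has_derivative
      (\<lambda>u. \<Sum>k\<in>UNIV. Z q $ k * FD (wirt k h) q u + FD Z q u $ k * wirt k h q)) (at q)"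
    by (intro has_derivative_sum has_derivative_mult bounded_linear.has_derivative[OF bounded_linear_vec_nth]
        holo_onD(2)[OF Z q] FD_works differentiableI[OF wirt_derivative(1)[OF h q]])
  ultimately have eq: "(\<Sum>k\<in>UNIV. Z q $ k * FD (wirt k h) q u + FD Z q u $ k * wirt k h q) = 0" for u
    using has_derivative_unique by (fastforce dest: fun_cong)
  have "(\<Sum>k\<in>UNIV. Z q $ k * wirt_bar m (wirt k h) q)
      = ((\<Sum>k\<in>UNIV. Z q $ k * FD (wirt k h) q (axis m 1) + FD Z q (axis m 1) $ k * wirt k h q)
        + \<i> * (\<Sum>k\<in>UNIV. Z q $ k * FD (wirt k h) q (axis m \<i>) + FD Z q (axis m \<i>) $ k * wirt k h q)) / 2"
    unfolding sum_distrib_left sum.distrib[symmetric] sum_divide_distrib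
    by (intro sum.cong refl) (simp add: wirt_bar_def axis_imaginary holo_onD(3)[OF Z q] field_simps)
  then show ?thesis unfolding eq by simp
qed

text \<open>The form pairs \<open>H $ i $ j\<close> with \<open>\<xi> $ i\<close> and the conjugate
  of \<open>\<xi> $ j\<close>, so a vector \<open>x\<close> killed by \<open>H\<close> contradicts
  positivity at the conjugate of \<open>x\<close>.\<close>

lemma pos_def_invertible:
  assumes "pos_def_hermitian H"
  shows "invertible H"
proof -
  have "x = 0" if x: "H *v x = 0" for x
  proof (rule ccontr)
    assume "x \<noteq> 0"
    then have nz: "(\<chi> i. cnj (x $ i)) \<noteq> 0" by (simp add: vec_eq_iff)
    have "0 < Re (\<Sum>i\<in>UNIV. \<Sum>j\<in>UNIV. H $ i $ j * cnj (x $ i) * x $ j)"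
      using conjunct2[OF assms[unfolded pos_def_hermitian_def], rule_format, OF nz] by simp
    also have "(\<Sum>i\<in>UNIV. \<Sum>j\<in>UNIV. H $ i $ j * cnj (x $ i) * x $ j) = (\<Sum>i\<in>UNIV. cnj (x $ i) * (H *v x) $ i)"
      by (simp add: matrix_vector_mult_def sum_distrib_left mult_ac)
    finally show False using x by simp
  qed
  then have "\<exists>B. B ** H = mat 1" by (simp add: matrix_left_invertible_ker)
  then show ?thesis by (simp add: invertible_left_inverse)
qed

text \<open>Solves the linear system for the fibre component \<open>s\<close>: multiplication by the
  inverse of the Levi matrix isolates \<open>s\<close> and turns the other term into
  \<open>Ncoef\<close>. The minus sign is that of \<open>delta_z\<close>.\<close>

lemma spray_coefficients:
  fixes h :: "complex^('n::finite + 'n) \<Rightarrow> complex"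
  assumes inv: "invertible (Levi h q)"
    and comm: "\<And>i m. wirt_bar (Inr m) (wirt (Inr i) h) q = wirt (Inr i) (wirt_bar (Inr m) h) q"
    and eq: "\<And>m. (\<Sum>k\<in>UNIV. vpair w s $ k * wirt_bar (Inr m) (wirt k h) q) = 0"
  shows "s $ j = - (\<Sum>i\<in>UNIV. w $ i * Ncoef h q j i)"
proof -
  let ?I = "matrix_inv (Levi h q)"
  have LI: "Levi h q ** ?I = mat 1" 
    using someI_ex[OF inv[unfolded invertible_def]] unfolding matrix_inv_def by blast
  have e: "(\<Sum>i\<in>UNIV. w $ i * wirt_bar (Inr m) (wirt (Inl i) h) q) + (\<Sum>i\<in>UNIV. s $ i * Levi h q $ i $ m) = 0" for m
    using eq[of m] by (simp add: sum_UNIV_Plus Levi_def comm)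
  have "0 = (\<Sum>m\<in>UNIV. ?I $ m $ j * ((\<Sum>i\<in>UNIV. w $ i * wirt_bar (Inr m) (wirt (Inl i) h) q) + (\<Sum>i\<in>UNIV. s $ i * Levi h q $ i $ m)))"
    by (simp only: e mult_zero_right sum.neutral_const)
  also have "\<dots> = (\<Sum>m\<in>UNIV. \<Sum>i\<in>UNIV. w $ i * (?I $ m $ j * wirt_bar (Inr m) (wirt (Inl i) h) q))
      + (\<Sum>m\<in>UNIV. \<Sum>i\<in>UNIV. s $ i * (Levi h q $ i $ m * ?I $ m $ j))"
    by (simp add: distrib_left sum.distrib sum_distrib_left mult_ac)
  also have "(\<Sum>m\<in>UNIV. \<Sum>i\<in>UNIV. w $ i * (?I $ m $ j * wirt_bar (Inr m) (wirt (Inl i) h) q))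
      = (\<Sum>i\<in>UNIV. w $ i * Ncoef h q j i)"
    by (subst sum.swap) (simp add: Ncoef_def sum_distrib_left)
  also have "(\<Sum>m\<in>UNIV. \<Sum>i\<in>UNIV. s $ i * (Levi h q $ i $ m * ?I $ m $ j)) = (\<Sum>i\<in>UNIV. s $ i * (Levi h q ** ?I) $ i $ j)"
    by (subst sum.swap) (simp add: matrix_matrix_mult_def sum_distrib_left)
  also have "\<dots> = s $ j"
    unfolding LI by (simp add: mat_def if_distrib[of "\<lambda>x. _ * x"] cong: if_cong)
  finally show ?thesis by (rule minus_unique[OF sym, symmetric])
qed

text \<open>The product rule at second order; two derivatives of \<open>F\<^sup>2\<close> are all
  that the Levi matrix and \<open>Ncoef\<close> involve.\<close>

lemma Ck_on_square:
  fixes f :: "'a::real_normed_vector \<Rightarrow> real"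
  assumes f: "Ck_on 2 f P" and P: "open P"
  shows "Ck_on 2 (\<lambda>x. complex_of_real ((f x)\<^sup>2)) P"
proof -
  define g where "g = (\<lambda>x. complex_of_real ((f x)\<^sup>2))"
  have f1: "(f has_derivative FD f x) (at x)" if "x \<in> P" for x
    using f that by (intro FD_works) (simp add: numeral_2_eq_2)
  have f2: "((\<lambda>x. FD f x v) has_derivative FD (\<lambda>x. FD f x v) x) (at x)" if "x \<in> P" for x v
    using f that by (intro FD_works) (simp add: numeral_2_eq_2)
  have f3: "continuous_on P (\<lambda>x. FD (\<lambda>x. FD f x v) x w)" for v w
    using f by (simp add: numeral_2_eq_2)
  have c0: "continuous_on P f" and c1: "continuous_on P (\<lambda>x. FD f x v)" for v
    by (rule continuous_at_imp_continuous_on, rule ballI, rule has_derivative_continuous[OF f1], assumption,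
        rule continuous_at_imp_continuous_on, rule ballI, rule has_derivative_continuous[OF f2], assumption)
  have g1: "(g has_derivative (\<lambda>v. of_real (2 * f x * FD f x v))) (at x)" if "x \<in> P" for x
    unfolding g_def power2_eq_square
    by (rule has_derivative_eq_rhs, rule has_derivative_of_real, rule has_derivative_mult[OF f1[OF that] f1[OF that]]) (simp add: mult.assoc)
  have FDg: "FD g x v = of_real (2 * f x * FD f x v)" if "x \<in> P" for x v
    using FD_eq[OF g1[OF that]] by simp
  have g2: "((\<lambda>x. FD g x v) has_derivative (\<lambda>w. of_real (2 * (f x * FD (\<lambda>x. FD f x v) x w + FD f x w * FD f x v)))) (at x)"
    if x: "x \<in> P" for x v
  proof (rule has_derivative_transform_within_open[OF _ P x])
    show "((\<lambda>x. complex_of_real (2 * f x * FD f x v)) has_derivative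
        (\<lambda>w. of_real (2 * (f x * FD (\<lambda>x. FD f x v) x w + FD f x w * FD f x v)))) (at x)"
      unfolding mult.assoc[of 2]
      by (intro has_derivative_of_real has_derivative_mult_right has_derivative_mult f1 f2 x)
  qed (simp add: FDg)
  have FDg2: "FD (\<lambda>x. FD g x v) x w = of_real (2 * (f x * FD (\<lambda>x. FD f x v) x w + FD f x w * FD f x v))"
    if "x \<in> P" for x v w
    using FD_eq[OF g2[OF that]] by simp
  have "continuous_on P (\<lambda>x. FD (\<lambda>x. FD g x v) x w)" for v w
  proof (rule continuous_on_eq)
    show "continuous_on P (\<lambda>x. complex_of_real (2 * (f x * FD (\<lambda>x. FD f x v) x w + FD f x w * FD f x v)))"
      by (intro continuous_intros c0 c1 f3)
  qed (simp add: FDg2)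
  moreover have "g differentiable (at x)" "(\<lambda>x. FD g x v) differentiable (at x)" if "x \<in> P" for x v
    using g1[OF that] g2[OF that] by (auto intro: differentiableI)
  ultimately have "Ck_on 2 g P" by (simp add: numeral_2_eq_2)
  then show ?thesis unfolding g_def .
qed

section \<open>The spray of an invariant metric\<close>

context lie_charts
begin

text \<open>Stated for invariance under right translations because these form the flows of left
  invariant fields; a left invariant metric is of this kind for the opposite group.\<close>

lemma finsler_spray:
  assumes F: "complex_finsler_metric A F"
    and inv: "\<And>g y. g \<in> points A \<Longrightarrow> y \<in> T10 A \<Longrightarrow> F (push A (\<lambda>x. mul x g) y) = F y"
    and c: "c \<in> A" "p \<in> fst c" and w: "w \<noteq> 0"
  shows "complex_spray A F c (p, t10 c w p) = t10 (T10_chart A c) (vpair w (scoeff c (snd c p) w)) (p, t10 c w p)"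
proof -
  let ?S = "snd c ` fst c"
  define h where "h = Gfun A c F"
  \<comment> \<open>The coordinates of the nonzero vectors over the chart, where \<open>F\<close> is
    smooth.\<close>
  define P where "P = {q :: 'n cpair. vfst q \<in> ?S \<and> vsnd q \<noteq> 0}"
  let ?k = "T10_chart A c" and ?y = "(p, t10 c w p)" and ?q = "vpair (snd c p) w :: 'n cpair"
  have P: "open P"
  proof -
    have "P = {q. vfst q \<in> ?S} \<inter> {q. vsnd q \<in> - {0}}" by (auto simp: P_def)
    moreover have "open {q :: 'n cpair. vsnd q \<in> - {0}}" by (rule open_vsnd_vimage) auto
    ultimately show ?thesis using open_vfst_vimage[OF open_img[OF c(1)]] by auto
  qed
  have q: "?q \<in> P" using c w by (simp add: P_def)
  have slit_iff: "(u, t10 c v u) \<in> slit \<longleftrightarrow> v \<noteq> 0" if "u \<in> fst c" for u v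
  proof -
    have "(\<lambda>f. 0) = t10 c 0 u" by (simp add: t10_0 fun_eq_iff)
    then show ?thesis using t10_inject[OF c(1) that, of v 0] by (simp add: slit_def)
  qed
  have img: "snd ?k ` (fst ?k \<inter> slit) = P"
  proof (intro equalityI subsetI)
    fix x assume "x \<in> snd ?k ` (fst ?k \<inter> slit)"
    then obtain z where z: "x = induced_coord c z" "z \<in> T10 A" "fst z \<in> fst c" "z \<in> slit"
      by (auto simp: T10_chart_def)
    obtain v where v: "z = (fst z, t10 c v (fst z))" by (rule T10_E[OF z(2) c(1) z(3)])
    have "x = vpair (snd c (fst z)) v" using z(1) coord_t10[OF c(1) z(3), of v] v by simp
    moreover have "v \<noteq> 0" using slit_iff[OF z(3), of v] z(4) v by simp
    ultimately show "x \<in> P" using z(3) by (simp add: P_def)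
  next
    fix x assume x: "x \<in> P"
    then obtain u where u: "vfst x = snd c u" "u \<in> fst c" by (auto simp: P_def)
    let ?z = "(u, t10 c (vsnd x) u)"
    have "?z \<in> fst ?k" by (rule t10_in_chart[OF c(1) u(2)])
    moreover have "?z \<in> slit" using slit_iff[OF u(2)] x by (simp add: P_def)
    moreover have "snd ?k ?z = x" using coord_t10[OF c(1) u(2), of "vsnd x"] u(1)[symmetric] by (simp add: T10_chart_def)
    ultimately show "x \<in> snd ?k ` (fst ?k \<inter> slit)" by (intro image_eqI[of _ _ ?z]) auto
  qed
  have "smooth_on (F \<circ> chart_inv ?k) P"
    using F T10_chart_mem[OF c(1)] img unfolding complex_finsler_metric_def by fastforce
  then have "Ck_on 2 (F \<circ> chart_inv ?k) P" by (simp add: smooth_on_def)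
  from Ck_on_square[OF this P] have h2: "Ck_on 2 h P"
    by (simp add: h_def Gfun_def[abs_def])
  \<comment> \<open>Invariance in coordinates: \<open>h\<close> is constant along the curves of
    \<open>kappa_derivative\<close>.\<close>
  have h_inv: "h (vpair (mloc c ce c (vpair (vfst r) b)) (FD (mloc c ce c) (vpair (vfst r) b) (vpair (vsnd r) 0))) = h r"
    if r: "vfst r \<in> ?S" and b: "vpair (vfst r) b \<in> mdom c ce c" for r :: "'n cpair" and b
  proof -
    obtain u where u: "vfst r = snd c u" "u \<in> fst c" using r by auto
    obtain g where g: "b = snd ce g" "g \<in> fst ce" using b by (auto simp: mdom_def)
    have m: "mul u g \<in> fst c" using b u g c ce by (simp add: mdom_def)
    have mloc: "mloc c ce c (vpair (vfst r) b) = snd c (mul u g)" using u g c ce by (simp add: mloc_def)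
    have "chart_inv ?k r = (u, t10 c (vsnd r) u)" using T10_chart_inv[OF c(1) r] u c by simp
    moreover have "chart_inv ?k (vpair (mloc c ce c (vpair (vfst r) b)) (FD (mloc c ce c) (vpair (vfst r) b) (vpair (vsnd r) 0)))
        = push A (\<lambda>x. mul x g) (u, t10 c (vsnd r) u)"
      unfolding push_right(2)[OF c(1) u(2) ce(1) g(2) c(1) m] mloc
      using T10_chart_inv[OF c(1), of "vpair (snd c (mul u g)) _"] m c u g by simp
    ultimately show ?thesis
      using inv[OF points_mem[OF ce(1) g(2)] t10_mem[OF c(1) u(2)]] by (simp add: h_def Gfun_def)
  qed
  have h0: "FD h r (vpair (lcoeff c \<eta> (vfst r)) (FD (lcoeff c \<eta>) (vfst r) (vsnd r))) = 0" if r: "r \<in> P" for r \<eta>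
  proof -
    have rS: "vfst r \<in> ?S" using r by (simp add: P_def)
    \<comment> \<open>A straight line replaces the integral curve, as only its velocity at 0
      enters.\<close>
    define \<gamma> where "\<gamma> t = snd ce e + t *\<^sub>R \<eta>" for t :: real
    have g: "\<gamma> 0 = snd ce e" "(\<gamma> has_vector_derivative \<eta>) (at 0)"
      unfolding \<gamma>_def[abs_def] by (auto intro!: derivative_eq_intros simp: has_vector_derivative_def)
    let ?\<kappa> = "\<lambda>t. vpair (mloc c ce c (vpair (vfst r) (\<gamma> t))) (FD (mloc c ce c) (vpair (vfst r) (\<gamma> t)) (vpair (vsnd r) 0)) :: 'n cpair"
    let ?\<zeta> = "vpair (lcoeff c \<eta> (vfst r)) (FD (lcoeff c \<eta>) (vfst r) (vsnd r)) :: 'n cpair"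
    have kd: "(?\<kappa> has_derivative (\<lambda>s. s *\<^sub>R ?\<zeta>)) (at 0)"
      using kappa_derivative[of c "vfst r" \<gamma> \<eta> "vsnd r", OF c(1) rS g] by (simp add: has_vector_derivative_def)
    have k0: "?\<kappa> 0 = r"
    proof -
      obtain u where u: "vfst r = snd c u" "u \<in> fst c" using rS by auto
      have m: "mul u e \<in> fst c" and ue: "mul u e = u" using u points_mem[OF c(1) u(2)] by simp_all
      have "push A (\<lambda>x. mul x e) (u, real_vec c (vsnd r) u) = (u, real_vec c (vsnd r) u)"
        by (rule push_ident[OF c(1) u(2)]) simp
      then have "FD (mloc c ce c) (vpair (vfst r) (\<gamma> 0)) (vpair (vsnd r) 0) = vsnd r"
        using push_right(1)[OF c(1) u(2) ce c(1) m, of "vsnd r"] real_vec_inject[OF c(1) u(2)]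
        by (simp add: ue u g(1))
      moreover have "mloc c ce c (vpair (vfst r) (\<gamma> 0)) = vfst r"
        using u c ce ue by (simp add: mloc_def g(1))
      ultimately show ?thesis by simp
    qed
    have hd: "h differentiable (at r)" using h2 r by (simp add: numeral_2_eq_2)
    have "((\<lambda>t. h (?\<kappa> t)) has_derivative (\<lambda>s. FD h r (s *\<^sub>R ?\<zeta>))) (at 0)"
      by (rule has_derivative_compose[OF kd]) (use FD_works[OF hd] k0 in simp)
    moreover have "((\<lambda>t. h (?\<kappa> t)) has_derivative (\<lambda>s. 0)) (at 0)"
    proof (rule has_derivative_cong_ev[OF _ has_derivative_const])
      have "eventually (\<lambda>t. vpair (vfst r) (\<gamma> t) \<in> mdom c ce c) (nhds 0)"
        by (rule eventually_in_open[OF has_vector_derivative_continuous[OF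
              has_vector_derivative_vpair[OF has_vector_derivative_const g(2)]] open_mdom[OF c(1) ce(1) c(1)]])
          (use mdom_e[OF c(1) rS] g(1) in simp)
      then show "eventually (\<lambda>t. h r = h (?\<kappa> t)) (nhds 0)"
        by eventually_elim (rule h_inv[OF rS, symmetric])
    qed
    ultimately have "(\<lambda>s. FD h r (s *\<^sub>R ?\<zeta>)) = (\<lambda>s. 0)" by (rule has_derivative_unique)
    from fun_cong[OF this, of 1] show ?thesis by simp
  qed
  obtain \<eta> where \<eta>: "lcoeff c \<eta> (snd c p) = w" using lcoeff_surj[OF c(1)] c(2) by blast
  \<comment> \<open>One field with \<open>\<eta>\<close> fixed. It has to match the spray only at
    \<open>?q\<close>, but as a lift it annihilates \<open>h\<close> on all of \<open>P\<close>,
    which permits a further derivative.\<close>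
  define Z where "Z r = (vpair (lcoeff c \<eta> (vfst r)) (FD (lcoeff c \<eta>) (vfst r) (vsnd r)) :: 'n cpair)"
    for r :: "'n cpair"
  have holo_Z: "holo_on Z P"
    unfolding Z_def[abs_def]
    by (intro holo_on_vpair holo_on_compose[OF holo_on_vfst holo_lcoeff[OF c(1)]]
        holo_on_subset[OF holo_FD_joint[OF holo_lcoeff[OF c(1)] open_img[OF c(1)]]]) (auto simp: P_def)
  \<comment> \<open>\<open>\<i>\<close> times the lift is the lift for
    \<open>\<i> *s \<eta>\<close>, so \<open>h0\<close> also gives the second real equation. The
    one-element index set specialises \<open>FD_lcoeff_sum\<close> to a scalar multiple.\<close>
  have iZ: "\<i> *s Z r = vpair (lcoeff c (\<i> *s \<eta>) (vfst r)) (FD (lcoeff c (\<i> *s \<eta>)) (vfst r) (vsnd r))" if "r \<in> P" for r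
    using that lcoeff_scale[OF c(1), of "vfst r" \<i> \<eta>] FD_lcoeff_sum[OF c(1), of "vfst r" "\<lambda>_. \<i>" "\<lambda>_. \<eta>" "{()}"]
    by (simp add: Z_def vpair_scale P_def)
  have Zq: "Z ?q = vpair w (scoeff c (snd c p) w)"
    using scoeff_eq[OF c(1) _ \<eta>] c(2) by (simp add: Z_def \<eta>)
  have comb: "(\<Sum>k\<in>UNIV. Z ?q $ k * wirt_bar m (wirt k h) ?q) = 0" for m
    by (rule wirt_bar_holo_combination[OF h2 P q holo_Z]) (simp_all add: h0 iZ, simp add: Z_def h0)
  have "pos_def_hermitian (Levi h (induced_coord c ?y))"
    using F c(1) t10_mem[OF c, of w] slit_iff[OF c(2), of w] w c(2)
    unfolding complex_finsler_metric_def h_def by fastforce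
  then have "invertible (Levi h ?q)"
    using pos_def_invertible coord_t10[OF c, of w] by simp
  from spray_coefficients[OF this wirt_commute[OF h2 P q] comb[unfolded Zq]]
  have s: "scoeff c (snd c p) w $ j = - (\<Sum>i\<in>UNIV. w $ i * Ncoef h ?q j i)" for j .
  show ?thesis
  proof
    fix f
    let ?pd = "\<lambda>k. pd ?k k ?y f"
    have "complex_spray A F c ?y f
      = (\<Sum>i\<in>UNIV. w $ i * (?pd (Inl i) - (\<Sum>j\<in>UNIV. Ncoef h ?q j i * ?pd (Inr j))))"
      using coord_t10[OF c, of w] by (simp add: complex_spray_def delta_z_def h_def)
    also have "\<dots> = (\<Sum>i\<in>UNIV. w $ i * ?pd (Inl i)) - (\<Sum>i\<in>UNIV. \<Sum>j\<in>UNIV. w $ i * Ncoef h ?q j i * ?pd (Inr j))"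
      by (simp add: right_diff_distrib sum_subtractf sum_distrib_left mult.assoc)
    also have "(\<Sum>i\<in>UNIV. \<Sum>j\<in>UNIV. w $ i * Ncoef h ?q j i * ?pd (Inr j)) = - (\<Sum>j\<in>UNIV. scoeff c (snd c p) w $ j * ?pd (Inr j))"
      by (subst sum.swap) (simp add: s sum_distrib_right sum_negf)
    finally show "complex_spray A F c ?y f = t10 ?k (vpair w (scoeff c (snd c p) w)) ?y f"
      by (simp add: t10_eq_sum sum_UNIV_Plus)
  qed
qed

end

section \<open>The canonical spray and the holomorphic extension\<close>

context lie_charts
begin

text \<open>The basis cancels as for a complex frame, now with real coefficients. As the basis
  property concerns invariant fields, it is applied to \<open>left_field \<theta>\<close> and then
  transferred to vectors at the identity.\<close>

lemma canonical_spray_eq: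
  assumes B: "\<And>k :: 'n + 'n. TR_field A (B k)" "\<And>k. left_inv (B k)"
    and basis: "\<And>Y. TR_field A Y \<Longrightarrow> left_inv Y \<Longrightarrow>
      \<exists>!a::real^('n + 'n). \<forall>g\<in>points A. Y g = (\<lambda>f. \<Sum>k\<in>UNIV. of_real (a $ k) * B k g f)"
    and c: "c \<in> A" "p \<in> fst c"
  shows "canonical_spray A B (p, real_vec c v p)
    = real_vec (TR_chart A c) (vpair v (scoeff c (snd c p) v)) (p, real_vec c v p)"
proof -
  let ?x = "snd c p" and ?y = "(p, real_vec c v p)"
  have x: "?x \<in> snd c ` fst c" using c by simp
  have "\<exists>\<eta>. B k e = real_vec ce \<eta> e" for k
    using B(1)[of k] TR_space_eq[OF ce] unfolding TR_field_def by (auto dest: bspec[OF _ e_points])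
  then obtain \<eta> where \<eta>: "\<And>k. B k e = real_vec ce (\<eta> k) e" by metis
  have lin: "(\<lambda>f. \<Sum>k\<in>UNIV. of_real (a $ k) * real_vec d (\<zeta> k) q f) = real_vec d (\<Sum>k\<in>UNIV. of_real (a $ k) *s \<zeta> k) q"
    for a :: "real^('n + 'n)" and d :: "('b, 'm::finite) chart" and \<zeta> q
    by (simp add: real_vec_sum of_real_vmult real_vec_scaleR fun_eq_iff)
  have Bd: "B k g = real_vec d (lcoeff d (\<eta> k) (snd d g)) g" if "d \<in> A" "g \<in> fst d" for k d g
    by (rule left_inv_coord[OF B(2) \<eta> that])
  obtain \<theta> where \<theta>: "lcoeff c \<theta> ?x = v" using lcoeff_surj[OF c(1) x] by blast
  \<comment> \<open>A linear relation between invariant fields at one point is the relation between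
    their vectors at the identity, hence does not depend on the point.\<close>
  have comb: "real_vec d (lcoeff d \<theta> (snd d g)) g = (\<lambda>f. \<Sum>k\<in>UNIV. of_real (a $ k) * B k g f)
      \<longleftrightarrow> \<theta> = (\<Sum>k\<in>UNIV. of_real (a $ k) *s \<eta> k)" if d: "d \<in> A" "g \<in> fst d" for d g and a :: "real^('n + 'n)"
  proof -
    have y: "snd d g \<in> snd d ` fst d" using d by simp
    have "(\<Sum>k\<in>UNIV. of_real (a $ k) *s lcoeff d (\<eta> k) (snd d g)) = lcoeff d (\<Sum>k\<in>UNIV. of_real (a $ k) *s \<eta> k) (snd d g)"
      by (simp only: lcoeff_sum[OF d(1) y] lcoeff_scale[OF d(1) y])
    then show ?thesis
      unfolding Bd[OF d] lin real_vec_inject[OF d] using lcoeff_inj[OF d(1) y] by auto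
  qed
  have "TR_field A (left_field \<theta>)"
    unfolding TR_field_def
  proof
    fix g assume "g \<in> points A"
    then obtain d where d: "d \<in> A" "g \<in> fst d" using chart_at by blast
    show "left_field \<theta> g \<in> TR_space A g"
      unfolding TR_space_eq[OF d] left_field_coord[OF d] by blast
  qed
  from basis[OF this left_inv_left_field]
  have "\<exists>!a::real^('n + 'n). \<forall>g\<in>points A. left_field \<theta> g = (\<lambda>f. \<Sum>k\<in>UNIV. of_real (a $ k) * B k g f)" .
  moreover have "(\<forall>g\<in>points A. left_field \<theta> g = (\<lambda>f. \<Sum>k\<in>UNIV. of_real (a $ k) * B k g f))
      \<longleftrightarrow> \<theta> = (\<Sum>k\<in>UNIV. of_real (a $ k) *s \<eta> k)" (is "?L \<longleftrightarrow> ?R") for a :: "real^('n + 'n)"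
  proof
    assume ?L
    then have "left_field \<theta> e = (\<lambda>f. \<Sum>k\<in>UNIV. of_real (a $ k) * B k e f)" using e_points by blast
    then show ?R unfolding left_field_coord[OF ce] comb[OF ce] .
  next
    assume R: ?R
    show ?L
    proof
      fix g assume "g \<in> points A"
      then obtain d where d: "d \<in> A" "g \<in> fst d" using chart_at by blast
      show "left_field \<theta> g = (\<lambda>f. \<Sum>k\<in>UNIV. of_real (a $ k) * B k g f)"
        unfolding left_field_coord[OF d] comb[OF d] by (rule R)
    qed
  qed
  ultimately have ex1: "\<exists>!a::real^('n + 'n). \<theta> = (\<Sum>k\<in>UNIV. of_real (a $ k) *s \<eta> k)" by simp
  then obtain a :: "real^('n + 'n)" where a: "\<theta> = (\<Sum>k\<in>UNIV. of_real (a $ k) *s \<eta> k)" by blast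
  have "real_frame_coord B ?y = a"
    unfolding real_frame_coord_def fst_conv snd_conv
      comb[OF c, unfolded \<theta>] by (rule the_equality) (use ex1 a in blast)+
  then have "canonical_spray A B ?y = real_vec (TR_chart A c)
      (\<Sum>k\<in>UNIV. of_real (a $ k) *s vpair (lcoeff c (\<eta> k) ?x) (FD (lcoeff c (\<eta> k)) ?x v)) ?y"
    unfolding lin[symmetric] by (simp add: canonical_spray_def fun_eq_iff lift_left_inv[OF B(2) \<eta> c])
  also have "(\<Sum>k\<in>UNIV. of_real (a $ k) *s vpair (lcoeff c (\<eta> k) ?x) (FD (lcoeff c (\<eta> k)) ?x v))
      = vpair v (FD (lcoeff c \<theta>) ?x v)"
    unfolding vpair_scale vpair_sum FD_lcoeff_sum[OF c(1) x, symmetric] lcoeff_scale[OF c(1) x, symmetric]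
      lcoeff_sum[OF c(1) x, symmetric] a[symmetric] \<theta> ..
  finally show ?thesis using scoeff_eq[OF c(1) x \<theta>] by simp
qed

text \<open>\<open>circ_map\<close> preserves base point and components, hence is injective on
  \<open>T10 A\<close>; so the inverse in \<open>field_on_TM\<close> yields the (1,0) vector with
  the same components.\<close>

lemma field_on_TM_eq:
  assumes Z: "Z (p, t10 c v p) = t10 (T10_chart A c) a (p, t10 c v p)" and c: "c \<in> A" "p \<in> fst c"
  shows "field_on_TM A Z (p, real_vec c v p) = real_vec (TR_chart A c) a (p, real_vec c v p)"
proof -
  have "inj_on circ_map (T10 A)"
  proof (rule inj_onI)
    fix y z assume y: "y \<in> T10 A" and z: "z \<in> T10 A" and eq: "circ_map y = circ_map z"
    then have fst: "fst y = fst z" by (simp add: circ_map_def)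
    have "fst y \<in> points A" using y by (auto simp: T10_def)
    then obtain d where d: "d \<in> A" "fst y \<in> fst d" using chart_at by blast
    obtain u where u: "y = (fst y, t10 d u (fst y))" by (rule T10_E[OF y d])
    obtain w where w: "z = (fst z, t10 d w (fst z))" by (rule T10_E[OF z d(1)]) (use d fst in auto)
    have "real_vec d u (fst y) = real_vec d w (fst y)"
      using eq circ_map_t10[of "fst y" d u] circ_map_t10[of "fst z" d w] u w fst by simp
    then show "y = z" using real_vec_inject[OF d] u w fst by simp
  qed
  then have "inv_into (T10 A) circ_map (p, real_vec c v p) = (p, t10 c v p)"
    by (rule inv_into_f_eq) (rule t10_mem[OF c] circ_map_t10)+
  then show ?thesis using Z circ_TM_t10[OF c] by (simp add: field_on_TM_def)
qed

text \<open>In a bundle chart the components are \<open>v\<close> and \<open>scoeff\<close>, jointly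
  holomorphic by \<open>holo_scoeff\<close>. The value \<open>v = 0\<close> is included, so the
  field is holomorphic across the zero section.\<close>

lemma holomorphic_field_spray:
  assumes Z: "\<And>c p v. c \<in> A \<Longrightarrow> p \<in> fst c \<Longrightarrow>
    Z (p, t10 c v p) = t10 (T10_chart A c) (vpair v (scoeff c (snd c p) v)) (p, t10 c v p)"
  shows "holomorphic_field (T10_atlas A) Z"
proof -
  interpret T10: holo_atlas "T10_atlas A" by (rule holo_atlas_T10)
  have "Z y \<in> T10_space (T10_atlas A) y" if y: "y \<in> points (T10_atlas A)" for y
  proof -
    obtain c where c: "c \<in> A" "y \<in> fst (T10_chart A c)" using y by (auto simp: points_def T10_atlas_def)
    then have y': "y \<in> T10 A" "fst y \<in> fst c" by (auto simp: T10_chart_def)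
    obtain v where v: "y = (fst y, t10 c v (fst y))" by (rule T10_E[OF y'(1) c(1) y'(2)])
    show ?thesis
      unfolding T10.T10_space_eq[OF T10_chart_mem[OF c(1)] c(2)]
      using Z[OF c(1) y'(2), of v] v by (metis rangeI)
  qed
  moreover have "holo_on (\<lambda>x. \<chi> i. Z (chart_inv k x) (\<lambda>q. snd k q $ i)) (snd k ` fst k)"
    if k: "k \<in> T10_atlas A" for k
  proof -
    obtain c where c: "c \<in> A" "k = T10_chart A c" using k by (auto simp: T10_atlas_def)
    let ?P = "{q :: 'n cpair. vfst q \<in> snd c ` fst c}"
    have img: "snd k ` fst k = ?P" using T10_chart_img[OF c(1), of UNIV] c(2) by simp
    have "holo_on (\<lambda>x :: 'n cpair. vpair (vsnd x) (scoeff c (vfst x) (vsnd x)) :: 'n cpair) ?P"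
      by (intro holo_on_vpair holo_on_vsnd holo_scoeff[OF c(1)])
    then show ?thesis
      unfolding img
    proof (rule holo_on_cong[OF _ open_vfst_vimage[OF open_img[OF c(1)]]])
      fix x assume "x \<in> ?P"
      then have x: "vfst x \<in> snd c ` fst c" by simp
      let ?p = "chart_inv c (vfst x)"
      have p: "?p \<in> fst c" "snd c ?p = vfst x" using chart_inv_into[OF x] chart_inv_right[OF x] .
      have "Z (chart_inv k x) = t10 k (vpair (vsnd x) (scoeff c (vfst x) (vsnd x))) (?p, t10 c (vsnd x) ?p)"
        using Z[OF c(1) p(1), of "vsnd x"] T10_chart_inv[OF c(1) x] c(2) p(2) by simp
      then show "vpair (vsnd x) (scoeff c (vfst x) (vsnd x)) = (\<chi> i. Z (chart_inv k x) (\<lambda>q. snd k q $ i))"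
        using T10.t10_coord[OF k, of "(?p, t10 c (vsnd x) ?p)"] t10_in_chart[OF c(1) p(1)] c(2)
        by (simp add: vec_eq_iff)
    qed
  qed
  ultimately show ?thesis by (simp add: holomorphic_field_def T10_field_def)
qed

end

section \<open>Complex Lie groups\<close>

text \<open>\<open>holo_map\<close> offers some charts around each pair of points, whereas
  \<open>lie_charts\<close> demands arbitrary ones. Transition maps before and after the product
  bridge the difference on a suitably shrunk open set.\<close>

lemma complex_lie_group_lie_charts:
  fixes A :: "('a, 'n::finite) atlas"
  assumes G: "complex_lie_group X A G"
  shows "lie_charts A X (mult G) (one G)"
proof -
  have man: "complex_manifold X A" and grp: "group G" and car: "carrier G = points A"
    and hm: "holo_map (prod_atlas A A) A (\<lambda>(g, h). mult G g h)"
    using G by (auto simp: complex_lie_group_def)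
  interpret group G by (rule grp)
  interpret holo_atlas A by (rule complex_manifold_holo_atlas(1)[OF man])
  show ?thesis
  proof (unfold_locales, goal_cases)
    case 1
    then show ?case using man by (simp add: complex_manifold_def)
  next
    case 2
    then show ?case using man by (simp add: complex_manifold_def)
  next
    case (3 c S)
    then show ?case by (rule complex_manifold_holo_atlas(2)[OF man])
  next
    case (9 p)
    then have p: "p \<in> carrier G" by (simp add: car)
    show ?case unfolding car[symmetric] using inv_closed[OF p] r_inv[OF p] l_inv[OF p] by blast
  next
    case (10 c d k g h)
    let ?mul = "\<lambda>z. mult G (fst z) (snd z)"
    have gh: "(g, h) \<in> points (prod_atlas A A)"
      using 10 by (force simp: points_def prod_atlas_def)
    obtain pc k' W where W: "pc \<in> prod_atlas A A" "k' \<in> A" "open W" "W \<subseteq> snd pc ` fst pc" "(g, h) \<in> fst pc"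
      "snd pc (g, h) \<in> W" "\<forall>x\<in>W. ?mul (chart_inv pc x) \<in> fst k'" "holo_on (snd k' \<circ> ?mul \<circ> chart_inv pc) W"
      using bspec[OF hm[unfolded holo_map_def] gh] unfolding split_def by blast
    obtain c' d' where cd: "c' \<in> A" "d' \<in> A"
      and pc: "pc = (fst c' \<times> fst d', \<lambda>p. \<chi> k. case k of Inl i \<Rightarrow> snd c' (fst p) $ i | Inr j \<Rightarrow> snd d' (snd p) $ j)"
      using W(1) by (auto simp: prod_atlas_def)
    have pcs: "snd pc z = vpair (snd c' (fst z)) (snd d' (snd z))" for z
      by (simp add: pc vpair_def)
    have g': "g \<in> fst c'" and h': "h \<in> fst d'" using W(5) by (auto simp: pc)
    have pcinj: "inj_on (snd pc) (fst pc)"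
      using inj[OF cd(1)] inj[OF cd(2)] unfolding inj_on_def pcs vpair_eq_iff by (auto simp: pc)
    have ci_pc: "chart_inv pc (vpair (snd c' u) (snd d' w)) = (u, w)" if "u \<in> fst c'" "w \<in> fst d'" for u w
      using chart_inv_left[OF pcinj, of "(u, w)"] that unfolding pcs by (simp add: pc)
    let ?D = "{q :: 'n cpair. vfst q \<in> snd c ` (fst c \<inter> fst c')} \<inter> {q. vsnd q \<in> snd d ` (fst d \<inter> fst d')}"
    \<comment> \<open>Passes from the prescribed charts \<open>c\<close>, \<open>d\<close> to the
      factors \<open>c'\<close>, \<open>d'\<close> of the product chart \<open>pc\<close>.\<close>
    let ?T = "\<lambda>q :: 'n cpair. vpair ((snd c' \<circ> chart_inv c) (vfst q)) ((snd d' \<circ> chart_inv d) (vsnd q)) :: 'n cpair"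
    let ?m = "snd k' \<circ> ?mul \<circ> chart_inv pc"
    have D: "open ?D"
      by (rule open_Int[OF open_vfst_vimage[OF open_overlap[OF 10(1) cd(1)]]
            open_vsnd_vimage[OF open_overlap[OF 10(2) cd(2)]]])
    have hT: "holo_on ?T ?D"
      by (intro holo_on_vpair holo_on_compose[OF holo_on_vfst holo_trans[OF 10(1) cd(1)]]
          holo_on_compose[OF holo_on_vsnd holo_trans[OF 10(2) cd(2)]]) auto
    define \<Omega>1 where "\<Omega>1 = ?D \<inter> ?T -` W"
    have O1: "open \<Omega>1"
      unfolding \<Omega>1_def by (rule continuous_open_preimage[OF holo_on_continuous[OF hT] D W(3)])
    have hmT: "holo_on (\<lambda>q. ?m (?T q)) \<Omega>1"
      by (rule holo_on_compose[OF holo_on_subset[OF hT] W(8)]) (auto simp: \<Omega>1_def)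
    have val: "chart_inv pc (?T q) = (chart_inv c (vfst q), chart_inv d (vsnd q))"
      "chart_inv c (vfst q) \<in> fst c" "chart_inv d (vsnd q) \<in> fst d"
      "vfst q \<in> snd c ` fst c" "vsnd q \<in> snd d ` fst d" if "q \<in> ?D" for q
      using that ci_pc 10(1,2) by auto
    \<comment> \<open>The second shrinking: the product must lie in \<open>k\<close> as well as in
      \<open>k'\<close>, so that the transition map between them applies.\<close>
    define \<Omega> where "\<Omega> = \<Omega>1 \<inter> (\<lambda>q. ?m (?T q)) -` (snd k' ` (fst k' \<inter> fst k))"
    have O: "open \<Omega>"
      unfolding \<Omega>_def
      by (rule continuous_open_preimage[OF holo_on_continuous[OF hmT] O1 open_overlap[OF W(2) 10(3)]])
    have in_k': "mult G (chart_inv c (vfst q)) (chart_inv d (vsnd q)) \<in> fst k'" if "q \<in> \<Omega>1" for q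
      using that W(7) val(1)[of q] unfolding \<Omega>1_def by fastforce
    have mT: "?m (?T q) = snd k' (mult G (chart_inv c (vfst q)) (chart_inv d (vsnd q)))" if "q \<in> \<Omega>1" for q
      using that val(1)[of q] unfolding \<Omega>1_def by simp
    have in_k: "mult G (chart_inv c (vfst q)) (chart_inv d (vsnd q)) \<in> fst k" if q: "q \<in> \<Omega>" for q
    proof -
      have q1: "q \<in> \<Omega>1" using q by (simp add: \<Omega>_def)
      obtain u where u: "?m (?T q) = snd k' u" "u \<in> fst k'" "u \<in> fst k" using q unfolding \<Omega>_def by blast
      then have "mult G (chart_inv c (vfst q)) (chart_inv d (vsnd q)) = u"
        using mT[OF q1] in_k'[OF q1] inj[OF W(2)] by (auto simp: inj_on_def)
      then show ?thesis using u by simp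
    qed
    have "holo_on (\<lambda>q. (snd k \<circ> chart_inv k') (?m (?T q))) \<Omega>"
      by (rule holo_on_compose[OF holo_on_subset[OF hmT] holo_trans[OF W(2) 10(3)]]) (auto simp: \<Omega>_def)
    then have "holo_on (\<lambda>q. snd k (mult G (chart_inv c (vfst q)) (chart_inv d (vsnd q)))) \<Omega>"
    proof (rule holo_on_cong[OF _ O])
      fix q assume "q \<in> \<Omega>"
      then have q1: "q \<in> \<Omega>1" by (simp add: \<Omega>_def)
      show "(snd k \<circ> chart_inv k') (?m (?T q)) = snd k (mult G (chart_inv c (vfst q)) (chart_inv d (vsnd q)))"
        unfolding mT[OF q1] using in_k'[OF q1] W(2) by simp
    qed
    moreover have "vpair (snd c g) (snd d h) \<in> \<Omega>"
    proof -
      let ?q = "vpair (snd c g) (snd d h) :: 'n cpair"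
      have T: "?T ?q = snd pc (g, h)" using 10 by (simp add: pcs)
      then have q1: "?q \<in> \<Omega>1" using 10 g' h' W(6) by (simp add: \<Omega>1_def)
      then show ?thesis using mT[OF q1] in_k'[OF q1] 10 by (auto simp: \<Omega>_def)
    qed
    moreover have "vfst q \<in> snd c ` fst c \<and> vsnd q \<in> snd d ` fst d \<and> mult G (chart_inv c (vfst q)) (chart_inv d (vsnd q)) \<in> fst k"
      if "q \<in> \<Omega>" for q
      using val(4,5)[of q] in_k[OF that] that by (simp add: \<Omega>_def \<Omega>1_def)
    ultimately show ?case using O by blast
  qed (auto simp: m_assoc simp flip: car)
qed

theorem theorem1p2:
  fixes X :: "'a topology"
    and A :: "('a, 'n::finite) atlas"
    and G :: "('a, 'b) monoid_scheme"
    and F :: "'a \<times> 'a tvec \<Rightarrow> real"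
    and e :: "'n \<Rightarrow> 'a tvec"
    and U V :: "'n \<Rightarrow> 'a tfield"
  assumes G: "complex_lie_group X A G"
    and F: "complex_finsler_metric A F" "left_invariant_metric A G F"
    and e: "complex_basis A \<one>\<^bsub>G\<^esub> e"
    and U: "\<And>i. T10_field A (U i)" "\<And>i. left_invariant A G (\<lambda>g. circ (U i g))"
           "\<And>i. U i \<one>\<^bsub>G\<^esub> = e i"
    and V: "\<And>i. T10_field A (V i)" "\<And>i. right_invariant A G (\<lambda>g. circ (V i g))"
           "\<And>i. V i \<one>\<^bsub>G\<^esub> = e i"
  shows "holomorphic_field (T10_atlas A) (frame_spray A U) \<and>
    (\<forall>w\<in>T10 A. frame_spray A U w = frame_spray A V w) \<and>
    (\<forall>c\<in>A. \<forall>w\<in>T10 A \<inter> slit. fst w \<in> fst c \<longrightarrow> complex_spray A F c w = frame_spray A U w) \<and>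
    (\<forall>B. left_invariant_real_basis A G B \<longrightarrow>
       (\<forall>y\<in>TR A. field_on_TM A (frame_spray A U) y = canonical_spray A B y))"
proof -
  have car: "carrier G = points A" using G by (simp add: complex_lie_group_def)
  interpret lie_charts A X "mult G" "one G" by (rule complex_lie_group_lie_charts[OF G])
  interpret opp: lie_charts A X "\<lambda>x y. mult G y x" "one G" by (rule lie_charts_opp)
  have left_inv: "left_inv Z \<longleftrightarrow> left_invariant A G Z" for Z
    by (simp add: left_inv_def left_invariant_def car)
  have right_inv: "opp.left_inv Z \<longleftrightarrow> right_invariant A G Z" for Z
    by (simp add: opp.left_inv_def right_invariant_def car)
  have SU: "frame_spray A U (p, t10 c v p) = t10 (T10_chart A c) (vpair v (scoeff c (snd c p) v)) (p, t10 c v p)"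
    if "c \<in> A" "p \<in> fst c" for c p v
    by (rule frame_spray_eq[OF U(1) _ U(3) e that]) (simp add: left_inv U(2))
  have SV: "frame_spray A V (p, t10 c v p) = t10 (T10_chart A c) (vpair v (scoeff c (snd c p) v)) (p, t10 c v p)"
    if "c \<in> A" "p \<in> fst c" for c p v
    \<comment> \<open>The right invariant frame is treated in the opposite group, whose spray
      coefficients are the same.\<close>
    unfolding scoeff_opp[OF that, symmetric]
    by (rule opp.frame_spray_eq[OF V(1) _ V(3) e that]) (simp add: right_inv V(2))
  have UV: "frame_spray A U w = frame_spray A V w" if w: "w \<in> T10 A" for w
  proof -
    have "fst w \<in> points A" using w by (auto simp: T10_def)
    then obtain c where c: "c \<in> A" "fst w \<in> fst c" using chart_at by blast
    obtain v where v: "w = (fst w, t10 c v (fst w))" by (rule T10_E[OF w c])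
    show ?thesis using SU[OF c, of v] SV[OF c, of v] v by simp
  qed
  have spray: "complex_spray A F c w = frame_spray A U w" if c: "c \<in> A" and w: "w \<in> T10 A" "w \<in> slit" and wc: "fst w \<in> fst c" for c w
  proof -
    obtain v where v: "w = (fst w, t10 c v (fst w))" by (rule T10_E[OF w(1) c wc])
    have "v \<noteq> 0"
    proof
      assume "v = 0"
      then have "snd w = (\<lambda>f. 0)" using v t10_0 by (metis ext snd_conv)
      then show False using w(2) by (simp add: slit_def)
    qed
    \<comment> \<open>Right translation by \<open>g\<close> in the opposite group is left
      translation by \<open>g\<close> in \<open>G\<close>, so the invariance of the metric has the
      required form.\<close>
    from opp.finsler_spray[OF F(1) _ c wc this]
    have "complex_spray A F c (fst w, t10 c v (fst w))
        = t10 (T10_chart A c) (vpair v (opp.scoeff c (snd c (fst w)) v)) (fst w, t10 c v (fst w))"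
      using F(2) by (simp add: left_invariant_metric_def car)
    then show ?thesis using SU[OF c wc, of v] scoeff_opp[OF c wc, of v] v by simp
  qed
  have canon: "field_on_TM A (frame_spray A U) y = canonical_spray A B y"
    if B: "left_invariant_real_basis A G B" and y: "y \<in> TR A" for B y
  proof -
    have "fst y \<in> points A" using y by (auto simp: TR_def)
    then obtain c where c: "c \<in> A" "fst y \<in> fst c" using chart_at by blast
    obtain v where v: "y = (fst y, real_vec c v (fst y))" by (rule TR_E[OF y c])
    have "canonical_spray A B (fst y, real_vec c v (fst y))
        = real_vec (TR_chart A c) (vpair v (scoeff c (snd c (fst y)) v)) (fst y, real_vec c v (fst y))"
      by (rule canonical_spray_eq[OF _ _ _ c]) (use B in \<open>simp_all add: left_invariant_real_basis_def left_inv car\<close>)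
    then show ?thesis using field_on_TM_eq[of "frame_spray A U" "fst y" c v, OF SU[OF c] c] v by simp
  qed
  show ?thesis
    using holomorphic_field_spray[OF SU] UV spray canon by blast
qed

end
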